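(* Let $\widetilde D$ be a connected extended coroot diagram with node set $\widetilde\Delta^\vee$, let $\mathbf n=n_0\mathbf g:\widetilde\Delta\to\mathbf N$ for a positive integer $n_0$, where $\mathbf g(a)=g_a$ are the coroot integers, and let $k\ge1$ be an integer dividing at least one of the $\mathbf n(a)$. Then the diagram $\widetilde D(\mathbf n,k)$ is the extended coroot diagram of a (possibly non-reduced) root system.
   Context: A connected extended coroot diagram is the extended coroot diagram of an irreducible, possibly non-reduced, root system: with simple roots $\Delta$, $\tilde a$ minus the highest root, $\widetilde\Delta=\Delta\cup\{\tilde a\}$, the nodes are the coroots $\widetilde\Delta^\vee$ inverse to $\widetilde\Delta$; distinct nodes $u,v$ are joined iff they are not orthogonal, by a bond of multiplicity $|u|^2/|v|^2$ where $|u|\ge|v|$, with arrow toward the shorter one if the multiplicity exceeds one; $\widetilde A_1$ is drawn as two nodes joined by two single bonds. By convention the extended coroot diagram of the zero root system is a single node. The coroot integers $g_a$ are the relatively prime positive integers with $\sum_{a\in\widetilde\Delta}g_aa^\vee=0$. Let $\ell:\widetilde\Delta^\vee\to\mathbf R^+$ be a length function: if $v,v'$ are joined and $\ell(v)\ge\ell(v')$ then the bond multiplicity is $\ell(v)^2/\ell(v')^2$ and the arrow (if any) points toward $v'$ (for $\widetilde A_1$ both lengths are equal). Let $\widetilde I(\mathbf n,k)=\{a\in\widetilde\Delta:k\nmid\mathbf n(a)\}$, with corresponding set of nodes $\widetilde I^\vee(\mathbf n,k)$, and let $\widetilde D'(\mathbf n,k)$ be the full subdiagram of $\widetilde D$ on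 $\widetilde I^\vee(\mathbf n,k)$. Every $v\in\widetilde\Delta^\vee-\widetilde I^\vee(\mathbf n,k)$ has exactly one of the following types: Type $\infty$: $v$ is the only element of $\widetilde\Delta^\vee-\widetilde I^\vee(\mathbf n,k)$. If not of Type $\infty$: Type 1: $v$ is joined to no node of $\widetilde D'(\mathbf n,k)$. Type 2: either $v$ is joined to exactly two components of $\widetilde D'(\mathbf n,k)$, each of type $A_1$, with nodes $v_1,v_2$, and $\ell(v)\le\min(\ell(v_1),\ell(v_2))$; or $v$ is joined to exactly one node $v_1$ of $\widetilde D'(\mathbf n,k)$ and $\ell(v)<\ell(v_1)$. Type 3: $v$ is joined to exactly two components, each of type $A_2$. Type 4: $v$ is joined to exactly two components, and either both are of type $A_1$ with nodes $v_1,v_2$ and $\ell(v)>\min(\ell(v_1),\ell(v_2))$, or both are of type $A_3$, or one is of type $A_3$ and the other of type $A_1$. Define $\ell_k(v)=\ell(v)/\sqrt r$ if $v$ is of Type $r$. $\widetilde D(\mathbf n,k)$ is the diagram with node set $\widetilde\Delta^\vee-\widetilde I^\vee(\mathbf n,k)$ such that: (a) nodes $v\neq v'$ are joined in $\widetilde D(\mathbf n,k)$ iff they are joined in $\widetilde D$ or both are joined by bonds of $\widetilde D$ to the same component of $\widetilde D'(\mathbf n,k)$; (b) if $v\neq v'$ are joined in $\widetilde D(\mathbf n,k)$, neither is joined in $\widetilde D(\mathbf n,k)$ to any other node, and $\ell_k(v)=\ell_k(v')$, then the subdiagram spanned by $v,v'$ is of type $\widetilde A_1$; (c) if $v\neq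 v'$ are joined in $\widetilde D(\mathbf n,k)$, are not as in (b), and $\ell_k(v)\ge\ell_k(v')$, then the multiplicity of the bond is $\ell_k(v)^2/\ell_k(v')^2$ and the arrow (if the multiplicity is greater than one) points toward $v'$. (If there is only one node, $\widetilde D(\mathbf n,k)$ is that single node.) *)

theory Defs
  imports "HOL-Analysis.Analysis" "HOL-Library.Extended_Nat"
begin

section \<open>Root systems\<close>

text \<open>Root systems are crystallographic but need not be reduced. They need not span the
  ambient space: a root system is regarded as living in its own span.\<close>

definition coroot :: "'a::euclidean_space \<Rightarrow> 'a" where
  "coroot a = (2 / (a \<bullet> a)) *\<^sub>R a"

definition root_system :: "'a::euclidean_space set \<Rightarrow> bool" where
  "root_system \<Phi> \<longleftrightarrow> finite \<Phi> \<and> 0 \<notin> \<Phi> \<and>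
     (\<forall>a\<in>\<Phi>. \<forall>b\<in>\<Phi>. b - (b \<bullet> coroot a) *\<^sub>R a \<in> \<Phi>) \<and>
     (\<forall>a\<in>\<Phi>. \<forall>b\<in>\<Phi>. b \<bullet> coroot a \<in> \<int>)"

definition irreducible_root_system :: "'a::euclidean_space set \<Rightarrow> bool" where
  "irreducible_root_system \<Phi> \<longleftrightarrow> root_system \<Phi> \<and> \<Phi> \<noteq> {} \<and>
     (\<forall>A B. A \<union> B = \<Phi> \<and> A \<inter> B = {} \<and> (\<forall>a\<in>A. \<forall>b\<in>B. a \<bullet> b = 0) \<longrightarrow> A = {} \<or> B = {})"

definition simple_roots :: "'a::euclidean_space set \<Rightarrow> 'a set \<Rightarrow> bool" where
  "simple_roots \<Phi> \<Delta> \<longleftrightarrow> \<Delta> \<subseteq> \<Phi> \<and> independent \<Delta> \<and>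
     (\<forall>b\<in>\<Phi>. \<exists>c :: 'a \<Rightarrow> nat. b = (\<Sum>a\<in>\<Delta>. real (c a) *\<^sub>R a) \<or> b = - (\<Sum>a\<in>\<Delta>. real (c a) *\<^sub>R a))"

definition highest_root :: "'a::euclidean_space set \<Rightarrow> 'a set \<Rightarrow> 'a \<Rightarrow> bool" where
  "highest_root \<Phi> \<Delta> \<theta> \<longleftrightarrow> \<theta> \<in> \<Phi> \<and>
     (\<forall>b\<in>\<Phi>. \<exists>c :: 'a \<Rightarrow> nat. \<theta> - b = (\<Sum>a\<in>\<Delta>. real (c a) *\<^sub>R a))"

text \<open>\<open>extended_simple_roots \<Phi> \<Delta> E\<close>: \<open>E\<close> consists of the simple roots \<open>\<Delta>\<close> of the irreducible
  root system \<open>\<Phi>\<close> and of minus its highest root. The zero root system is the empty set; taking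
  \<open>E = {0}\<close> for it implements the convention that its extended coroot diagram is a single node
  (note that \<open>coroot 0 = 0\<close>).\<close>

definition extended_simple_roots :: "'a::euclidean_space set \<Rightarrow> 'a set \<Rightarrow> 'a set \<Rightarrow> bool" where
  "extended_simple_roots \<Phi> \<Delta> E \<longleftrightarrow>
     (irreducible_root_system \<Phi> \<and> simple_roots \<Phi> \<Delta> \<and>
        (\<exists>\<theta>. highest_root \<Phi> \<Delta> \<theta> \<and> E = insert (- \<theta>) \<Delta>)) \<or>
     (\<Phi> = {} \<and> \<Delta> = {} \<and> E = {0})"

definition coroot_integers :: "'a::euclidean_space set \<Rightarrow> ('a \<Rightarrow> nat) \<Rightarrow> bool" where
  "coroot_integers E g \<longleftrightarrow> (\<forall>a\<in>E. 0 < g a) \<and> Gcd (g ` E) = 1 \<and>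
     (\<Sum>a\<in>E. real (g a) *\<^sub>R coroot a) = 0"


section \<open>Diagrams\<close>

text \<open>Multiplicities are real numbers because that of a bond of the diagram constructed below
  is a quotient of squared lengths. \<open>Two_Single_Bonds\<close> is the special bond of the diagram of
  affine type \<open>A\<^sub>1\<close>; it differs from \<open>Bond 2\<close>. \<open>arrow D u v\<close> means that the bond between \<open>u\<close> and \<open>v\<close>
  carries an arrow pointing toward \<open>v\<close>. Values of \<open>bond\<close> and \<open>arrow\<close> outside the nodes
  are irrelevant.\<close>

datatype bond_kind = No_Bond | Bond real | Two_Single_Bonds

record 'a diagram =
  nodes :: "'a set"
  bond :: "'a \<Rightarrow> 'a \<Rightarrow> bond_kind"
  arrow :: "'a \<Rightarrow> 'a \<Rightarrow> bool"

definition joined :: "'a diagram \<Rightarrow> 'a \<Rightarrow> 'a \<Rightarrow> bool" where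
  "joined D u v \<longleftrightarrow> u \<in> nodes D \<and> v \<in> nodes D \<and> u \<noteq> v \<and> bond D u v \<noteq> No_Bond"

definition diagram_iso :: "'a diagram \<Rightarrow> 'b diagram \<Rightarrow> bool" where
  "diagram_iso D D' \<longleftrightarrow> (\<exists>f. bij_betw f (nodes D) (nodes D') \<and>
     (\<forall>u\<in>nodes D. \<forall>v\<in>nodes D. bond D u v = bond D' (f u) (f v) \<and> arrow D u v = arrow D' (f u) (f v)))"

definition full_subdiagram :: "'a diagram \<Rightarrow> 'a set \<Rightarrow> 'a diagram" where
  "full_subdiagram D S = D\<lparr>nodes := nodes D \<inter> S\<rparr>"

definition diagram_components :: "'a diagram \<Rightarrow> 'a set set" where
  "diagram_components D = {{w. (joined D)\<^sup>*\<^sup>* v w} | v. v \<in> nodes D}"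

definition A_diagram :: "nat \<Rightarrow> nat diagram" where
  "A_diagram m = \<lparr>nodes = {..<m},
     bond = (\<lambda>i j. if i = Suc j \<or> j = Suc i then Bond 1 else No_Bond),
     arrow = (\<lambda>_ _. False)\<rparr>"

definition type_A :: "'a diagram \<Rightarrow> nat \<Rightarrow> 'a set \<Rightarrow> bool" where
  "type_A D m C \<longleftrightarrow> diagram_iso (full_subdiagram D C) (A_diagram m)"

text \<open>Two distinct elements of \<open>E\<close> have opposite coroots exactly when \<open>E\<close> comes from a root system of
  type \<open>A\<^sub>1\<close>; this is the case in which the diagram is drawn with two single bonds.\<close>

definition extended_coroot_diagram :: "'a::euclidean_space set \<Rightarrow> 'a diagram" where
  "extended_coroot_diagram E = \<lparr>nodes = coroot ` E,
     bond = (\<lambda>u v. if u = v \<or> u \<bullet> v = 0 then No_Bond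
                   else if v = - u then Two_Single_Bonds
                   else if norm u \<ge> norm v then Bond ((norm u)\<^sup>2 / (norm v)\<^sup>2)
                   else Bond ((norm v)\<^sup>2 / (norm u)\<^sup>2)),
     arrow = (\<lambda>u v. u \<noteq> v \<and> u \<bullet> v \<noteq> 0 \<and> norm u > norm v)\<rparr>"

definition length_function :: "'a diagram \<Rightarrow> ('a \<Rightarrow> real) \<Rightarrow> bool" where
  "length_function D len \<longleftrightarrow> (\<forall>v\<in>nodes D. 0 < len v) \<and>
     (\<forall>v v'. joined D v v' \<and> len v \<ge> len v' \<longrightarrow>
        (if bond D v v' = Two_Single_Bonds then len v = len v'
         else bond D v v' = Bond ((len v)\<^sup>2 / (len v')\<^sup>2) \<and> \<not> arrow D v' v))"


section \<open>The diagram obtained by removing a set of nodes\<close>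

text \<open>In this section \<open>I\<close> is a set of nodes of \<open>D\<close>, and \<open>full_subdiagram D I\<close> is the diagram
  whose components determine the types of the remaining nodes.\<close>

definition adjacent_components :: "'a diagram \<Rightarrow> 'a set \<Rightarrow> 'a \<Rightarrow> 'a set set" where
  "adjacent_components D I v =
     {C \<in> diagram_components (full_subdiagram D I). \<exists>w\<in>C. joined D v w}"

definition type_inf :: "'a diagram \<Rightarrow> 'a set \<Rightarrow> 'a \<Rightarrow> bool" where
  "type_inf D I v \<longleftrightarrow> nodes D - I = {v}"

definition type1 :: "'a diagram \<Rightarrow> 'a set \<Rightarrow> 'a \<Rightarrow> bool" where
  "type1 D I v \<longleftrightarrow> (\<forall>w\<in>I. \<not> joined D v w)"

definition type2 :: "'a diagram \<Rightarrow> 'a set \<Rightarrow> ('a \<Rightarrow> real) \<Rightarrow> 'a \<Rightarrow> bool" where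
  "type2 D I len v \<longleftrightarrow>
     (\<exists>C1 C2 v1 v2. C1 \<noteq> C2 \<and> adjacent_components D I v = {C1, C2} \<and>
        type_A D 1 C1 \<and> type_A D 1 C2 \<and> v1 \<in> C1 \<and> v2 \<in> C2 \<and> len v \<le> min (len v1) (len v2)) \<or>
     (\<exists>v1. {w \<in> I. joined D v w} = {v1} \<and> len v < len v1)"

definition type3 :: "'a diagram \<Rightarrow> 'a set \<Rightarrow> 'a \<Rightarrow> bool" where
  "type3 D I v \<longleftrightarrow>
     (\<exists>C1 C2. C1 \<noteq> C2 \<and> adjacent_components D I v = {C1, C2} \<and> type_A D 2 C1 \<and> type_A D 2 C2)"

definition type4 :: "'a diagram \<Rightarrow> 'a set \<Rightarrow> ('a \<Rightarrow> real) \<Rightarrow> 'a \<Rightarrow> bool" where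
  "type4 D I len v \<longleftrightarrow>
     (\<exists>C1 C2. C1 \<noteq> C2 \<and> adjacent_components D I v = {C1, C2} \<and>
        ((type_A D 1 C1 \<and> type_A D 1 C2 \<and>
            (\<exists>v1\<in>C1. \<exists>v2\<in>C2. len v > min (len v1) (len v2))) \<or>
         (type_A D 3 C1 \<and> type_A D 3 C2) \<or>
         (type_A D 3 C1 \<and> type_A D 1 C2)))"

definition node_type :: "'a diagram \<Rightarrow> 'a set \<Rightarrow> ('a \<Rightarrow> real) \<Rightarrow> 'a \<Rightarrow> enat \<Rightarrow> bool" where
  "node_type D I len v r \<longleftrightarrow>
     (if type_inf D I v then r = \<infinity>
      else (r = 1 \<and> type1 D I v) \<or> (r = 2 \<and> type2 D I len v) \<or>
           (r = 3 \<and> type3 D I v) \<or> (r = 4 \<and> type4 D I len v))"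

text \<open>Every remaining node has exactly one type when \<open>D\<close> and \<open>I\<close> arise as in
  \<open>diagram_nk\<close> below. The length of a node of type \<open>\<infinity>\<close> is set to \<open>0\<close>; it is never
  used because such a node is the only one.\<close>

definition new_length :: "'a diagram \<Rightarrow> 'a set \<Rightarrow> ('a \<Rightarrow> real) \<Rightarrow> 'a \<Rightarrow> real" where
  "new_length D I len v =
     (case (THE r. node_type D I len v r) of enat m \<Rightarrow> len v / sqrt (real m) | \<infinity> \<Rightarrow> 0)"

definition new_joined :: "'a diagram \<Rightarrow> 'a set \<Rightarrow> 'a \<Rightarrow> 'a \<Rightarrow> bool" where
  "new_joined D I v v' \<longleftrightarrow> v \<in> nodes D - I \<and> v' \<in> nodes D - I \<and> v \<noteq> v' \<and>
     (joined D v v' \<or> adjacent_components D I v \<inter> adjacent_components D I v' \<noteq> {})"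

definition new_diagram :: "'a diagram \<Rightarrow> 'a set \<Rightarrow> ('a \<Rightarrow> real) \<Rightarrow> 'a diagram" where
  "new_diagram D I len = (let l = new_length D I len; J = new_joined D I in
     \<lparr>nodes = nodes D - I,
      bond = (\<lambda>v v'. if \<not> J v v' then No_Bond
                     else if (\<forall>w. J v w \<longrightarrow> w = v') \<and> (\<forall>w. J v' w \<longrightarrow> w = v) \<and> l v = l v'
                       then Two_Single_Bonds
                     else if l v \<ge> l v' then Bond ((l v)\<^sup>2 / (l v')\<^sup>2)
                     else Bond ((l v')\<^sup>2 / (l v)\<^sup>2)),
      arrow = (\<lambda>v v'. J v v' \<and> l v > l v')\<rparr>)"

definition diagram_nk ::
    "'a::euclidean_space set \<Rightarrow> ('a \<Rightarrow> nat) \<Rightarrow> nat \<Rightarrow> ('a \<Rightarrow> real) \<Rightarrow> 'a diagram" where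
  "diagram_nk E n k len =
     new_diagram (extended_coroot_diagram E) (coroot ` {a \<in> E. \<not> k dvd n a}) len"

end

theory Submission
  imports Defs
begin

text \<open>The classification of root systems is avoided. The nodes are vectors \<open>v\<close> whose linear relations
  are spanned by the single relation with the coroot integers as coefficients. After division of \<open>k\<close>
  by a common factor with \<open>n\<^sub>0\<close>, this relation modulo \<open>k\<close> forces every component of the removed
  diagram to be of type \<open>A\<^sub>1\<close> if \<open>k = 2\<close> and of type \<open>A\<^sub>2\<close> if \<open>k = 3\<close>; for \<open>k \<ge> 4\<close> either a single
  node remains or the diagram is that of \<open>E\<^sub>8\<close> with \<open>k = 4\<close>. For \<open>k = 2\<close> and \<open>k = 3\<close> the
  orthogonal projections of the remaining nodes to the complement of the removed ones have squared
  lengths \<open>|v|\<^sup>2 / r\<close>, where \<open>r\<close> is the type of \<open>v\<close>, so that they realise the new diagram. The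
  coefficients of their linear relation are the coroot integers divided by \<open>k\<close>, and a shortest
  projection occurs in it with coefficient 1; vectors with these properties are the extended simple
  coroots of a root system.\<close>

section \<open>Coroots with a one-dimensional space of relations\<close>

text \<open>For distinct nodes \<open>A u v\<close> is minus the Cartan integer
  \<open>u \<bullet> coroot v\<close>. Positivity of \<open>G\<close> makes every proper subset of
  \<open>V\<close> linearly independent. So a nonzero nonnegative combination of a proper subset
  cannot have nonpositive inner product with all its members, and small explicit coefficients then
  pin down the components for \<open>k = 2\<close> and \<open>k = 3\<close>. Pairing the relation
  with a node gives an equation in natural numbers; modulo \<open>k\<close> the remaining nodes drop
  out of it, which leaves a congruence on the removed ones alone.

  The obstacle on the way back is to produce a root system from vectors. An orbit under reflections
  offers no direct control of finiteness or signs, so roots are cut out by two lattice conditions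
  and a length condition. Coefficient 1 on a shortest vector puts it and its coroot into the
  lattices spanned by the others. Non-reducedness is visible only at the coroot \<open>v0\<close> of
  minus the highest root, where \<open>G\<close> may be 2 instead of 1.\<close>

locale affine_coroots =
  fixes V :: "'a::euclidean_space set" and G :: "'a \<Rightarrow> nat" and A :: "'a \<Rightarrow> 'a \<Rightarrow> nat"
  assumes finite_V: "finite V" and zero_notin_V: "0 \<notin> V"
    and G_pos: "\<And>v. v \<in> V \<Longrightarrow> 0 < G v"
    and G_sum: "(\<Sum>v\<in>V. real (G v) *\<^sub>R v) = 0"
    and rigid: "\<And>c. (\<Sum>v\<in>V. c v *\<^sub>R v) = 0 \<Longrightarrow> \<exists>t. \<forall>v\<in>V. c v = t * real (G v)"
    and A_inner: "\<And>u v. u \<in> V \<Longrightarrow> v \<in> V \<Longrightarrow> u \<noteq> v \<Longrightarrow> 2 * (u \<bullet> v) = - real (A u v) * (v \<bullet> v)"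
    and A_refl: "\<And>v. A v v = 0"
begin

lemma inner_pos: "v \<in> V \<Longrightarrow> 0 < v \<bullet> v"
  using zero_notin_V by auto

lemma A_sym: "u \<in> V \<Longrightarrow> v \<in> V \<Longrightarrow> real (A u v) * (v \<bullet> v) = real (A v u) * (u \<bullet> u)"
proof (cases "u = v")
  case False
  assume "u \<in> V" "v \<in> V"
  then show ?thesis
    using A_inner[of u v] A_inner[of v u] False by (simp add: inner_commute)
qed simp

lemma A_pos_sym: "u \<in> V \<Longrightarrow> v \<in> V \<Longrightarrow> 0 < A u v \<longleftrightarrow> 0 < A v u"
  using A_sym[of u v] inner_pos[of u] inner_pos[of v]
  by (metis less_numeral_extra(3) mult_eq_0_iff neq0_conv of_nat_eq_0_iff)

lemma A_eq_0_iff: "u \<in> V \<Longrightarrow> v \<in> V \<Longrightarrow> u \<noteq> v \<Longrightarrow> A u v = 0 \<longleftrightarrow> u \<bullet> v = 0"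
  using A_inner[of u v] inner_pos[of v] by auto

lemma A_pos_neq: "0 < A u v \<Longrightarrow> u \<noteq> v"
  using A_refl by force

lemma inner_nonpos: "u \<in> V \<Longrightarrow> v \<in> V \<Longrightarrow> u \<noteq> v \<Longrightarrow> u \<bullet> v \<le> 0"
  using A_inner[of u v] inner_pos[of v]
  by (smt (verit, best) mult_nonneg_nonneg of_nat_0_le_iff mult_minus_left)

lemma inner_eq: "u \<in> V \<Longrightarrow> v \<in> V \<Longrightarrow> u \<noteq> v \<Longrightarrow> u \<bullet> v = - real (A u v) * (v \<bullet> v) / 2"
  using A_inner[of u v] by simp

text \<open>Every coefficient of the spanning relation is positive, so a relation extended by zero
  from a proper subset is its zero multiple. Proper subdiagrams are thus of finite type.\<close>

lemma indep_proper:
  assumes "S \<subseteq> V" "S \<noteq> V" "(\<Sum>v\<in>S. c v *\<^sub>R v) = 0" "v \<in> S"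
  shows "c v = 0"
proof -
  let ?d = "\<lambda>v. if v \<in> S then c v else 0"
  have "(\<Sum>v\<in>V. ?d v *\<^sub>R v) = (\<Sum>v\<in>S. ?d v *\<^sub>R v)"
    using assms(1) finite_V by (intro sum.mono_neutral_right) auto
  also have "\<dots> = 0" using assms(3) by simp
  finally obtain t where t: "\<And>v. v \<in> V \<Longrightarrow> ?d v = t * real (G v)"
    using rigid[of ?d] by blast
  obtain u where "u \<in> V" "u \<notin> S" using assms by blast
  then have "t = 0" using t[of u] G_pos[of u] by auto
  with t[of v] assms show ?thesis by auto
qed

text \<open>By the hypothesis the combination \<open>y\<close> with coefficients \<open>c\<close>
  has nonpositive inner product with every member of \<open>S\<close>, hence with itself, so
  \<open>y = 0\<close> and independence applies. In use, an explicit \<open>c\<close> that is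
  positive somewhere shows that a configuration cannot occur in a proper subdiagram.\<close>

lemma test_vector:
  fixes c :: "'a \<Rightarrow> nat"
  assumes S: "S \<subseteq> V" "S \<noteq> V"
    and c: "\<And>w. w \<in> S \<Longrightarrow> 2 * c w \<le> (\<Sum>u\<in>S. c u * A u w)"
    and w: "w \<in> S"
  shows "c w = 0"
proof -
  define y where "y = (\<Sum>u\<in>S. real (c u) *\<^sub>R u)"
  have fS: "finite S" using S finite_V finite_subset by blast
  have yw: "y \<bullet> w \<le> 0" if w: "w \<in> S" for w
  proof -
    have wV: "w \<in> V" using w S by auto
    have "2 * (y \<bullet> w) = (\<Sum>u\<in>S. real (c u) * (2 * (u \<bullet> w)))"
      unfolding y_def by (simp add: inner_sum_left sum_distrib_left mult.left_commute)
    also have "\<dots> = real (c w) * (2 * (w \<bullet> w)) + (\<Sum>u\<in>S-{w}. real (c u) * (2 * (u \<bullet> w)))"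
      using fS w by (simp add: sum.remove)
    also have "(\<Sum>u\<in>S-{w}. real (c u) * (2 * (u \<bullet> w))) = (\<Sum>u\<in>S-{w}. - real (c u * A u w) * (w \<bullet> w))"
      using S wV by (intro sum.cong refl) (subst A_inner, auto)
    also have "\<dots> = - (\<Sum>u\<in>S-{w}. real (c u * A u w)) * (w \<bullet> w)"
      by (simp add: sum_distrib_right sum_negf)
    also have "(\<Sum>u\<in>S-{w}. real (c u * A u w)) = (\<Sum>u\<in>S. real (c u * A u w))"
      using fS w A_refl by (simp add: sum.remove[of S w])
    also have "\<dots> = real (\<Sum>u\<in>S. c u * A u w)" by simp
    finally have "2 * (y \<bullet> w) = (real (2 * c w) - real (\<Sum>u\<in>S. c u * A u w)) * (w \<bullet> w)"
      by (simp add: algebra_simps)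
    moreover have "real (2 * c w) \<le> real (\<Sum>u\<in>S. c u * A u w)"
      using c[OF w] by (simp only: of_nat_le_iff)
    ultimately show ?thesis using inner_pos[OF wV]
      by (smt (verit) mult_nonpos_nonneg)
  qed
  have "y \<bullet> y = (\<Sum>u\<in>S. real (c u) * (y \<bullet> u))"
    unfolding y_def by (simp add: inner_sum_right)
  also have "\<dots> \<le> 0" using yw by (intro sum_nonpos) (simp add: mult_nonneg_nonpos)
  finally have "y = 0" by (meson inner_gt_zero_iff not_less)
  then show ?thesis using indep_proper[OF S, of "\<lambda>u. real (c u)" w] w y_def by simp
qed

text \<open>Pairing \<open>G_sum\<close> with \<open>v\<close> and dividing by
  \<open>v \<bullet> v\<close> gives an identity of natural numbers. All arithmetic on
  \<open>G\<close>, exact or modulo \<open>k\<close>, starts here.\<close>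

lemma balance:
  assumes v: "v \<in> V"
  shows "2 * G v = (\<Sum>u\<in>V. G u * A u v)"
proof -
  have "0 = 2 * ((\<Sum>u\<in>V. real (G u) *\<^sub>R u) \<bullet> v)" using G_sum by simp
  also have "\<dots> = (\<Sum>u\<in>V. real (G u) * (2 * (u \<bullet> v)))"
    by (simp add: inner_sum_left sum_distrib_left mult.left_commute)
  also have "\<dots> = real (G v) * (2 * (v \<bullet> v)) + (\<Sum>u\<in>V-{v}. real (G u) * (2 * (u \<bullet> v)))"
    using finite_V v by (simp add: sum.remove)
  also have "(\<Sum>u\<in>V-{v}. real (G u) * (2 * (u \<bullet> v))) = (\<Sum>u\<in>V-{v}. - real (G u * A u v) * (v \<bullet> v))"
    using v by (intro sum.cong refl) (subst A_inner, auto)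
  also have "\<dots> = - (\<Sum>u\<in>V-{v}. real (G u * A u v)) * (v \<bullet> v)"
    by (simp add: sum_distrib_right sum_negf)
  also have "(\<Sum>u\<in>V-{v}. real (G u * A u v)) = (\<Sum>u\<in>V. real (G u * A u v))"
    using finite_V v A_refl by (simp add: sum.remove[of V v])
  finally have "0 = real (G v) * (2 * (v \<bullet> v)) + - (\<Sum>u\<in>V. real (G u * A u v)) * (v \<bullet> v)" .
  then have "(real (2 * G v) - (\<Sum>u\<in>V. real (G u * A u v))) * (v \<bullet> v) = 0"
    unfolding left_diff_distrib by linarith
  then have "real (2 * G v) - (\<Sum>u\<in>V. real (G u * A u v)) = 0"
    using inner_pos[OF v] by (metis mult_eq_0_iff less_irrefl)
  then have "real (2 * G v) = real (\<Sum>u\<in>V. G u * A u v)"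
    by simp
  then show ?thesis by (simp only: of_nat_eq_iff)
qed

lemma balance_remove:
  assumes "v \<in> V" "P \<subseteq> V"
  shows "2 * G v = (\<Sum>u\<in>P. G u * A u v) + (\<Sum>u\<in>V-P. G u * A u v)"
  using balance[OF assms(1)] sum.subset_diff[OF assms(2) finite_V] by (simp add: add.commute)

lemma neighbour_le: "u \<in> V \<Longrightarrow> v \<in> V \<Longrightarrow> G u * A u v \<le> 2 * G v"
  using balance_remove[of v "{u}"] by simp

lemma two_neighbours_le:
  "u \<in> V \<Longrightarrow> w \<in> V \<Longrightarrow> v \<in> V \<Longrightarrow> u \<noteq> w \<Longrightarrow> G u * A u v + G w * A w v \<le> 2 * G v"
  using balance_remove[of v "{u, w}"] by simp

text \<open>If \<open>S\<close> were proper, the balance equations would close up on it, and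
  \<open>G\<close> itself would be a test vector.\<close>

lemma connected_V:
  assumes S: "S \<subseteq> V" "S \<noteq> {}" and closed: "\<And>u v. u \<in> S \<Longrightarrow> v \<in> V \<Longrightarrow> 0 < A v u \<Longrightarrow> v \<in> S"
  shows "S = V"
proof (rule ccontr)
  assume ne: "S \<noteq> V"
  obtain w where w: "w \<in> S" using S by auto
  have "2 * G u \<le> (\<Sum>v\<in>S. G v * A v u)" if u: "u \<in> S" for u
  proof -
    have "(\<Sum>v\<in>V-S. G v * A v u) = 0" using closed[OF u] by (intro sum.neutral) auto
    then show ?thesis using balance_remove[of u S] u S by auto
  qed
  from test_vector[OF S(1) ne this w] show False using G_pos[of w] w S by auto
qed

text \<open>The pairs are the last edges of walks from \<open>r\<close> without backtracking. The
  previous node is carried along because concavity compares two consecutive edges.\<close>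

inductive_set walk :: "'a \<Rightarrow> ('a \<times> 'a) set" for r where
  walk_start: "b \<in> V \<Longrightarrow> 0 < A b r \<Longrightarrow> (r, b) \<in> walk r"
| walk_step: "(p, x) \<in> walk r \<Longrightarrow> y \<in> V \<Longrightarrow> 0 < A y x \<Longrightarrow> y \<noteq> p \<Longrightarrow> (x, y) \<in> walk r"

text \<open>\<open>G\<close> is concave along paths, so it keeps decreasing once it has stopped to grow.\<close>

lemma bounded_by_neighbours:
  assumes r: "r \<in> V" and nbr: "\<And>b. b \<in> V \<Longrightarrow> 0 < A b r \<Longrightarrow> G b \<le> t" and t: "t \<le> G r"
    and v: "v \<in> V" "v \<noteq> r"
  shows "G v \<le> t"
proof -
  have W: "p \<in> V \<and> x \<in> V \<and> 0 < A p x \<and> G x \<le> G p \<and> G x \<le> t \<and> (p = r \<or> p \<in> snd ` walk r)"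
    if "(p, x) \<in> walk r" for p x
    using that
  proof (induction rule: walk.induct)
    case (walk_start b)
    then show ?case using r nbr[of b] t A_pos_sym[of b r] by auto
  next
    case (walk_step p x y)
    have xy: "0 < A x y" using walk_step A_pos_sym by blast
    \<comment> \<open>\<open>p\<close> and \<open>y\<close> are distinct neighbours of
      \<open>x\<close> and share its balance; as \<open>G x \<le> G p\<close>, only
      \<open>G y \<le> G x\<close> is left.\<close>
    have "G p * A p x + G y * A y x \<le> 2 * G x"
      using walk_step by (intro two_neighbours_le) auto
    moreover have "G p \<le> G p * A p x" "G y \<le> G y * A y x" using walk_step by auto
    ultimately have "G y \<le> G x" using walk_step by linarith
    then show ?case using walk_step xy by (force intro: rev_image_eqI)
  qed
  have "insert r (snd ` walk r) = V"
  proof (rule connected_V)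
    show "insert r (snd ` walk r) \<subseteq> V" using W r by fastforce
  next
    fix u v assume u: "u \<in> insert r (snd ` walk r)" and v: "v \<in> V" "0 < A v u"
    show "v \<in> insert r (snd ` walk r)"
    proof (cases "u = r")
      case True
      then show ?thesis using walk_start[OF v(1)] v by force
    next
      case False
      then obtain p where p: "(p, u) \<in> walk r" using u by auto
      show ?thesis
      proof (cases "v = p")
        case True
        then show ?thesis using W[OF p] by auto
      next
        case False
        then show ?thesis using walk_step[OF p v] by force
      qed
    qed
  qed auto
  then obtain p where "(p, v) \<in> walk r" using v by auto
  then show ?thesis using W by auto
qed

end

section \<open>The root system of a shortest node with coefficient one\<close>

lemma coroot_coroot [simp]: "coroot (coroot a) = a"
  by (cases "a = 0") (simp_all add: coroot_def)

lemma inj_coroot: "inj_on coroot S"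
  by (metis coroot_coroot inj_onI)

lemma coroot_eq_0_iff [simp]: "coroot a = 0 \<longleftrightarrow> a = 0"
  by (metis coroot_coroot coroot_def scaleR_zero_right)

lemma coroot_minus [simp]: "coroot (- a) = - coroot a"
  by (simp add: coroot_def)

lemma inner_coroot_self: "a \<noteq> 0 \<Longrightarrow> a \<bullet> coroot a = 2"
  by (simp add: coroot_def)

lemma inner_coroot_mult: "(b \<bullet> coroot a) * (a \<bullet> a) = 2 * (b \<bullet> a)"
  by (simp add: coroot_def)

lemma coroot_inner_coroot: "coroot a \<bullet> coroot b = 4 * (a \<bullet> b) / ((a \<bullet> a) * (b \<bullet> b))"
  by (simp add: coroot_def)

lemma norm_reflect: "a \<noteq> 0 \<Longrightarrow> (b - (b \<bullet> coroot a) *\<^sub>R a) \<bullet> (b - (b \<bullet> coroot a) *\<^sub>R a) = b \<bullet> b"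
  by (simp add: coroot_def inner_diff_left inner_diff_right inner_commute power2_eq_square field_simps)

lemma reflect_reflect: "a \<noteq> 0 \<Longrightarrow> b - (b \<bullet> coroot a) *\<^sub>R a = b' \<Longrightarrow> b' - (b' \<bullet> coroot a) *\<^sub>R a = b"
proof -
  assume a: "a \<noteq> 0" and b': "b - (b \<bullet> coroot a) *\<^sub>R a = b'"
  have "b' \<bullet> coroot a = - (b \<bullet> coroot a)"
    unfolding b'[symmetric] by (simp add: inner_diff_left inner_coroot_self[OF a])
  then show ?thesis using b' by (simp add: algebra_simps)
qed

lemma coroot_reflect:
  assumes "a \<noteq> 0"
  shows "coroot (b - (b \<bullet> coroot a) *\<^sub>R a) = coroot b - (a \<bullet> coroot b) *\<^sub>R coroot a"
proof -
  have "coroot (b - (b \<bullet> coroot a) *\<^sub>R a) = (2 / (b \<bullet> b)) *\<^sub>R (b - (b \<bullet> coroot a) *\<^sub>R a)"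
    unfolding coroot_def[of "b - _"] norm_reflect[OF assms] ..
  also have "\<dots> = coroot b - (a \<bullet> coroot b) *\<^sub>R coroot a"
    by (simp add: coroot_def algebra_simps inner_commute)
  finally show ?thesis .
qed

text \<open>Off-diagonal terms occur in equal pairs and diagonal terms are even. This compensates a
  factor 1/2 in the squared length of a partial sum of a root.\<close>

lemma even_sum_symmetric:
  fixes f :: "'b \<Rightarrow> 'b \<Rightarrow> int"
  assumes "finite S" "\<And>x y. x \<in> S \<Longrightarrow> y \<in> S \<Longrightarrow> f x y = f y x" "\<And>x. x \<in> S \<Longrightarrow> even (f x x)"
  shows "even (\<Sum>x\<in>S. \<Sum>y\<in>S. f x y)"
  using assms
proof (induction S)
  case (insert a S)
  have "(\<Sum>y\<in>S. f a y) = (\<Sum>x\<in>S. f x a)" using insert.prems by (intro sum.cong) auto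
  then have "(\<Sum>x\<in>insert a S. \<Sum>y\<in>insert a S. f x y) = f a a + 2 * (\<Sum>x\<in>S. f x a) + (\<Sum>x\<in>S. \<Sum>y\<in>S. f x y)"
    using insert.hyps by (simp add: sum.distrib)
  then show ?case using insert by simp
qed simp

text \<open>\<open>x0\<close> is to be the coroot of minus the highest root. Coefficient 1 puts it
  into the lattice spanned by the other nodes. \<open>root_integers\<close> does the same for
  \<open>coroot x0\<close>, whose coefficients are \<open>G x\<close> times a ratio of squared
  lengths. A shortest node has a longest coroot, as a highest root must be.\<close>

locale special_node = affine_coroots +
  fixes x0
  assumes x0_in: "x0 \<in> V" and G_x0: "G x0 = 1"
    and x0_shortest: "\<And>x. x \<in> V \<Longrightarrow> x0 \<bullet> x0 \<le> x \<bullet> x"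
    and root_integers: "\<And>x. x \<in> V \<Longrightarrow> \<exists>m::nat. real (G x) * (x \<bullet> x) = real m * (x0 \<bullet> x0)"
begin

section \<open>The two lattices and the roots cut out by them\<close>

abbreviation (input) "V0 \<equiv> V - {x0}"

lemma finite_V0: "finite V0" using finite_V by simp

text \<open>The Cartan matrix with entries in \<open>int\<close>, where parity can be
  argued.\<close>

definition pairing :: "'a \<Rightarrow> 'a \<Rightarrow> int" where
  "pairing x z = (if x = z then 2 else - int (A z x))"

lemma pairing: "x \<in> V \<Longrightarrow> z \<in> V \<Longrightarrow> coroot x \<bullet> z = of_int (pairing x z)"
proof -
  assume xz: "x \<in> V" "z \<in> V"
  have "x \<noteq> 0" using xz zero_notin_V by auto
  then show ?thesis using A_inner[of z x] inner_pos[of x] xz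
    by (auto simp: pairing_def coroot_def inner_commute field_simps)
qed

definition root_comb :: "('a \<Rightarrow> int) \<Rightarrow> 'a" where
  "root_comb k = (\<Sum>x\<in>V0. of_int (k x) *\<^sub>R coroot x)"

definition coroot_comb :: "('a \<Rightarrow> int) \<Rightarrow> 'a" where
  "coroot_comb l = (\<Sum>x\<in>V0. of_int (l x) *\<^sub>R x)"

text \<open>This arithmetic description replaces the orbit of the simple roots under the reflection group.\<close>

definition roots :: "'a set" where
  "roots = {y. y \<noteq> 0 \<and> y \<in> range root_comb \<and> coroot y \<in> range coroot_comb \<and>
     (\<exists>x\<in>V. y \<bullet> y = coroot x \<bullet> coroot x)}"

lemma indep_V0: "(\<Sum>x\<in>V0. c x *\<^sub>R x) = 0 \<Longrightarrow> x \<in> V0 \<Longrightarrow> c x = 0"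
  using indep_proper[of V0 c x] x0_in by auto

lemma indep_V0_coroot:
  assumes "(\<Sum>x\<in>V0. c x *\<^sub>R coroot x) = 0" "x \<in> V0"
  shows "c x = 0"
proof -
  have "(\<Sum>x\<in>V0. (c x * (2 / (x \<bullet> x))) *\<^sub>R x) = 0" using assms(1) by (simp add: coroot_def)
  from indep_V0[OF this assms(2)] show ?thesis using inner_pos[of x] assms(2) by auto
qed

lemma inner_coroots_nonpos: "x \<in> V \<Longrightarrow> z \<in> V \<Longrightarrow> x \<noteq> z \<Longrightarrow> coroot x \<bullet> coroot z \<le> 0"
  using inner_nonpos[of x z] by (simp add: coroot_inner_coroot divide_nonpos_nonneg)

lemma root_comb_inner_coroot_comb: "root_comb k \<bullet> coroot_comb l \<in> \<int>"
proof -
  have "root_comb k \<bullet> coroot_comb l = (\<Sum>x\<in>V0. \<Sum>z\<in>V0. of_int (k x * l z * pairing x z))"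
    unfolding root_comb_def coroot_comb_def inner_sum_left inner_sum_right
    by (subst sum.swap) (intro sum.cong refl, simp add: pairing)
  then show ?thesis by (auto intro!: Ints_sum Ints_mult)
qed

lemma root_comb_add: "root_comb k + root_comb k' = root_comb (\<lambda>x. k x + k' x)"
  by (simp add: root_comb_def sum.distrib algebra_simps)

lemma root_comb_scale: "of_int m *\<^sub>R root_comb k = root_comb (\<lambda>x. m * k x)"
  by (simp add: root_comb_def scaleR_sum_right)

lemma coroot_comb_add: "coroot_comb k + coroot_comb k' = coroot_comb (\<lambda>x. k x + k' x)"
  by (simp add: coroot_comb_def sum.distrib algebra_simps)

lemma coroot_comb_scale: "of_int m *\<^sub>R coroot_comb k = coroot_comb (\<lambda>x. m * k x)"
  by (simp add: coroot_comb_def scaleR_sum_right)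

lemma root_comb_unit: "x \<in> V0 \<Longrightarrow> root_comb (\<lambda>z. if z = x then 1 else 0) = coroot x"
proof -
  assume x: "x \<in> V0"
  have "root_comb (\<lambda>z. if z = x then 1 else 0) = (\<Sum>z\<in>V0. if z = x then coroot z else 0)"
    unfolding root_comb_def by (intro sum.cong) auto
  then show ?thesis using finite_V x by simp
qed

lemma coroot_comb_unit: "x \<in> V0 \<Longrightarrow> coroot_comb (\<lambda>z. if z = x then 1 else 0) = x"
proof -
  assume x: "x \<in> V0"
  have "coroot_comb (\<lambda>z. if z = x then 1 else 0) = (\<Sum>z\<in>V0. if z = x then z else 0)"
    unfolding coroot_comb_def by (intro sum.cong) auto
  then show ?thesis using finite_V x by simp
qed

lemma roots_integral: "a \<in> roots \<Longrightarrow> b \<in> roots \<Longrightarrow> b \<bullet> coroot a \<in> \<int>"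
  unfolding roots_def using root_comb_inner_coroot_comb by auto

text \<open>A reflection changes \<open>b\<close> by an integral multiple of \<open>a\<close> and
  \<open>coroot b\<close> by one of \<open>coroot a\<close>, so it respects both lattices, and it
  preserves the length.\<close>

lemma roots_reflect:
  assumes a: "a \<in> roots" and b: "b \<in> roots"
  shows "b - (b \<bullet> coroot a) *\<^sub>R a \<in> roots"
proof -
  let ?c = "b - (b \<bullet> coroot a) *\<^sub>R a"
  have a0: "a \<noteq> 0" and b0: "b \<noteq> 0" using a b by (auto simp: roots_def)
  obtain ka kb la lb where k: "a = root_comb ka" "b = root_comb kb"
      "coroot a = coroot_comb la" "coroot b = coroot_comb lb"
    using a b by (auto simp: roots_def)
  obtain m where m: "b \<bullet> coroot a = of_int m" using roots_integral[OF a b] by (elim Ints_cases)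
  obtain m' where m': "a \<bullet> coroot b = of_int m'" using roots_integral[OF b a] by (elim Ints_cases)
  have "?c = root_comb kb + of_int (- m) *\<^sub>R root_comb ka" using k m by simp
  then have 1: "?c \<in> range root_comb" unfolding root_comb_scale root_comb_add by blast
  have "coroot ?c = coroot_comb lb + of_int (- m') *\<^sub>R coroot_comb la"
    using k m' coroot_reflect[OF a0, of b] by simp
  then have 2: "coroot ?c \<in> range coroot_comb"
    unfolding coroot_comb_scale coroot_comb_add by blast
  have "?c \<bullet> ?c = b \<bullet> b" using norm_reflect[OF a0] .
  then show ?thesis using 1 2 b b0 unfolding roots_def
    by (smt (verit) inner_eq_zero_iff mem_Collect_eq)
qed

lemma coroot_in_roots:
  assumes "x \<in> V" shows "coroot x \<in> roots" "- coroot x \<in> roots"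
proof -
  have x0: "x \<noteq> 0" using assms zero_notin_V by auto
  have "coroot x \<in> range root_comb \<and> x \<in> range coroot_comb"
  proof (cases "x = x0")
    case False
    then show ?thesis using root_comb_unit[of x] coroot_comb_unit[of x] assms
      by (metis DiffI range_eqI singletonD)
  next
    case True
    \<comment> \<open>Only \<open>x0\<close> needs an argument. Its coefficient 1 lets the relation
      be solved for it over the integers; rescaled by \<open>2 / (x0 \<bullet> x0)\<close> and
      rewritten in coroots, the coefficients are the integers \<open>m z\<close> up to sign.\<close>
    have s: "x0 + (\<Sum>z\<in>V0. real (G z) *\<^sub>R z) = 0"
      using G_sum G_x0 finite_V x0_in by (simp add: sum.remove)
    then have x0_eq: "x0 = - (\<Sum>z\<in>V0. real (G z) *\<^sub>R z)" by (simp add: eq_neg_iff_add_eq_0)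
    also have "\<dots> = coroot_comb (\<lambda>z. - int (G z))" by (simp add: coroot_comb_def sum_negf)
    finally have 1: "x0 \<in> range coroot_comb" by blast
    obtain m :: "'a \<Rightarrow> nat" where m: "\<And>z. z \<in> V \<Longrightarrow> real (G z) * (z \<bullet> z) = real (m z) * (x0 \<bullet> x0)"
      using root_integers by metis
    have "coroot x0 = (2 / (x0 \<bullet> x0)) *\<^sub>R - (\<Sum>z\<in>V0. real (G z) *\<^sub>R z)"
      using x0_eq by (metis coroot_def)
    also have "\<dots> = (\<Sum>z\<in>V0. (2 / (x0 \<bullet> x0)) *\<^sub>R - (real (G z) *\<^sub>R z))"
      by (simp add: scaleR_sum_right sum_negf)
    also have "\<dots> = root_comb (\<lambda>z. - int (m z))"
      unfolding root_comb_def
    proof (intro sum.cong refl)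
      fix z assume z: "z \<in> V0"
      have "2 / (x0 \<bullet> x0) * real (G z) = real (m z) * (2 / (z \<bullet> z))"
        using m[of z] z inner_pos[of z] inner_pos[OF x0_in] by (auto simp: field_simps)
      then show "(2 / (x0 \<bullet> x0)) *\<^sub>R - (real (G z) *\<^sub>R z) = of_int (- int (m z)) *\<^sub>R coroot z"
        by (simp add: coroot_def)
    qed
    finally show ?thesis using 1 True by blast
  qed
  note ranges = this
  then obtain k l where kl: "coroot x = root_comb k" "x = coroot_comb l" by auto
  show "coroot x \<in> roots" using ranges x0 assms unfolding roots_def by auto
  have "- coroot x = root_comb (\<lambda>x. -1 * k x)" "- x = coroot_comb (\<lambda>x. -1 * l x)"
    using root_comb_scale[of "-1" k] coroot_comb_scale[of "-1" l] kl by auto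
  then have "- coroot x \<in> range root_comb" "- x \<in> range coroot_comb" by (metis rangeI)+
  then show "- coroot x \<in> roots" using x0 assms unfolding roots_def by auto
qed

text \<open>The sum of the terms of \<open>y\<close> over any set of nodes has squared length an integral multiple of
  that of \<open>y\<close>, while the positive and the negative part of \<open>y\<close> enclose an acute angle.\<close>

lemma roots_sign:
  assumes y: "y \<in> roots" and k: "y = root_comb k"
  shows "(\<forall>x\<in>V0. 0 \<le> k x) \<or> (\<forall>x\<in>V0. k x \<le> 0)"
proof (rule ccontr)
  assume neg: "\<not> ?thesis"
  have y0: "y \<bullet> y > 0" using y by (auto simp: roots_def)
  obtain l where l: "coroot y = coroot_comb l" using y by (auto simp: roots_def)
  \<comment> \<open>\<open>coroot y\<close> is a multiple of \<open>y\<close>, so the two expansions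
    can be compared coefficientwise in the independent set \<open>V0\<close>.\<close>
  have kl: "2 * of_int (k x) / (x \<bullet> x) = of_int (l x) * (y \<bullet> y) / 2" if x: "x \<in> V0" for x
  proof -
    have "(\<Sum>x\<in>V0. ((2 / (y \<bullet> y)) * (2 * of_int (k x) / (x \<bullet> x)) - of_int (l x)) *\<^sub>R x)
        = (2 / (y \<bullet> y)) *\<^sub>R root_comb k - coroot_comb l"
      unfolding root_comb_def coroot_comb_def coroot_def
      by (simp add: scaleR_sum_right sum_subtractf algebra_simps)
    also have "\<dots> = 0" using l k by (simp add: coroot_def)
    finally have *: "(\<Sum>x\<in>V0. ((2 / (y \<bullet> y)) * (2 * of_int (k x) / (x \<bullet> x)) - of_int (l x)) *\<^sub>R x) = 0" .
    have "2 * of_int (k x) / (x \<bullet> x) = (y \<bullet> y) / 2 * ((2 / (y \<bullet> y)) * (2 * of_int (k x) / (x \<bullet> x)))"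
      using y0 by simp
    also have "\<dots> = (y \<bullet> y) / 2 * of_int (l x)"
      using indep_V0[OF * x] by simp
    finally show ?thesis by (simp only: mult.commute times_divide_eq_right)
  qed
  define p where "p S = (\<Sum>x\<in>S. of_int (k x) *\<^sub>R coroot x)" for S
  have p: "y \<bullet> y \<le> p S \<bullet> p S" if S: "S \<subseteq> V0" and x: "x \<in> S" and kx: "k x \<noteq> 0" for S x
  proof -
    have fS: "finite S" using S finite_V finite_subset by blast
    let ?f = "\<lambda>x z. k x * l z * pairing x z"
    have pS: "p S = ((y \<bullet> y) / 2) *\<^sub>R (\<Sum>z\<in>S. of_int (l z) *\<^sub>R z)"
      unfolding p_def scaleR_sum_right
    proof (intro sum.cong refl)
      fix z assume "z \<in> S"
      then have "of_int (k z) * (2 / (z \<bullet> z)) = (y \<bullet> y) / 2 * of_int (l z)"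
        using kl[of z] S by (auto simp: mult.commute)
      then show "of_int (k z) *\<^sub>R coroot z = ((y \<bullet> y) / 2) *\<^sub>R of_int (l z) *\<^sub>R z"
        by (simp add: coroot_def)
    qed
    have f: "of_int (?f x z) = (2 / (y \<bullet> y)) * (of_int (k x) * of_int (k z) * (coroot x \<bullet> coroot z))"
      if "x \<in> S" "z \<in> S" for x z
    proof -
      have "x \<in> V" "z \<in> V" using that S by auto
      then have "of_int (?f x z) = of_int (k x) * of_int (l z) * (coroot x \<bullet> z)"
        using pairing[of x z] by simp
      also have "of_int (l z) = (2 / (y \<bullet> y)) * (of_int (l z) * (y \<bullet> y) / 2)"
        using y0 by simp
      also have "of_int (l z) * (y \<bullet> y) / 2 = 2 * of_int (k z) / (z \<bullet> z)"
        by (rule kl[symmetric]) (use that S in auto)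
      finally show ?thesis by (simp add: coroot_def[of z])
    qed
    \<comment> \<open>By \<open>kl\<close> each summand is a fixed multiple of an expression
      symmetric in \<open>x\<close> and \<open>z\<close>; the diagonal carries the Cartan entry
      2.\<close>
    have "even (\<Sum>x\<in>S. \<Sum>z\<in>S. ?f x z)"
    proof (rule even_sum_symmetric[OF fS])
      fix x z assume "x \<in> S" "z \<in> S"
      then have "real_of_int (?f x z) = real_of_int (?f z x)"
        using f[of x z] f[of z x] by (simp add: inner_commute mult.commute)
      then show "?f x z = ?f z x" by linarith
    qed (simp add: pairing_def)
    then obtain N where N: "(\<Sum>x\<in>S. \<Sum>z\<in>S. ?f x z) = 2 * N" by (elim evenE)
    have "p S \<bullet> p S = ((y \<bullet> y) / 2) * ((\<Sum>x\<in>S. of_int (k x) *\<^sub>R coroot x) \<bullet> (\<Sum>z\<in>S. of_int (l z) *\<^sub>R z))"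
      by (subst (2) pS) (simp add: p_def)
    also have "(\<Sum>x\<in>S. of_int (k x) *\<^sub>R coroot x) \<bullet> (\<Sum>z\<in>S. of_int (l z) *\<^sub>R z)
        = (\<Sum>x\<in>S. \<Sum>z\<in>S. of_int (?f x z))"
      unfolding inner_sum_left inner_sum_right
    proof (subst sum.swap, intro sum.cong refl)
      fix x z assume "x \<in> S" "z \<in> S"
      then have "x \<in> V" "z \<in> V" using S by auto
      from pairing[OF this] show "(of_int (k x) *\<^sub>R coroot x) \<bullet> (of_int (l z) *\<^sub>R z) = of_int (?f x z)"
        by simp
    qed
    also have "\<dots> = of_int (2 * N)" unfolding N[symmetric] by simp
    finally have pN: "p S \<bullet> p S = (y \<bullet> y) * of_int N" by simp
    have "p S \<noteq> 0"
    proof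
      assume "p S = 0"
      moreover have "(\<Sum>z\<in>V0. (if z \<in> S then of_int (k z) else 0) *\<^sub>R coroot z) = p S"
        unfolding p_def using S finite_V by (intro sum.mono_neutral_cong_right) auto
      ultimately have "(\<Sum>z\<in>V0. (if z \<in> S then of_int (k z) else 0) *\<^sub>R coroot z) = 0" by simp
      from indep_V0_coroot[OF this, of x] x S kx show False by auto
    qed
    then have "0 < (y \<bullet> y) * of_int N" using pN by (metis inner_gt_zero_iff)
    then have "1 \<le> N" using y0 by (simp add: zero_less_mult_iff)
    then show ?thesis using pN y0 by simp
  qed
  define P where "P = {x \<in> V0. 0 < k x}"
  define Q where "Q = {x \<in> V0. k x < 0}"
  have "y = (\<Sum>x\<in>P \<union> Q. of_int (k x) *\<^sub>R coroot x)"
    unfolding k root_comb_def P_def Q_def using finite_V by (intro sum.mono_neutral_right) auto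
  also have "\<dots> = p P + p Q"
    unfolding p_def P_def Q_def using finite_V by (intro sum.union_disjoint) auto
  finally have ypq: "y = p P + p Q" .
  \<comment> \<open>Coefficients of opposite sign meet nonpositive inner products of distinct
    coroots. With both parts present, \<open>y \<bullet> y\<close> would be at least twice
    itself.\<close>
  have "0 \<le> p P \<bullet> p Q"
    unfolding p_def inner_sum_left inner_sum_right
  proof (intro sum_nonneg)
    fix x z assume xz: "x \<in> Q" "z \<in> P"
    then have "x \<noteq> z" by (auto simp: P_def Q_def)
    then have "coroot z \<bullet> coroot x \<le> 0" "of_int (k x) * of_int (k z) \<le> (0::real)"
      using inner_coroots_nonpos[of z x] xz by (auto simp: P_def Q_def mult_nonpos_nonneg)
    then show "0 \<le> (of_int (k z) *\<^sub>R coroot z) \<bullet> (of_int (k x) *\<^sub>R coroot x)"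
      using mult_nonpos_nonpos by fastforce
  qed
  moreover obtain x where "x \<in> P" using neg by (auto simp: P_def not_le)
  then have "y \<bullet> y \<le> p P \<bullet> p P" using p[of P x] by (auto simp: P_def)
  moreover obtain z where "z \<in> Q" using neg by (auto simp: Q_def not_le)
  then have "y \<bullet> y \<le> p Q \<bullet> p Q" using p[of Q z] by (auto simp: Q_def)
  moreover have "y \<bullet> y = p P \<bullet> p P + 2 * (p P \<bullet> p Q) + p Q \<bullet> p Q"
    unfolding ypq by (simp add: inner_add_left inner_add_right inner_commute)
  ultimately show False using y0 by linarith
qed


text \<open>A root is determined by its inner products with \<open>V0\<close>. These are integers,
  bounded by Cauchy-Schwarz because only finitely many lengths occur.\<close>

lemma finite_roots: "finite roots"
proof -
  obtain B where B: "\<And>x. x \<in> V \<Longrightarrow> norm x \<le> B \<and> norm (coroot x) \<le> B"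
  proof -
    have "finite (norm ` V \<union> (\<lambda>x. norm (coroot x)) ` V)" using finite_V by simp
    then have "bdd_above (norm ` V \<union> (\<lambda>x. norm (coroot x)) ` V)" by (rule bdd_above_finite)
    then show thesis using that by (fastforce simp: bdd_above_def)
  qed
  define N where "N = \<lceil>B * B\<rceil>"
  let ?f = "\<lambda>y. \<lambda>x\<in>V0. \<lfloor>y \<bullet> x\<rfloor>"
  have int: "of_int \<lfloor>y \<bullet> x\<rfloor> = y \<bullet> x \<and> \<bar>y \<bullet> x\<bar> \<le> B * B" if y: "y \<in> roots" and x: "x \<in> V0" for y x
  proof
    have "coroot x \<in> roots" using x coroot_in_roots by auto
    from roots_integral[OF this y] show "of_int \<lfloor>y \<bullet> x\<rfloor> = y \<bullet> x" by simp
    obtain z where z: "z \<in> V" "norm y = norm (coroot z)"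
      using y unfolding roots_def by (auto simp: norm_eq_sqrt_inner)
    have "\<bar>y \<bullet> x\<bar> \<le> norm y * norm x" by (rule Cauchy_Schwarz_ineq2)
    also have "\<dots> \<le> B * B"
    proof (rule mult_mono')
      show "norm y \<le> B" using z B by auto
      show "norm x \<le> B" using x B by auto
    qed auto
    finally show "\<bar>y \<bullet> x\<bar> \<le> B * B" .
  qed
  have "?f ` roots \<subseteq> (\<Pi>\<^sub>E x\<in>V0. {- N..N})"
  proof clarify
    fix y assume y: "y \<in> roots"
    show "?f y \<in> (\<Pi>\<^sub>E x\<in>V0. {- N..N})"
    proof (rule restrict_PiE_iff[THEN iffD2], rule ballI)
      fix x assume "x \<in> V0"
      from int[OF y this] show "\<lfloor>y \<bullet> x\<rfloor> \<in> {- N..N}"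
        unfolding N_def by (auto simp: abs_le_iff) linarith+
    qed
  qed
  moreover have "finite (\<Pi>\<^sub>E x\<in>V0. {- N..N})" using finite_V0 by (intro finite_PiE) auto
  ultimately have "finite (?f ` roots)" by (rule finite_subset)
  moreover have "inj_on ?f roots"
  proof
    fix y z assume y: "y \<in> roots" and z: "z \<in> roots" and eq: "?f y = ?f z"
    have *: "(y - z) \<bullet> x = 0" if x: "x \<in> V0" for x
    proof -
      have "\<lfloor>y \<bullet> x\<rfloor> = \<lfloor>z \<bullet> x\<rfloor>" using fun_cong[OF eq, of x] x by simp
      then have "y \<bullet> x = z \<bullet> x" using int[OF y x] int[OF z x] by metis
      then show ?thesis by (simp add: inner_diff_left)
    qed
    obtain k where "y - z = root_comb k"
    proof -
      obtain k k' where "y = root_comb k" "z = root_comb k'" using y z by (auto simp: roots_def)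
      then have "y - z = root_comb k + of_int (-1) *\<^sub>R root_comb k'" by simp
      then show thesis using that unfolding root_comb_scale root_comb_add by blast
    qed
    then have "(y - z) \<bullet> (y - z) = (\<Sum>x\<in>V0. of_int (k x) * ((y - z) \<bullet> coroot x))"
      unfolding root_comb_def by (metis (no_types, lifting) inner_scaleR_right inner_sum_right sum.cong)
    also have "\<dots> = 0" using * by (intro sum.neutral) (simp add: coroot_def)
    finally show "y = z" by simp
  qed
  ultimately show ?thesis by (rule finite_imageD)
qed

lemma root_system_roots: "root_system roots"
  unfolding root_system_def
  using finite_roots roots_reflect roots_integral by (auto simp: roots_def)

lemma sum_coroots: "(\<Sum>a\<in>coroot ` V0. real (c a) *\<^sub>R a) = root_comb (\<lambda>x. int (c (coroot x)))"
  unfolding root_comb_def by (subst sum.reindex[OF inj_coroot]) simp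

lemma simple_roots_roots: "simple_roots roots (coroot ` V0)"
  unfolding simple_roots_def
proof (intro conjI ballI)
  show "coroot ` V0 \<subseteq> roots" using coroot_in_roots by auto
  show "independent (coroot ` V0)"
    unfolding independent_explicit
  proof (intro conjI allI impI ballI)
    show "finite (coroot ` V0)" using finite_V by simp
    fix c v assume s: "(\<Sum>v\<in>coroot ` V0. c v *\<^sub>R v) = 0" and v: "v \<in> coroot ` V0"
    from s have "(\<Sum>x\<in>V0. c (coroot x) *\<^sub>R coroot x) = 0" by (subst (asm) sum.reindex[OF inj_coroot]) simp
    from indep_V0_coroot[OF this] show "c v = 0" using v by auto
  qed
  fix b assume b: "b \<in> roots"
  then obtain k where k: "b = root_comb k" by (auto simp: roots_def)
  from roots_sign[OF b k] show "\<exists>c :: 'a \<Rightarrow> nat. b = (\<Sum>a\<in>coroot ` V0. real (c a) *\<^sub>R a) \<or>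
      b = - (\<Sum>a\<in>coroot ` V0. real (c a) *\<^sub>R a)"
  proof
    assume "\<forall>x\<in>V0. 0 \<le> k x"
    then have "b = (\<Sum>a\<in>coroot ` V0. real (nat (k (coroot a))) *\<^sub>R a)"
      unfolding sum_coroots[of "\<lambda>a. nat (k (coroot a))"] k root_comb_def by (intro sum.cong) auto
    then show ?thesis by (intro exI[of _ "\<lambda>a. nat (k (coroot a))"]) simp
  next
    assume "\<forall>x\<in>V0. k x \<le> 0"
    then have "b = - (\<Sum>a\<in>coroot ` V0. real (nat (- k (coroot a))) *\<^sub>R a)"
      unfolding sum_coroots[of "\<lambda>a. nat (- k (coroot a))"] k root_comb_def sum_negf[symmetric]
      by (intro sum.cong) auto
    then show ?thesis by (intro exI[of _ "\<lambda>a. nat (- k (coroot a))"]) simp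
  qed
qed

section \<open>Dominant roots and the highest root\<close>

abbreviation (input) "\<theta> \<equiv> - coroot x0"

text \<open>The relation solved for \<open>- x0\<close> has positive coefficients, and passing to
  coroots multiplies them by positive ratios, with integral result. Strict positivity later excludes
  a dominant root orthogonal to \<open>\<theta>\<close>.\<close>

lemma theta_comb:
  obtains m where "\<theta> = root_comb m" "\<And>x. x \<in> V0 \<Longrightarrow> 0 < m x"
proof -
  obtain m :: "'a \<Rightarrow> nat" where m: "\<And>z. z \<in> V \<Longrightarrow> real (G z) * (z \<bullet> z) = real (m z) * (x0 \<bullet> x0)"
    using root_integers by metis
  have "x0 + (\<Sum>z\<in>V0. real (G z) *\<^sub>R z) = 0"
    using G_sum G_x0 finite_V x0_in by (simp add: sum.remove)
  then have "- x0 = (\<Sum>z\<in>V0. real (G z) *\<^sub>R z)" by (metis add_eq_0_iff2 add.commute)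
  moreover have "\<theta> = (2 / (x0 \<bullet> x0)) *\<^sub>R (- x0)" by (simp add: coroot_def)
  ultimately have "\<theta> = (2 / (x0 \<bullet> x0)) *\<^sub>R (\<Sum>z\<in>V0. real (G z) *\<^sub>R z)" by metis
  also have "\<dots> = root_comb (\<lambda>z. int (m z))"
    unfolding root_comb_def scaleR_sum_right
  proof (intro sum.cong refl)
    fix z assume z: "z \<in> V0"
    have "2 / (x0 \<bullet> x0) * real (G z) = real (m z) * (2 / (z \<bullet> z))"
      using m[of z] z inner_pos[of z] inner_pos[OF x0_in] by (auto simp: field_simps)
    then show "(2 / (x0 \<bullet> x0)) *\<^sub>R (real (G z) *\<^sub>R z) = of_int (int (m z)) *\<^sub>R coroot z"
      by (simp add: coroot_def)
  qed
  moreover have "0 < m z" if "z \<in> V0" for z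
    using m[of z] G_pos[of z] inner_pos[of z] that by (cases "m z") auto
  ultimately show thesis using that[of "\<lambda>z. int (m z)"] by auto
qed

lemma root_comb_inner: "root_comb k \<bullet> y = (\<Sum>x\<in>V0. of_int (k x) * (coroot x \<bullet> y))"
  unfolding root_comb_def by (simp add: inner_sum_left)

lemma theta_dominant: "x \<in> V0 \<Longrightarrow> 0 \<le> \<theta> \<bullet> coroot x"
  using inner_coroots_nonpos[of x0 x] x0_in by auto

lemma norm_le_theta:
  assumes "y \<in> roots" shows "y \<bullet> y \<le> \<theta> \<bullet> \<theta>"
proof -
  obtain x where x: "x \<in> V" "y \<bullet> y = coroot x \<bullet> coroot x" using assms by (auto simp: roots_def)
  have "4 / (x \<bullet> x) \<le> 4 / (x0 \<bullet> x0)"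
    using x0_shortest[OF x(1)] inner_pos[OF x0_in] inner_pos[OF x(1)]
    by (intro divide_left_mono mult_pos_pos) auto
  then show ?thesis using x zero_notin_V x0_in by (auto simp: coroot_inner_coroot)
qed

text \<open>Among the finitely many roots that exceed \<open>b\<close> by a nonnegative combination,
  one with the largest coefficient sum is dominant: reflection in a simple root of negative pairing
  would increase the sum.\<close>

lemma root_le_dominant:
  assumes "b \<in> roots"
  obtains y k where "y \<in> roots" "y - b = root_comb k" "\<And>x. x \<in> V0 \<Longrightarrow> 0 \<le> k x"
    "\<And>x. x \<in> V0 \<Longrightarrow> 0 \<le> y \<bullet> coroot x"
proof -
  define H where "H y k \<longleftrightarrow> y \<in> roots \<and> y - b = root_comb k \<and> (\<forall>x\<in>V0. 0 \<le> k x)" for y k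
  let ?N = "{y \<in> roots. \<exists>k. H y k}"
  \<comment> \<open>The expansion of \<open>y - b\<close> is unique only on \<open>V0\<close>;
    fixing one makes the height \<open>h\<close> a function of \<open>y\<close>.\<close>
  define \<kappa> where "\<kappa> y = (SOME k. H y k)" for y
  have \<kappa>: "H y (\<kappa> y)" if "y \<in> ?N" for y
    unfolding \<kappa>_def using that by (metis (mono_tags, lifting) mem_Collect_eq someI_ex)
  have fin: "finite ?N" using finite_roots by simp
  have "H b (\<lambda>_. 0)" using assms by (simp add: H_def root_comb_def)
  then have ne: "b \<in> ?N" using assms by auto
  define h where "h y = (\<Sum>x\<in>V0. \<kappa> y x)" for y
  have "Max (h ` ?N) \<in> h ` ?N" using fin ne by (intro Max_in) auto
  then obtain y where y1: "y \<in> ?N" "h y = Max (h ` ?N)" by (metis (lifting) imageE)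
  have "h z \<le> h y" if "z \<in> ?N" for z
    unfolding y1(2) using fin that by (intro Max_ge finite_imageI imageI)
  note y = y1(1) this
  have dom: "0 \<le> y \<bullet> coroot x" if x: "x \<in> V0" for x
  proof (rule ccontr)
    assume neg: "\<not> ?thesis"
    have xV: "x \<in> V" using x by auto
    have xr: "coroot x \<in> roots" using coroot_in_roots xV by auto
    have yx: "y \<bullet> x < 0" using neg inner_pos[OF xV] unfolding not_le coroot_def inner_scaleR_right
      by (metis mult_less_0_iff less_asym zero_less_divide_iff zero_less_numeral)
    obtain m where m: "y \<bullet> x = of_int m" using roots_integral[OF xr, of y] y by (auto elim: Ints_cases)
    then have m0: "m < 0" using yx by simp
    let ?z = "y - (y \<bullet> x) *\<^sub>R coroot x"
    let ?k = "\<lambda>u. \<kappa> y u + - m * (if u = x then 1 else 0)"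
    have zr: "?z \<in> roots" using roots_reflect[OF xr, of y] y by simp
    have "?z - b = root_comb (\<kappa> y) + of_int (- m) *\<^sub>R root_comb (\<lambda>u. if u = x then 1 else 0)"
      using root_comb_unit[OF x] m \<kappa>[OF y(1)] by (simp add: H_def algebra_simps)
    then have zk: "?z - b = root_comb ?k" unfolding root_comb_scale root_comb_add .
    have \<kappa>0: "0 \<le> \<kappa> y u" if "u \<in> V0" for u using \<kappa>[OF y(1)] that by (simp add: H_def)
    have "0 \<le> ?k u" if "u \<in> V0" for u using m0 \<kappa>0[OF that] by (cases "u = x") auto
    then have "H ?z ?k" using zr zk by (auto simp: H_def)
    then have zN: "?z \<in> ?N" using zr by auto
    have "root_comb (\<kappa> ?z) = root_comb ?k" using zk \<kappa>[OF zN] by (simp add: H_def)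
    then have "\<kappa> ?z u = ?k u" if "u \<in> V0" for u
    proof -
      have "(\<Sum>u\<in>V0. (of_int (\<kappa> ?z u) - of_int (?k u)) *\<^sub>R coroot u) = root_comb (\<kappa> ?z) - root_comb ?k"
        unfolding root_comb_def by (simp only: sum_subtractf scaleR_left_diff_distrib)
      also have "\<dots> = 0" using \<open>root_comb (\<kappa> ?z) = root_comb ?k\<close> by simp
      finally have *: "(\<Sum>u\<in>V0. (of_int (\<kappa> ?z u) - of_int (?k u)) *\<^sub>R coroot u) = 0" .
      from indep_V0_coroot[OF * that] have "real_of_int (\<kappa> ?z u) = real_of_int (?k u)" by simp
      then show ?thesis by linarith
    qed
    then have "h ?z = (\<Sum>u\<in>V0. ?k u)" unfolding h_def by simp
    also have "\<dots> = h y + (\<Sum>u\<in>V0. if u = x then - m else 0)"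
      unfolding h_def sum.distrib[symmetric] by (intro sum.cong) auto
    also have "\<dots> = h y - m" using x finite_V by simp
    finally show False using y(2)[OF zN] m0 by simp
  qed
  show thesis using that[OF _ _ _ dom, of "\<kappa> y"] \<kappa>[OF y(1)] by (auto simp: H_def)
qed

lemma dominant_inner_nonneg:
  assumes "\<And>x. x \<in> V0 \<Longrightarrow> 0 \<le> y \<bullet> coroot x" "\<And>x. x \<in> V0 \<Longrightarrow> 0 \<le> k x"
  shows "0 \<le> root_comb k \<bullet> y"
  unfolding root_comb_inner using assms by (intro sum_nonneg) (simp add: inner_commute)

lemma root_comb_sign_diff:
  assumes "y \<in> roots"
  obtains k where "y = root_comb k" "\<And>x. x \<in> V0 \<Longrightarrow> 0 \<le> k x"
  | k where "y = - root_comb k" "\<And>x. x \<in> V0 \<Longrightarrow> 0 \<le> k x"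
proof -
  obtain k where k: "y = root_comb k" using assms by (auto simp: roots_def)
  have "- root_comb k = root_comb (\<lambda>x. - k x)" using root_comb_scale[of "-1" k] by simp
  then have k': "y = - root_comb (\<lambda>x. - k x)" using k by (metis minus_minus)
  from roots_sign[OF assms k] show thesis
  proof
    assume "\<forall>x\<in>V0. 0 \<le> k x" then show thesis using that(1)[of k] k by auto
  next
    assume "\<forall>x\<in>V0. k x \<le> 0" then show thesis using that(2)[of "\<lambda>x. - k x"] k' by auto
  qed
qed

text \<open>The Cartan integer \<open>n\<close> of \<open>y\<close> against \<open>\<theta>\<close>
  is positive. If it is at least 2, then \<open>\<theta>\<close> being longest gives
  \<open>y = \<theta>\<close>. If it is 1, then \<open>y - \<theta>\<close> is a root; as a
  nonnegative combination it would have a nonnegative inner product with \<open>\<theta>\<close>,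
  but this is \<open>- (\<theta> \<bullet> \<theta>) / 2\<close>.\<close>

lemma dominant_le_theta:
  assumes y: "y \<in> roots" and dom: "\<And>x. x \<in> V0 \<Longrightarrow> 0 \<le> y \<bullet> coroot x"
  obtains k where "\<theta> - y = root_comb k" "\<And>x. x \<in> V0 \<Longrightarrow> 0 \<le> k x"
proof -
  have y0: "0 < y \<bullet> y" using y by (auto simp: roots_def)
  have th: "\<theta> \<in> roots" using coroot_in_roots x0_in by auto
  obtain m where m: "\<theta> = root_comb m" "\<And>x. x \<in> V0 \<Longrightarrow> 0 < m x"
    using theta_comb by blast
  have th0: "0 < \<theta> \<bullet> \<theta>" using th by (auto simp: roots_def)
  \<comment> \<open>Otherwise every term vanishes, all coefficients of \<open>\<theta>\<close> being
    positive, and \<open>y\<close> is orthogonal to its own expansion.\<close>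
  have pos: "0 < \<theta> \<bullet> y"
  proof (rule ccontr)
    assume "\<not> 0 < \<theta> \<bullet> y"
    moreover have nn: "0 \<le> of_int (m x) * (coroot x \<bullet> y)" if "x \<in> V0" for x
      using m(2)[OF that] dom[OF that] by (simp add: inner_commute)
    ultimately have "(\<Sum>x\<in>V0. of_int (m x) * (coroot x \<bullet> y)) = 0"
      using sum_nonneg[of V0 "\<lambda>x. of_int (m x) * (coroot x \<bullet> y)"] m(1) root_comb_inner[of m y]
      by (metis (no_types, lifting) not_less order_antisym)
    then have "\<forall>x\<in>V0. of_int (m x) * (coroot x \<bullet> y) = 0"
      using sum_nonneg_eq_0_iff[OF finite_V0, of "\<lambda>x. of_int (m x) * (coroot x \<bullet> y)"] nn by auto
    then have 0: "coroot x \<bullet> y = 0" if "x \<in> V0" for x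
      using m(2)[OF that] that by (metis less_irrefl mult_eq_0_iff of_int_eq_0_iff)
    obtain k where "y = root_comb k" using y by (auto simp: roots_def)
    then have "y \<bullet> y = 0" using root_comb_inner[of k y] 0 by simp
    then show False using y0 by simp
  qed
  have le: "y \<bullet> y \<le> \<theta> \<bullet> \<theta>" using norm_le_theta[OF y] .
  obtain n where n: "y \<bullet> coroot \<theta> = of_int n" using roots_integral[OF th y] by (elim Ints_cases)
  have yn: "2 * (y \<bullet> \<theta>) = of_int n * (\<theta> \<bullet> \<theta>)" using inner_coroot_mult[of y \<theta>] n by metis
  then have n0: "0 < n" using pos th0 by (metis inner_commute mult_2 add_pos_pos of_int_0_less_iff zero_less_mult_pos2)
  have d: "(y - t) \<bullet> (y - t) = y \<bullet> y - 2 * (y \<bullet> t) + t \<bullet> t" for t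
    by (simp add: inner_diff_left inner_diff_right inner_commute)
  show thesis
  proof (cases "n = 1")
    case False
    then have "2 * (\<theta> \<bullet> \<theta>) \<le> of_int n * (\<theta> \<bullet> \<theta>)" using n0 th0 by (intro mult_right_mono) auto
    then have "(y - \<theta>) \<bullet> (y - \<theta>) \<le> 0" using d[of \<theta>] le yn by linarith
    then have "y = \<theta>" by (metis eq_iff_diff_eq_0 inner_gt_zero_iff not_less)
    then show thesis using that[of "\<lambda>_. 0"] by (simp add: root_comb_def)
  next
    case True
    then have "y - \<theta> \<in> roots" using roots_reflect[OF th y] n by simp
    then show thesis
    proof (cases rule: root_comb_sign_diff)
      case (1 k)
      have "0 \<le> (y - \<theta>) \<bullet> \<theta>"
        using dominant_inner_nonneg[of \<theta> k] theta_dominant 1 by auto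
      then have "\<theta> \<bullet> \<theta> \<le> y \<bullet> \<theta>" unfolding inner_diff_left by simp
      moreover have "2 * (y \<bullet> \<theta>) = \<theta> \<bullet> \<theta>" using yn unfolding True of_int_1 mult_1_left .
      ultimately have False using th0 by linarith
      then show thesis ..
    next
      case (2 k)
      then show thesis using that[of k] by (metis minus_diff_eq minus_minus)
    qed
  qed
qed

lemma highest_root_theta: "highest_root roots (coroot ` V0) \<theta>"
  unfolding highest_root_def
proof (intro conjI ballI)
  show "\<theta> \<in> roots" using coroot_in_roots x0_in by auto
  fix b assume b: "b \<in> roots"
  obtain y k where yk: "y \<in> roots" "y - b = root_comb k" "\<And>x. x \<in> V0 \<Longrightarrow> 0 \<le> k x"
    "\<And>x. x \<in> V0 \<Longrightarrow> 0 \<le> y \<bullet> coroot x" using root_le_dominant[OF b] by blast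
  obtain l where l: "\<theta> - y = root_comb l" "\<And>x. x \<in> V0 \<Longrightarrow> 0 \<le> l x"
    using dominant_le_theta[OF yk(1) yk(4)] by blast
  have "\<theta> - b = root_comb (\<lambda>x. l x + k x)"
    using yk(2) l(1) unfolding root_comb_add[symmetric] by (metis add.commute diff_add_cancel add_diff_eq)
  also have "\<dots> = (\<Sum>a\<in>coroot ` V0. real (nat (l (coroot a) + k (coroot a))) *\<^sub>R a)"
    unfolding sum_coroots[of "\<lambda>a. nat (l (coroot a) + k (coroot a))"] root_comb_def
    using yk(3) l(2) by (intro sum.cong) auto
  finally show "\<exists>c :: 'a \<Rightarrow> nat. \<theta> - b = (\<Sum>a\<in>coroot ` V0. real (c a) *\<^sub>R a)"
    by (intro exI[of _ "\<lambda>a. nat (l (coroot a) + k (coroot a))"])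
qed

text \<open>Neighbours are not orthogonal, so connectedness spreads membership in \<open>B\<close>
  from \<open>coroot x0\<close> to the coroots of all nodes. A root in \<open>C\<close> is then
  orthogonal to its own expansion.\<close>

lemma irreducible_half:
  assumes AB: "B \<union> C = roots" "B \<inter> C = {}" "\<forall>a\<in>B. \<forall>b\<in>C. a \<bullet> b = 0" and x0: "coroot x0 \<in> B"
  shows "C = {}"
proof -
  have "{x \<in> V. coroot x \<in> B} = V"
  proof (rule connected_V)
    show "{x \<in> V. coroot x \<in> B} \<noteq> {}" using x0 x0_in by auto
    fix u v assume u: "u \<in> {x \<in> V. coroot x \<in> B}" and v: "v \<in> V" "0 < A v u"
    have "coroot u \<bullet> coroot v \<noteq> 0"
      using A_eq_0_iff[of v u] A_pos_neq[OF v(2)] u v zero_notin_V by (auto simp: coroot_inner_coroot inner_commute)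
    moreover have "coroot v \<in> roots" using coroot_in_roots v by auto
    ultimately show "v \<in> {x \<in> V. coroot x \<in> B}" using AB u v by auto
  qed auto
  then have xB: "coroot x \<in> B" if "x \<in> V" for x using that by auto
  show ?thesis
  proof (rule ccontr)
    assume "C \<noteq> {}"
    then obtain y where y: "y \<in> C" by auto
    then have yr: "y \<in> roots" using AB by auto
    then obtain k where k: "y = root_comb k" by (auto simp: roots_def)
    have "y \<bullet> y = 0" using root_comb_inner[of k y] k xB AB(3) y by simp
    then show False using yr by (auto simp: roots_def)
  qed
qed

lemma irreducible_roots: "irreducible_root_system roots"
  unfolding irreducible_root_system_def
proof (intro conjI allI impI root_system_roots)
  have x0r: "coroot x0 \<in> roots" using coroot_in_roots x0_in by auto
  then show "roots \<noteq> {}" by auto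
  fix B C assume BC: "B \<union> C = roots \<and> B \<inter> C = {} \<and> (\<forall>a\<in>B. \<forall>b\<in>C. a \<bullet> b = 0)"
  then have "C \<union> B = roots" "C \<inter> B = {}" "\<forall>a\<in>C. \<forall>b\<in>B. a \<bullet> b = 0"
    by (blast, blast, metis inner_commute)
  then show "B = {} \<or> C = {}" using irreducible_half[of B C] irreducible_half[of C B] BC x0r by blast
qed

theorem extended_simple_roots_roots: "extended_simple_roots roots (coroot ` V0) (coroot ` V)"
  unfolding extended_simple_roots_def
  using irreducible_roots simple_roots_roots highest_root_theta x0_in
  by (intro disjI1 conjI exI[of _ \<theta>]) auto

end

section \<open>Highest roots\<close>

text \<open>\<open>v0\<close> is the coroot of minus the highest root, and \<open>\<rho>\<close>
  measures squared lengths in units of that of \<open>v0\<close>; integrality of the ratios reflects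
  that the highest root is longest. \<open>G v0 = 2\<close> arises only when half the highest root
  is a root, and the two evenness conditions express this.\<close>

locale extended_coroots = affine_coroots +
  fixes v0 and \<rho> :: "'a \<Rightarrow> nat"
  assumes v0_in: "v0 \<in> V"
    and \<rho>: "\<And>v. v \<in> V \<Longrightarrow> v \<bullet> v = real (\<rho> v) * (v0 \<bullet> v0)"
    and Gcd_G: "Gcd (G ` V) = 1"
    and G_v0: "G v0 = 1 \<or> G v0 = 2 \<and> (\<forall>v\<in>V - {v0}. even (\<rho> v) \<and> even (A v v0))"

locale root_data =
  fixes \<Phi> \<Delta> :: "'a::euclidean_space set" and \<theta> :: 'a
  assumes irreducible: "irreducible_root_system \<Phi>" and simple: "simple_roots \<Phi> \<Delta>"
    and highest: "highest_root \<Phi> \<Delta> \<theta>"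
begin

section \<open>Expansions in simple roots\<close>

lemma root_system: "root_system \<Phi>"
  using irreducible by (simp add: irreducible_root_system_def)

lemma root_neq_0: "a \<in> \<Phi> \<Longrightarrow> a \<noteq> 0"
  using root_system by (auto simp: root_system_def)

lemma root_inner_pos: "a \<in> \<Phi> \<Longrightarrow> 0 < a \<bullet> a"
  using root_neq_0 by auto

lemma reflect_root: "a \<in> \<Phi> \<Longrightarrow> b \<in> \<Phi> \<Longrightarrow> b - (b \<bullet> coroot a) *\<^sub>R a \<in> \<Phi>"
  using root_system by (auto simp: root_system_def)

lemma root_integral:
  assumes "a \<in> \<Phi>" "b \<in> \<Phi>" obtains m where "b \<bullet> coroot a = of_int m"
  using root_system assms unfolding root_system_def by (metis Ints_cases)

lemma minus_root: "a \<in> \<Phi> \<Longrightarrow> - a \<in> \<Phi>"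
  using reflect_root[of a a] root_neq_0[of a] by (simp add: inner_coroot_self scaleR_2)

lemma simple_subset: "\<Delta> \<subseteq> \<Phi>" using simple by (simp add: simple_roots_def)

lemma theta_root: "\<theta> \<in> \<Phi>" using highest by (simp add: highest_root_def)

definition comb :: "('a \<Rightarrow> real) \<Rightarrow> 'a" where "comb k = (\<Sum>x\<in>\<Delta>. k x *\<^sub>R x)"

lemma finite_simple: "finite \<Delta>"
  using root_system simple_subset finite_subset by (auto simp: root_system_def)

lemma indep: "(\<Sum>x\<in>\<Delta>. k x *\<^sub>R x) = 0 \<Longrightarrow> x \<in> \<Delta> \<Longrightarrow> k x = 0"
  using simple unfolding simple_roots_def independent_explicit by blast

lemma comb_diff: "comb k - comb l = comb (\<lambda>x. k x - l x)"
  by (simp add: comb_def sum_subtractf algebra_simps)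

lemma comb_inj: "comb k = comb l \<Longrightarrow> x \<in> \<Delta> \<Longrightarrow> k x = l x"
  using indep[of "\<lambda>x. k x - l x" x] comb_diff[of k l] by (simp add: comb_def)

lemma comb_unit: "a \<in> \<Delta> \<Longrightarrow> comb (\<lambda>x. if x = a then m else 0) = m *\<^sub>R a"
proof -
  assume a: "a \<in> \<Delta>"
  have "comb (\<lambda>x. if x = a then m else 0) = (\<Sum>x\<in>\<Delta>. if x = a then m *\<^sub>R x else 0)"
    unfolding comb_def by (intro sum.cong) auto
  then show ?thesis using finite_simple a by simp
qed

lemma comb_minus: "- comb k = comb (\<lambda>x. - k x)"
  by (simp add: comb_def sum_negf)

lemma comb_inner: "comb k \<bullet> y = (\<Sum>x\<in>\<Delta>. k x * (x \<bullet> y))"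
  by (simp add: comb_def inner_sum_left)

lemma comb_nonneg:
  "(\<And>x. x \<in> \<Delta> \<Longrightarrow> 0 \<le> x \<bullet> y) \<Longrightarrow> (\<And>x. x \<in> \<Delta> \<Longrightarrow> 0 \<le> k x) \<Longrightarrow> 0 \<le> comb k \<bullet> y"
  unfolding comb_inner by (intro sum_nonneg) simp

lemma root_cases:
  assumes "b \<in> \<Phi>"
  obtains c :: "'a \<Rightarrow> nat" where "b = comb (\<lambda>x. real (c x))"
  | c :: "'a \<Rightarrow> nat" where "b = - comb (\<lambda>x. real (c x))"
  using simple assms unfolding simple_roots_def comb_def by blast

lemma theta_minus_root:
  assumes "b \<in> \<Phi>"
  obtains c :: "'a \<Rightarrow> nat" where "\<theta> - b = comb (\<lambda>x. real (c x))"
  using highest assms unfolding highest_root_def comb_def by blast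

text \<open>Reflecting \<open>b\<close> in \<open>a\<close> leaves coefficient 1 at \<open>b\<close>
  and puts minus the pairing at \<open>a\<close>; the coefficients of a root have one sign.\<close>

lemma simple_obtuse:
  assumes a: "a \<in> \<Delta>" and b: "b \<in> \<Delta>" and ab: "a \<noteq> b"
  shows "b \<bullet> coroot a \<le> 0"
proof -
  have a\<Phi>: "a \<in> \<Phi>" and b\<Phi>: "b \<in> \<Phi>" using a b simple_subset by auto
  let ?m = "b \<bullet> coroot a"
  have r: "b - ?m *\<^sub>R a = comb (\<lambda>x. (if x = b then 1 else 0) - (if x = a then ?m else 0))"
    using comb_diff[of "\<lambda>x. if x = b then 1 else 0" "\<lambda>x. if x = a then ?m else 0"]
      comb_unit[OF a] comb_unit[OF b, of 1] by simp
  from reflect_root[OF a\<Phi> b\<Phi>] show ?thesis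
  proof (cases rule: root_cases)
    case (1 c)
    from comb_inj[OF this[unfolded r] a] show ?thesis using ab by simp
  next
    case (2 c)
    from comb_inj[OF this[unfolded r comb_minus] b] show ?thesis using ab by simp
  qed
qed

text \<open>\<open>\<theta>\<close> minus its reflection in \<open>a\<close> is a multiple of
  \<open>a\<close>, and must be a nonnegative combination.\<close>

lemma theta_dominant:
  assumes a: "a \<in> \<Delta>" shows "0 \<le> \<theta> \<bullet> coroot a"
proof -
  have a\<Phi>: "a \<in> \<Phi>" using a simple_subset by auto
  obtain c :: "'a \<Rightarrow> nat" where "\<theta> - (\<theta> - (\<theta> \<bullet> coroot a) *\<^sub>R a) = comb (\<lambda>x. real (c x))"
    using theta_minus_root[OF reflect_root[OF a\<Phi> theta_root]] by blast
  then have "comb (\<lambda>x. if x = a then \<theta> \<bullet> coroot a else 0) = comb (\<lambda>x. real (c x))"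
    using comb_unit[OF a] by simp
  from comb_inj[OF this a] show ?thesis by simp
qed

lemma inner_coroot_nonneg_iff: "a \<in> \<Phi> \<Longrightarrow> 0 \<le> y \<bullet> coroot a \<longleftrightarrow> 0 \<le> a \<bullet> y"
proof -
  assume "a \<in> \<Phi>"
  then obtain c where "coroot a = c *\<^sub>R a" "0 < c"
    using root_inner_pos[of a] unfolding coroot_def by (metis divide_pos_pos zero_less_numeral)
  then show ?thesis by (simp add: inner_commute zero_le_mult_iff)
qed

lemma theta_inner_nonneg: "a \<in> \<Delta> \<Longrightarrow> 0 \<le> a \<bullet> \<theta>"
  using theta_dominant inner_coroot_nonneg_iff simple_subset by blast

text \<open>Induction on the height of \<open>\<theta> - b\<close>. If \<open>b\<close> is dominant,
  \<open>\<theta> - b\<close> has nonnegative inner product with \<open>b\<close> and with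
  \<open>\<theta>\<close>, so \<open>b \<bullet> \<theta>\<close> lies between the squared lengths.
  Otherwise a simple reflection keeps the length and lowers the height.\<close>

lemma norm_le_theta_aux:
  fixes c :: "'a \<Rightarrow> nat"
  shows "b \<in> \<Phi> \<Longrightarrow> \<theta> - b = comb (\<lambda>x. real (c x)) \<Longrightarrow> (\<Sum>x\<in>\<Delta>. c x) = N \<Longrightarrow> b \<bullet> b \<le> \<theta> \<bullet> \<theta>"
proof (induction N arbitrary: b c rule: less_induct)
  case (less N)
  show ?case
  proof (cases "\<forall>a\<in>\<Delta>. 0 \<le> a \<bullet> b")
    case True
    have "0 \<le> (\<theta> - b) \<bullet> b" "0 \<le> (\<theta> - b) \<bullet> \<theta>"
      unfolding less.prems(2) using True theta_inner_nonneg by (auto intro!: comb_nonneg)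
    then show ?thesis by (simp add: inner_diff_left inner_diff_right inner_commute)
  next
    case False
    then obtain a where a: "a \<in> \<Delta>" and neg: "\<not> 0 \<le> a \<bullet> b" by auto
    have a\<Phi>: "a \<in> \<Phi>" using a simple_subset by auto
    obtain m where m: "b \<bullet> coroot a = of_int m" using root_integral[OF a\<Phi> less.prems(1)] .
    have m0: "m < 0" using neg inner_coroot_nonneg_iff[OF a\<Phi>, of b] m by simp
    let ?b = "b - (b \<bullet> coroot a) *\<^sub>R a"
    have b\<Phi>: "?b \<in> \<Phi>" using reflect_root[OF a\<Phi> less.prems(1)] .
    obtain d :: "'a \<Rightarrow> nat" where d: "\<theta> - ?b = comb (\<lambda>x. real (d x))"
      using theta_minus_root[OF b\<Phi>] by blast
    have "\<theta> - ?b = comb (\<lambda>x. real (c x)) - comb (\<lambda>x. if x = a then - of_int m else 0)"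
      using less.prems(2) comb_unit[OF a, of "- of_int m"] m by (simp add: algebra_simps)
    then have "comb (\<lambda>x. real (d x)) = comb (\<lambda>x. real (c x) - (if x = a then - of_int m else 0))"
      using d comb_diff by metis
    from comb_inj[OF this] have "real (d x) = real (c x) - (if x = a then - of_int m else 0)" if "x \<in> \<Delta>" for x
      using that .
    then have dc: "int (d x) = int (c x) + (if x = a then m else 0)" if "x \<in> \<Delta>" for x
      using that by (smt (verit) of_int_of_nat_eq of_int_add of_int_eq_iff of_int_0)
    have "int (\<Sum>x\<in>\<Delta>. d x) = (\<Sum>x\<in>\<Delta>. int (c x) + (if x = a then m else 0))"
      using dc by simp
    also have "\<dots> = int (\<Sum>x\<in>\<Delta>. c x) + m" using finite_simple a by (simp add: sum.distrib)
    finally have "(\<Sum>x\<in>\<Delta>. d x) < N" using less.prems(3) m0 by linarith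
    from less.IH[OF this b\<Phi> d refl] show ?thesis using norm_reflect[OF root_neq_0[OF a\<Phi>], of b] by simp
  qed
qed

lemma norm_le_theta: "b \<in> \<Phi> \<Longrightarrow> b \<bullet> b \<le> \<theta> \<bullet> \<theta>"
  using theta_minus_root norm_le_theta_aux by blast

section \<open>Indivisible roots and ratios of lengths\<close>

lemma half_root_reflect:
  assumes a: "a \<in> \<Phi>" and b: "(1/2) *\<^sub>R b \<notin> \<Phi>"
  shows "(1/2) *\<^sub>R (b - (b \<bullet> coroot a) *\<^sub>R a) \<notin> \<Phi>"
proof
  let ?h = "(1/2) *\<^sub>R b"
  assume "(1/2) *\<^sub>R (b - (b \<bullet> coroot a) *\<^sub>R a) \<in> \<Phi>"
  moreover have "(1/2) *\<^sub>R (b - (b \<bullet> coroot a) *\<^sub>R a) = ?h - (?h \<bullet> coroot a) *\<^sub>R a"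
    by (simp add: scaleR_diff_right)
  ultimately have c: "?h - (?h \<bullet> coroot a) *\<^sub>R a \<in> \<Phi>" by simp
  from reflect_root[OF a this] have "?h \<in> \<Phi>"
    unfolding reflect_reflect[OF root_neq_0[OF a] refl] .
  then show False using b by simp
qed

lemma half_simple: "a \<in> \<Delta> \<Longrightarrow> (1/2) *\<^sub>R a \<notin> \<Phi>"
proof
  assume a: "a \<in> \<Delta>" and "(1/2) *\<^sub>R a \<in> \<Phi>"
  then have h: "comb (\<lambda>x. if x = a then 1/2 else 0) \<in> \<Phi>" using comb_unit[OF a, of "1/2"] by simp
  have no: "1/2 \<noteq> real n" for n
  proof
    assume "1/2 = real n"
    then have "real 1 = real (2 * n)" by simp
    then have "1 = 2 * n" by (simp only: of_nat_eq_iff)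
    then show False by presburger
  qed
  from h show False
  proof (cases rule: root_cases)
    case (1 c)
    from comb_inj[OF this a] show False using no[of "c a"] by simp
  next
    case (2 c)
    from comb_inj[OF this[unfolded comb_minus] a] show False by simp
  qed
qed

text \<open>The indivisible roots with the length of \<open>a\<close> form a set \<open>X\<close>
  stable under reflections. The roots orthogonal to all of \<open>X\<close> are therefore orthogonal
  to all other roots, and irreducibility leaves none of them.\<close>

lemma exists_not_orthogonal:
  assumes a: "a \<in> \<Delta>"
  obtains b where "b \<in> \<Phi>" "b \<bullet> b = a \<bullet> a" "(1/2) *\<^sub>R b \<notin> \<Phi>" "b \<bullet> \<theta> \<noteq> 0"
proof -
  define X where "X = {b \<in> \<Phi>. b \<bullet> b = a \<bullet> a \<and> (1/2) *\<^sub>R b \<notin> \<Phi>}"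
  have aX: "a \<in> X" using a simple_subset half_simple by (auto simp: X_def)
  have X: "b - (b \<bullet> coroot c) *\<^sub>R c \<in> X" if "b \<in> X" "c \<in> \<Phi>" for b c
    using that reflect_root[of c b] half_root_reflect[of c b] norm_reflect[OF root_neq_0[of c], of b]
    by (simp add: X_def)
  define B where "B = {c \<in> \<Phi>. \<forall>x\<in>X. x \<bullet> c = 0}"
  have orth: "b \<bullet> c = 0" if b: "b \<in> B" and c: "c \<in> \<Phi> - B" for b c
  proof -
    obtain x where x: "x \<in> X" "x \<bullet> c \<noteq> 0" using c by (auto simp: B_def)
    have "(x - (x \<bullet> coroot c) *\<^sub>R c) \<bullet> b = 0" "x \<bullet> b = 0" using b X[of x c] x c by (auto simp: B_def)
    then have "(x \<bullet> coroot c) * (c \<bullet> b) = 0" by (simp add: inner_diff_left)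
    moreover have "x \<bullet> coroot c \<noteq> 0" using x c root_inner_pos[of c] by (auto simp: coroot_def)
    ultimately show ?thesis by (simp add: inner_commute)
  qed
  have "B \<union> (\<Phi> - B) = \<Phi> \<and> B \<inter> (\<Phi> - B) = {} \<and> (\<forall>a\<in>B. \<forall>b\<in>\<Phi> - B. a \<bullet> b = 0)"
    using orth by (auto simp: B_def)
  then have "B = {} \<or> \<Phi> - B = {}"
    using irreducible unfolding irreducible_root_system_def by blast
  moreover have "a \<in> \<Phi> - B" using aX root_inner_pos[of a] a simple_subset by (force simp: B_def)
  ultimately have "\<theta> \<notin> B" by blast
  then show thesis using that theta_root by (auto simp: B_def X_def)
qed

text \<open>The squared lengths of \<open>\<theta>\<close> and \<open>b\<close> are in the ratio of
  the Cartan integers \<open>p\<close> and \<open>n\<close>. As \<open>\<theta>\<close> is longest,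
  \<open>n\<close> is 1 or -1 unless \<open>b\<close> is \<open>\<theta>\<close> or its negative. If
  half of \<open>\<theta>\<close> is a root, it pairs integrally with \<open>coroot b\<close>, so
  \<open>p\<close> is even; and then \<open>b\<close>, being indivisible, is neither
  \<open>\<theta>\<close> nor its negative.\<close>

lemma theta_ratio:
  assumes a: "a \<in> \<Delta>"
  obtains m :: nat where "\<theta> \<bullet> \<theta> = real m * (a \<bullet> a)" "(1/2) *\<^sub>R \<theta> \<in> \<Phi> \<Longrightarrow> even m"
proof -
  obtain b where b: "b \<in> \<Phi>" "b \<bullet> b = a \<bullet> a" "(1/2) *\<^sub>R b \<notin> \<Phi>" "b \<bullet> \<theta> \<noteq> 0"
    using exists_not_orthogonal[OF a] .
  have b0: "0 < b \<bullet> b" and t0: "0 < \<theta> \<bullet> \<theta>" using root_inner_pos b theta_root by auto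
  obtain n where n: "b \<bullet> coroot \<theta> = of_int n" using root_integral[OF theta_root b(1)] .
  obtain p where p: "\<theta> \<bullet> coroot b = of_int p" using root_integral[OF b(1) theta_root] .
  have nt: "of_int n * (\<theta> \<bullet> \<theta>) = 2 * (b \<bullet> \<theta>)" using inner_coroot_mult[of b \<theta>] n by simp
  have pb: "of_int p * (b \<bullet> b) = 2 * (b \<bullet> \<theta>)" using inner_coroot_mult[of \<theta> b] p by (simp add: inner_commute)
  have n0: "n \<noteq> 0" using nt b(4) by auto
  have le: "b \<bullet> b \<le> \<theta> \<bullet> \<theta>" using norm_le_theta b(1) by simp
  show thesis
  proof (cases "\<bar>n\<bar> = 1")
    case True
    have "\<theta> \<bullet> \<theta> = \<bar>of_int n * (\<theta> \<bullet> \<theta>)\<bar>" using True t0 by (simp add: abs_mult flip: of_int_abs)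
    also have "\<dots> = \<bar>of_int p * (b \<bullet> b)\<bar>" using nt pb by simp
    also have "\<dots> = real (nat \<bar>p\<bar>) * (a \<bullet> a)" using b(2) b0 by (simp add: abs_mult)
    finally have 1: "\<theta> \<bullet> \<theta> = real (nat \<bar>p\<bar>) * (a \<bullet> a)" .
    have 2: "even (nat \<bar>p\<bar>)" if half: "(1/2) *\<^sub>R \<theta> \<in> \<Phi>"
    proof -
      obtain q where "((1/2) *\<^sub>R \<theta>) \<bullet> coroot b = of_int q" using root_integral[OF b(1) half] .
      then have "real_of_int p = of_int (2 * q)" using p by simp
      then have "p = 2 * q" by (simp only: of_int_eq_iff)
      then show ?thesis by (simp add: even_nat_iff)
    qed
    show thesis using that[OF 1 2] by simp
  next
    case False
    have pm: "b = \<theta> \<or> b = - \<theta>"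
    proof (cases "0 < n")
      case True
      then have "2 * (\<theta> \<bullet> \<theta>) \<le> of_int n * (\<theta> \<bullet> \<theta>)" using t0 False by (intro mult_right_mono) auto
      then have "(b - \<theta>) \<bullet> (b - \<theta>) \<le> 0" using nt le
        by (simp add: inner_diff_left inner_diff_right inner_commute)
      then show ?thesis by (metis eq_iff_diff_eq_0 inner_gt_zero_iff not_less)
    next
      case neg: False
      then have "2 * (\<theta> \<bullet> \<theta>) \<le> of_int (- n) * (\<theta> \<bullet> \<theta>)" using t0 False n0 by (intro mult_right_mono) auto
      then have "(b + \<theta>) \<bullet> (b + \<theta>) \<le> 0" using nt le
        by (simp add: inner_add_left inner_add_right inner_commute)
      then show ?thesis by (metis add_eq_0_iff2 inner_gt_zero_iff not_less)
    qed
    then have 1: "\<theta> \<bullet> \<theta> = real 1 * (a \<bullet> a)" using b(2) by auto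
    have 2: "even (1::nat)" if "(1/2) *\<^sub>R \<theta> \<in> \<Phi>"
      using pm b(3) that minus_root[OF that] by auto
    show thesis using that[OF 1 2] by simp
  qed
qed

text \<open>Induction on the height: a simple reflection lowers it and changes the coroot by an
  integral multiple of \<open>coroot a\<close>. The reflected root can be negative only if
  \<open>b\<close> is a multiple of \<open>a\<close>. The factor then divides 2, and 2 is excluded
  because \<open>b\<close> is indivisible; the coroot of twice \<open>a\<close> is half of
  \<open>coroot a\<close>.\<close>

lemma coroot_int_comb_aux:
  fixes c :: "'a \<Rightarrow> nat"
  shows "b \<in> \<Phi> \<Longrightarrow> (1/2) *\<^sub>R b \<notin> \<Phi> \<Longrightarrow> b = comb (\<lambda>x. real (c x)) \<Longrightarrow> (\<Sum>x\<in>\<Delta>. c x) = N \<Longrightarrow>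
    \<exists>l :: 'a \<Rightarrow> int. coroot b = (\<Sum>x\<in>\<Delta>. of_int (l x) *\<^sub>R coroot x)"
proof (induction N arbitrary: b c rule: less_induct)
  case (less N)
  have unit: "(\<Sum>x\<in>\<Delta>. of_int (if x = a then m else 0) *\<^sub>R coroot x) = of_int m *\<^sub>R coroot a"
    if "a \<in> \<Delta>" for a m
  proof -
    have "(\<Sum>x\<in>\<Delta>. of_int (if x = a then m else 0) *\<^sub>R coroot x)
        = (\<Sum>x\<in>\<Delta>. if x = a then of_int m *\<^sub>R coroot x else 0)" by (intro sum.cong) auto
    then show ?thesis using finite_simple that by simp
  qed
  obtain a where a: "a \<in> \<Delta>" and pos: "0 < a \<bullet> b"
  proof (rule ccontr)
    assume "\<not> thesis"
    then have "a \<bullet> b \<le> 0" if "a \<in> \<Delta>" for a using that \<open>\<And>a. \<lbrakk>a \<in> \<Delta>; 0 < a \<bullet> b\<rbrakk> \<Longrightarrow> thesis\<close> by force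
    then have "comb (\<lambda>x. real (c x)) \<bullet> b \<le> 0" unfolding comb_inner
      by (intro sum_nonpos) (simp add: mult_nonneg_nonpos)
    then show False using root_inner_pos[OF less.prems(1)] less.prems(3) by (metis not_less)
  qed
  have a\<Phi>: "a \<in> \<Phi>" using a simple_subset by auto
  obtain m where m: "b \<bullet> coroot a = of_int m" using root_integral[OF a\<Phi> less.prems(1)] .
  have "0 < (b \<bullet> coroot a) * (a \<bullet> a)" using inner_coroot_mult[of b a] pos by (simp add: inner_commute)
  then have m0: "0 < m" using m root_inner_pos[OF a\<Phi>] by (simp add: zero_less_mult_iff)
  obtain p where p: "a \<bullet> coroot b = of_int p" using root_integral[OF less.prems(1) a\<Phi>] .
  let ?b = "b - (b \<bullet> coroot a) *\<^sub>R a"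
  have b\<Phi>: "?b \<in> \<Phi>" using reflect_root[OF a\<Phi> less.prems(1)] .
  have bc: "?b = comb (\<lambda>x. real (c x) - (if x = a then of_int m else 0))"
    using less.prems(3) comb_diff[of "\<lambda>x. real (c x)" "\<lambda>x. if x = a then of_int m else 0"]
      comb_unit[OF a, of "of_int m"] m by simp
  from b\<Phi> show ?case
  proof (cases rule: root_cases)
    case (1 d)
    then have "comb (\<lambda>x. real (d x)) = comb (\<lambda>x. real (c x) - (if x = a then of_int m else 0))"
      using bc by simp
    from comb_inj[OF this] have "real (d x) = real (c x) - (if x = a then of_int m else 0)" if "x \<in> \<Delta>" for x
      using that .
    then have dc: "int (d x) = int (c x) - (if x = a then m else 0)" if "x \<in> \<Delta>" for x
      using that by (smt (verit) of_int_of_nat_eq of_int_diff of_int_eq_iff of_int_0)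
    have "int (\<Sum>x\<in>\<Delta>. d x) = (\<Sum>x\<in>\<Delta>. int (c x) - (if x = a then m else 0))"
      using dc by simp
    also have "\<dots> = int (\<Sum>x\<in>\<Delta>. c x) - m" using finite_simple a by (simp add: sum_subtractf)
    finally have "(\<Sum>x\<in>\<Delta>. d x) < N" using less.prems(4) m0 by linarith
    from less.IH[OF this b\<Phi> half_root_reflect[OF a\<Phi> less.prems(2)] 1 refl]
    obtain l :: "'a \<Rightarrow> int" where l: "coroot ?b = (\<Sum>x\<in>\<Delta>. of_int (l x) *\<^sub>R coroot x)" by blast
    have "coroot b = coroot ?b + of_int p *\<^sub>R coroot a"
      using coroot_reflect[OF root_neq_0[OF a\<Phi>], of b] p by simp
    also have "\<dots> = (\<Sum>x\<in>\<Delta>. of_int (l x + (if x = a then p else 0)) *\<^sub>R coroot x)"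
      unfolding l unit[OF a, symmetric] sum.distrib[symmetric] by (simp add: scaleR_left_distrib)
    finally show ?thesis by (intro exI[of _ "\<lambda>x. l x + (if x = a then p else 0)"])
  next
    case (2 d)
    then have eq: "comb (\<lambda>x. - real (d x)) = comb (\<lambda>x. real (c x) - (if x = a then of_int m else 0))"
      using bc comb_minus by simp
    have "c x = 0" if "x \<in> \<Delta>" "x \<noteq> a" for x using comb_inj[OF eq that(1)] that(2) by simp
    then have "b = comb (\<lambda>x. if x = a then real (c a) else 0)"
      unfolding less.prems(3) comb_def by (intro sum.cong) auto
    then have ba: "b = real (c a) *\<^sub>R a" using comb_unit[OF a] by simp
    have "of_int p * (b \<bullet> b) = 2 * (a \<bullet> b)" using inner_coroot_mult[of a b] p by simp
    then have "of_int p * (real (c a) * real (c a)) * (a \<bullet> a) = 2 * real (c a) * (a \<bullet> a)"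
      unfolding ba by (simp add: mult.assoc)
    moreover have ca: "c a \<noteq> 0" using ba root_neq_0[OF less.prems(1)] by auto
    ultimately have "of_int p * real (c a) = (2::real)" using root_neq_0[OF a\<Phi>] by auto
    then have "real_of_int (p * int (c a)) = of_int 2" by simp
    then have "p * int (c a) = 2" by (simp only: of_int_eq_iff)
    then have "int (c a) dvd 2" by (metis dvd_triv_right)
    then have "c a dvd 2" by (metis int_dvd_int_iff of_nat_numeral)
    then have "c a \<le> 2" by (auto dest: dvd_imp_le)
    then have "c a = 1 \<or> c a = 2" using ca by linarith
    then have "b = a"
    proof
      assume "c a = 2" then show ?thesis using ba less.prems(2) a\<Phi> by simp
    qed (simp add: ba)
    then show ?thesis using unit[OF a, of 1] by (intro exI[of _ "\<lambda>x. if x = a then 1 else 0"]) simp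
  qed
qed

lemma coroot_int_comb:
  assumes b: "b \<in> \<Phi>" "(1/2) *\<^sub>R b \<notin> \<Phi>"
  obtains l :: "'a \<Rightarrow> int" where "coroot b = (\<Sum>x\<in>\<Delta>. of_int (l x) *\<^sub>R coroot x)"
  using b(1)
proof (cases rule: root_cases)
  case (1 c)
  show thesis using coroot_int_comb_aux[OF b 1 refl] that by blast
next
  case (2 c)
  have "(1/2) *\<^sub>R (- b) \<notin> \<Phi>" using b(2) minus_root[of "(1/2) *\<^sub>R (- b)"] by auto
  moreover have "- b = comb (\<lambda>x. real (c x))" using 2 by simp
  ultimately obtain l :: "'a \<Rightarrow> int" where "coroot (- b) = (\<Sum>x\<in>\<Delta>. of_int (l x) *\<^sub>R coroot x)"
    using coroot_int_comb_aux[OF minus_root[OF b(1)] _ _ refl] by blast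
  then have "coroot b = (\<Sum>x\<in>\<Delta>. of_int (- l x) *\<^sub>R coroot x)"
    by (metis (mono_tags, lifting) coroot_minus minus_equation_iff of_int_minus scaleR_minus_left sum.cong sum_negf)
  then show thesis by (rule that)
qed


section \<open>Relations among the extended coroots\<close>

lemma coroots_indep:
  assumes "(\<Sum>x\<in>\<Delta>. c x *\<^sub>R coroot x) = 0" "x \<in> \<Delta>"
  shows "c x = 0"
proof -
  have "(\<Sum>x\<in>\<Delta>. (c x * (2 / (x \<bullet> x))) *\<^sub>R x) = 0" using assms(1) by (simp add: coroot_def)
  from indep[OF this assms(2)] show ?thesis using root_inner_pos[of x] simple_subset assms(2) by auto
qed

text \<open>Cross-multiplication eliminates the coefficient at \<open>- \<theta>\<close> and leaves
  a relation among the independent simple coroots.\<close>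

lemma coroots_relation:
  assumes \<theta>: "- \<theta> \<notin> \<Delta>" and g: "g (- \<theta>) \<noteq> 0"
    and sum_g: "(\<Sum>a\<in>insert (- \<theta>) \<Delta>. g a *\<^sub>R coroot a) = 0"
    and sum_c: "(\<Sum>a\<in>insert (- \<theta>) \<Delta>. c a *\<^sub>R coroot a) = 0"
    and a: "a \<in> insert (- \<theta>) \<Delta>"
  shows "c a * g (- \<theta>) = c (- \<theta>) * g a"
proof -
  let ?d = "\<lambda>a. c a * g (- \<theta>) - c (- \<theta>) * g a"
  have "(\<Sum>a\<in>insert (- \<theta>) \<Delta>. ?d a *\<^sub>R coroot a) =
      g (- \<theta>) *\<^sub>R (\<Sum>a\<in>insert (- \<theta>) \<Delta>. c a *\<^sub>R coroot a)
      - c (- \<theta>) *\<^sub>R (\<Sum>a\<in>insert (- \<theta>) \<Delta>. g a *\<^sub>R coroot a)"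
    unfolding scaleR_sum_right sum_subtractf[symmetric] by (intro sum.cong) (simp_all add: algebra_simps)
  also have "\<dots> = 0" using sum_g sum_c by (simp del: sum.insert)
  finally have "(\<Sum>a\<in>\<Delta>. ?d a *\<^sub>R coroot a) = 0" using \<theta> finite_simple by simp
  from coroots_indep[OF this, of a] a show ?thesis by auto
qed

lemma extended_coroots:
  assumes E: "E = insert (- \<theta>) \<Delta>" and g: "coroot_integers E g"
  obtains A \<rho> where "extended_coroots (coroot ` E) (\<lambda>v. g (coroot v)) A (coroot (- \<theta>)) \<rho>"
proof -
  let ?V = "coroot ` E" and ?v0 = "coroot (- \<theta>)" and ?G = "\<lambda>v. g (coroot v)"
  have E\<Phi>: "E \<subseteq> \<Phi>" using simple_subset minus_root[OF theta_root] E by auto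
  have g_pos: "\<And>a. a \<in> E \<Longrightarrow> 0 < g a" and g_gcd: "Gcd (g ` E) = 1"
    and g_sum: "(\<Sum>a\<in>E. real (g a) *\<^sub>R coroot a) = 0"
    using g by (auto simp: coroot_integers_def)
  have sum_V: "(\<Sum>v\<in>?V. c v *\<^sub>R v) = (\<Sum>a\<in>E. c (coroot a) *\<^sub>R coroot a)" for c
    by (subst sum.reindex[OF inj_coroot]) simp
  have notin: "- \<theta> \<notin> \<Delta>"
  proof
    assume "- \<theta> \<in> \<Delta>"
    then have "E = \<Delta>" using E by auto
    then show False using coroots_indep[of "\<lambda>a. real (g a)" "- \<theta>"] g_sum g_pos[of "- \<theta>"] \<open>- \<theta> \<in> \<Delta>\<close> by simp
  qed
  have relation: "c a * real (g (- \<theta>)) = c (- \<theta>) * real (g a)"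
    if "(\<Sum>a\<in>E. c a *\<^sub>R coroot a) = 0" "a \<in> E" for c a
    using coroots_relation[OF notin, of "\<lambda>a. real (g a)" c a] that g_sum g_pos[of "- \<theta>"] E by simp
  \<comment> \<open>For distinct members of \<open>?V\<close> the value is a nonnegative integer, so
    \<open>nat\<close> and the floor lose nothing.\<close>
  define A where "A u v = (if u = v then 0 else nat \<lfloor>- (u \<bullet> coroot v)\<rfloor>)" for u v :: 'a
  have A: "u \<bullet> coroot v = - real (A u v)" if uv: "u \<in> ?V" "v \<in> ?V" "u \<noteq> v" for u v
  proof -
    obtain a b where ab: "a \<in> E" "b \<in> E" "u = coroot a" "v = coroot b" using uv by auto
    then have ne: "a \<noteq> b" using uv by auto
    obtain m where m: "b \<bullet> coroot a = of_int m" using root_integral[of a b] ab E\<Phi> by blast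
    have "b \<bullet> coroot a \<le> 0"
      using ab(1,2) unfolding E
    proof (elim insertE)
      assume "a = - \<theta>" "b \<in> \<Delta>"
      then show ?thesis using theta_inner_nonneg[of b] root_inner_pos[OF theta_root]
        by (simp add: coroot_def)
    next
      assume "a \<in> \<Delta>" "b = - \<theta>"
      then show ?thesis using theta_dominant[of a] by simp
    next
      assume "a \<in> \<Delta>" "b \<in> \<Delta>"
      then show ?thesis using simple_obtuse ne by blast
    qed (use ne in auto)
    then show ?thesis using m ne ab(3,4) uv(3) unfolding A_def by (simp add: inner_commute)
  qed
  have "\<forall>v\<in>?V. \<exists>m. v \<bullet> v = real m * (?v0 \<bullet> ?v0) \<and> ((1/2) *\<^sub>R \<theta> \<in> \<Phi> \<longrightarrow> v \<noteq> ?v0 \<longrightarrow> even m)"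
  proof
    fix v assume v: "v \<in> ?V"
    show "\<exists>m. v \<bullet> v = real m * (?v0 \<bullet> ?v0) \<and> ((1/2) *\<^sub>R \<theta> \<in> \<Phi> \<longrightarrow> v \<noteq> ?v0 \<longrightarrow> even m)"
    proof (cases "v = ?v0")
      case True
      then show ?thesis by (intro exI[of _ 1]) simp
    next
      case False
      then obtain a where a: "a \<in> \<Delta>" "v = coroot a" using v E by auto
      obtain m where m: "\<theta> \<bullet> \<theta> = real m * (a \<bullet> a)" "(1/2) *\<^sub>R \<theta> \<in> \<Phi> \<Longrightarrow> even m"
        using theta_ratio[OF a(1)] by blast
      have "v \<bullet> v = real m * (?v0 \<bullet> ?v0)"
        using m(1) root_inner_pos[of a] root_inner_pos[OF theta_root] a simple_subset
        by (auto simp: coroot_inner_coroot)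
      then show ?thesis using m(2) by blast
    qed
  qed
  then obtain \<rho> where \<rho>: "\<And>v. v \<in> ?V \<Longrightarrow> v \<bullet> v = real (\<rho> v) * (?v0 \<bullet> ?v0)"
    "\<And>v. v \<in> ?V \<Longrightarrow> (1/2) *\<^sub>R \<theta> \<in> \<Phi> \<Longrightarrow> v \<noteq> ?v0 \<Longrightarrow> even (\<rho> v)"
    by (metis (no_types))
  \<comment> \<open>Such an expansion is a relation with coefficient \<open>p\<close> at
    \<open>- \<theta>\<close>. Being proportional to \<open>g\<close>, it makes
    \<open>g (- \<theta>)\<close> divide all \<open>p * g a\<close>, whose greatest common divisor
    is \<open>p\<close>.\<close>
  have dvd: "g (- \<theta>) dvd p" if l: "real p *\<^sub>R coroot \<theta> = (\<Sum>x\<in>\<Delta>. of_int (l x) *\<^sub>R coroot x)" for p l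
  proof -
    let ?c = "\<lambda>a. if a = - \<theta> then real p else of_int (l a)"
    have "(\<Sum>a\<in>\<Delta>. ?c a *\<^sub>R coroot a) = (\<Sum>x\<in>\<Delta>. of_int (l x) *\<^sub>R coroot x)"
      using notin by (intro sum.cong) auto
    then have "(\<Sum>a\<in>E. ?c a *\<^sub>R coroot a) = 0"
      unfolding E using finite_simple notin l by simp
    from relation[OF this] have r: "?c a * real (g (- \<theta>)) = real p * real (g a)" if "a \<in> E" for a
      using that by simp
    have "g (- \<theta>) dvd p * g a" if a: "a \<in> E" for a
    proof (cases "a = - \<theta>")
      case False
      then have "real_of_int (l a * int (g (- \<theta>))) = of_int (int (p * g a))" using r[OF a] by simp
      then have "l a * int (g (- \<theta>)) = int (p * g a)" by (simp only: of_int_eq_iff)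
      then have "int (g (- \<theta>)) dvd int (p * g a)" by (metis dvd_triv_right)
      then show ?thesis by (simp only: int_dvd_int_iff)
    qed simp
    then have "g (- \<theta>) dvd Gcd ((*) p ` (g ` E))" by (intro Gcd_greatest) auto
    also have "Gcd ((*) p ` (g ` E)) = p * Gcd (g ` E)" using Gcd_mult[of p "g ` E"] by simp
    finally show ?thesis using g_gcd by simp
  qed
  \<comment> \<open>For indivisible \<open>\<theta>\<close> the choice \<open>p = 1\<close> works.
    Otherwise half of \<open>\<theta>\<close> is indivisible and has twice the coroot of
    \<open>\<theta>\<close>, which gives \<open>p = 2\<close>.\<close>
  have G_v0: "g (- \<theta>) = 1 \<or> g (- \<theta>) = 2 \<and> (1/2) *\<^sub>R \<theta> \<in> \<Phi>"
  proof (cases "(1/2) *\<^sub>R \<theta> \<in> \<Phi>")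
    case False
    obtain l :: "'a \<Rightarrow> int" where "coroot \<theta> = (\<Sum>x\<in>\<Delta>. of_int (l x) *\<^sub>R coroot x)"
      using coroot_int_comb[OF theta_root False] .
    then show ?thesis using dvd[of 1 l] by simp
  next
    case True
    let ?h = "(1/2) *\<^sub>R \<theta>"
    have "(1/2) *\<^sub>R ?h \<notin> \<Phi>"
    proof
      assume "(1/2) *\<^sub>R ?h \<in> \<Phi>"
      then obtain m where "((1/2) *\<^sub>R ?h) \<bullet> coroot \<theta> = of_int m"
        using root_integral[OF theta_root] by blast
      then have "1 / 2 = real_of_int m" using inner_coroot_self[OF root_neq_0[OF theta_root]] by simp
      then have "real_of_int 1 = of_int (2 * m)" by simp
      then have "1 = 2 * m" by (simp only: of_int_eq_iff)
      then show False by presburger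
    qed
    then obtain l :: "'a \<Rightarrow> int" where "coroot ?h = (\<Sum>x\<in>\<Delta>. of_int (l x) *\<^sub>R coroot x)"
      using coroot_int_comb[OF True] by blast
    moreover have "coroot ?h = real 2 *\<^sub>R coroot \<theta>" by (simp add: coroot_def)
    ultimately have "g (- \<theta>) dvd 2" using dvd[of 2 l] by simp
    then have "g (- \<theta>) \<le> 2" by (auto dest: dvd_imp_le)
    moreover have "0 < g (- \<theta>)" using g_pos E by simp
    ultimately show ?thesis using True by linarith
  qed
  \<comment> \<open>The coroot of \<open>?v0\<close> is \<open>- \<theta>\<close>, and already half
    of \<open>\<theta>\<close> pairs integrally with every coroot.\<close>
  have A_v0: "even (A v ?v0)" if half: "(1/2) *\<^sub>R \<theta> \<in> \<Phi>" and v: "v \<in> ?V - {?v0}" for v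
  proof -
    obtain a where a: "a \<in> E" "v = coroot a" using v by auto
    obtain m where "((1/2) *\<^sub>R \<theta>) \<bullet> coroot a = of_int m" using root_integral half a E\<Phi> by blast
    then have "v \<bullet> \<theta> = of_int (2 * m)" using a by (simp add: inner_commute)
    moreover have "v \<bullet> coroot ?v0 = - real (A v ?v0)" using v E by (intro A) auto
    ultimately have "real_of_int (int (A v ?v0)) = of_int (2 * m)" unfolding coroot_coroot by simp
    then have "int (A v ?v0) = 2 * m" by (simp only: of_int_eq_iff)
    then show ?thesis by presburger
  qed
  show thesis
  proof (rule that[of A \<rho>], unfold_locales)
    show "finite ?V" using E finite_simple by simp
    show "0 \<notin> ?V" using E\<Phi> root_neq_0 by auto
    show "0 < ?G v" if "v \<in> ?V" for v using that g_pos by auto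
    show "(\<Sum>v\<in>?V. real (?G v) *\<^sub>R v) = 0" unfolding sum_V using g_sum by simp
    show "\<exists>t. \<forall>v\<in>?V. c v = t * real (?G v)" if c: "(\<Sum>v\<in>?V. c v *\<^sub>R v) = 0" for c
    proof (intro exI[of _ "c ?v0 / real (g (- \<theta>))"] ballI)
      fix v assume "v \<in> ?V"
      then show "c v = c ?v0 / real (g (- \<theta>)) * real (?G v)"
        using relation[of "\<lambda>a. c (coroot a)" "coroot v"] c[unfolded sum_V] g_pos[of "- \<theta>"] E
        by (auto simp: field_simps)
    qed
    show "2 * (u \<bullet> v) = - real (A u v) * (v \<bullet> v)" if "u \<in> ?V" "v \<in> ?V" "u \<noteq> v" for u v
      using A[OF that] inner_coroot_mult[of u v] by simp
    show "A v v = 0" for v by (simp add: A_def)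
    show "?v0 \<in> ?V" using E by auto
    show "v \<bullet> v = real (\<rho> v) * (?v0 \<bullet> ?v0)" if "v \<in> ?V" for v using \<rho>(1)[OF that] .
    have "?G ` ?V = g ` E" by (simp add: image_image)
    then show "Gcd (?G ` ?V) = 1" using g_gcd by metis
    show "?G ?v0 = 1 \<or> ?G ?v0 = 2 \<and> (\<forall>v\<in>?V - {?v0}. even (\<rho> v) \<and> even (A v ?v0))"
      using G_v0 A_v0 \<rho>(2) by auto
  qed
qed

end

section \<open>Components and node types\<close>

definition component :: "'a diagram \<Rightarrow> 'a set \<Rightarrow> 'a \<Rightarrow> 'a set" where
  "component D I w = {u. (joined (full_subdiagram D I))\<^sup>*\<^sup>* w u}"

lemma joined_full_subdiagram:
  "joined (full_subdiagram D I) u v \<longleftrightarrow> u \<in> I \<and> v \<in> I \<and> joined D u v"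
  by (auto simp: joined_def full_subdiagram_def)

lemma component_self: "w \<in> component D I w"
  by (simp add: component_def)

lemma component_subset: "w \<in> I \<Longrightarrow> component D I w \<subseteq> I"
proof
  fix u assume w: "w \<in> I" and "u \<in> component D I w"
  then have "(joined (full_subdiagram D I))\<^sup>*\<^sup>* w u" by (simp add: component_def)
  then show "u \<in> I" using w by (induction rule: rtranclp_induct) (auto simp: joined_full_subdiagram)
qed

lemma component_eq:
  assumes sym: "symp (joined D)" and u: "u \<in> component D I w"
  shows "component D I u = component D I w"
proof -
  let ?J = "joined (full_subdiagram D I)"
  have "symp ?J" using sym unfolding symp_def joined_full_subdiagram by blast
  then have "?J\<^sup>*\<^sup>* u w" "?J\<^sup>*\<^sup>* w u"
    using u by (auto simp: component_def dest: sympD[OF symp_rtranclp])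
  then show ?thesis unfolding component_def by (auto intro: rtranclp_trans)
qed

lemma component_eqI:
  assumes w: "w \<in> C" and closed: "\<And>u v. u \<in> C \<Longrightarrow> v \<in> I \<Longrightarrow> joined D u v \<Longrightarrow> v \<in> C"
    and conn: "\<And>u. u \<in> C \<Longrightarrow> u \<in> component D I w"
  shows "component D I w = C"
proof
  show "component D I w \<subseteq> C"
  proof
    fix u assume "u \<in> component D I w"
    then have "(joined (full_subdiagram D I))\<^sup>*\<^sup>* w u" by (simp add: component_def)
    then show "u \<in> C" using w closed
      by (induction rule: rtranclp_induct) (auto simp: joined_full_subdiagram)
  qed
qed (use conn in auto)

lemma component_step:
  "u \<in> component D I w \<Longrightarrow> u \<in> I \<Longrightarrow> v \<in> I \<Longrightarrow> joined D u v \<Longrightarrow> v \<in> component D I w"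
  by (auto simp: component_def joined_full_subdiagram intro: rtranclp.rtrancl_into_rtrancl)

lemma adjacent_components_eq:
  assumes sym: "symp (joined D)" and I: "I \<subseteq> nodes D"
  shows "adjacent_components D I v = component D I ` {w \<in> I. joined D v w}"
proof -
  have c: "diagram_components (full_subdiagram D I) = component D I ` I"
    using I by (auto simp: diagram_components_def component_def full_subdiagram_def)
  show ?thesis
  proof
    show "adjacent_components D I v \<subseteq> component D I ` {w \<in> I. joined D v w}"
    proof
      fix C assume "C \<in> adjacent_components D I v"
      then have C: "C \<in> component D I ` I" "\<exists>w\<in>C. joined D v w"
        unfolding adjacent_components_def c by simp_all
      from C(1) obtain w0 where w0: "w0 \<in> I" "C = component D I w0" by (elim imageE)
      from C(2) obtain w where w: "w \<in> C" "joined D v w" by (elim bexE)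
      note w = w0 w
      have "w \<in> I" using component_subset[OF w(1)] w(3) unfolding w(2) by (rule subsetD)
      moreover have "component D I w = C"
        using component_eq[OF sym w(3)[unfolded w(2)]] w(2) by simp
      ultimately show "C \<in> component D I ` {w \<in> I. joined D v w}" using w(4) by (metis (mono_tags, lifting) image_eqI mem_Collect_eq)
    qed
    show "component D I ` {w \<in> I. joined D v w} \<subseteq> adjacent_components D I v"
    proof
      fix C assume "C \<in> component D I ` {w \<in> I. joined D v w}"
      then obtain w where w: "w \<in> I" "joined D v w" "C = component D I w" by blast
      then show "C \<in> adjacent_components D I v"
        unfolding adjacent_components_def c using component_self[of w D I]
        by (metis (mono_tags, lifting) image_eqI mem_Collect_eq)
    qed
  qed
qed

lemma type_A_card: "type_A D m C \<Longrightarrow> C \<subseteq> nodes D \<Longrightarrow> card C = m"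
proof -
  assume t: "type_A D m C" and C: "C \<subseteq> nodes D"
  then obtain f where "bij_betw f (nodes D \<inter> C) {..<m}"
    by (auto simp: type_A_def diagram_iso_def full_subdiagram_def A_diagram_def)
  moreover have "nodes D \<inter> C = C" using C by auto
  ultimately show ?thesis using bij_betw_same_card by fastforce
qed

lemma new_length_eqI:
  assumes "node_type D I len v (enat m)" and "\<And>s. node_type D I len v s \<Longrightarrow> s = enat m"
  shows "new_length D I len v = len v / sqrt (real m)"
proof -
  have "(THE r. node_type D I len v r) = enat m" using assms by (rule the_equality)
  then show ?thesis by (simp add: new_length_def)
qed

lemma enat_numerals: "enat 1 = 1" "enat 2 = 2" "enat 3 = 3" "enat 4 = 4"
  by (simp_all add: one_enat_def numeral_eq_enat)

lemma new_length_type1: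
  assumes "\<not> type_inf D I v" "{w \<in> I. joined D v w} = {}" "adjacent_components D I v = {}"
  shows "new_length D I len v = len v / sqrt (real 1)"
proof (rule new_length_eqI)
  show "node_type D I len v (enat 1)"
    using assms unfolding node_type_def type1_def enat_numerals by auto
  show "s = enat 1" if "node_type D I len v s" for s
  proof -
    have "\<not> type2 D I len v" "\<not> type3 D I v" "\<not> type4 D I len v"
      unfolding type2_def type3_def type4_def assms(2,3) by auto
    then show ?thesis using that assms(1) unfolding node_type_def enat_numerals by auto
  qed
qed

text \<open>The new length rests on a definite description, so every type has to be decided; the
  neighbour \<open>w\<close> in \<open>I\<close> rules out Type 1.\<close>

lemma new_length_not_type1:
  assumes inf: "\<not> type_inf D I v" and w: "w \<in> I" "joined D v w" and m: "m \<in> {2, 3, 4}"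
    and t2: "type2 D I len v \<longleftrightarrow> m = 2" and t3: "type3 D I v \<longleftrightarrow> m = 3"
    and t4: "type4 D I len v \<longleftrightarrow> m = 4"
  shows "new_length D I len v = len v / sqrt (real m)"
proof (rule new_length_eqI)
  have t1: "\<not> type1 D I v" using w by (auto simp: type1_def)
  show "node_type D I len v (enat m)"
    using assms unfolding node_type_def by (auto simp: enat_numerals)
  show "s = enat m" if "node_type D I len v s" for s
    using that inf t1 t2 t3 t4 unfolding node_type_def by (auto simp: enat_numerals)
qed

lemma diagram_iso_single_node:
  assumes "nodes D - I = {v}"
  shows "diagram_iso (new_diagram D I len) (extended_coroot_diagram {0 :: 'a::euclidean_space})"
  unfolding diagram_iso_def
proof (intro exI[of _ "\<lambda>_. 0"] conjI)
  show "bij_betw (\<lambda>_. 0) (nodes (new_diagram D I len)) (nodes (extended_coroot_diagram {0 :: 'a}))"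
    using assms by (simp add: new_diagram_def extended_coroot_diagram_def Let_def bij_betw_def)
  show "\<forall>u\<in>nodes (new_diagram D I len). \<forall>v\<in>nodes (new_diagram D I len).
      bond (new_diagram D I len) u v = bond (extended_coroot_diagram {0 :: 'a}) 0 0 \<and>
      arrow (new_diagram D I len) u v = arrow (extended_coroot_diagram {0 :: 'a}) 0 0"
    using assms by (auto simp: new_diagram_def extended_coroot_diagram_def Let_def new_joined_def)
qed

lemma extended_simple_roots_zero: "extended_simple_roots {} {} {0}"
  by (simp add: extended_simple_roots_def)

text \<open>Multiplicities and arrows depend only on ratios of lengths and on non-orthogonality, so
  vectors with these data realise the diagram. What needs an argument is the bond of affine type
  \<open>A\<^sub>1\<close>: an isolated pair of equal new lengths corresponds to a pair of opposite
  vectors.\<close>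

lemma diagram_iso_new_diagram:
  fixes x :: "'b \<Rightarrow> 'a::euclidean_space"
  assumes inj: "inj_on x (nodes D - I)" and aff: "affine_coroots (x ` (nodes D - I)) H B"
    and c: "0 < c" and len: "\<And>v. v \<in> nodes D - I \<Longrightarrow> new_length D I len v = c * norm (x v)"
    and joined: "\<And>u v. u \<in> nodes D - I \<Longrightarrow> v \<in> nodes D - I \<Longrightarrow>
      new_joined D I u v \<longleftrightarrow> u \<noteq> v \<and> x u \<bullet> x v \<noteq> 0"
  shows "diagram_iso (new_diagram D I len) (extended_coroot_diagram (coroot ` x ` (nodes D - I)))"
proof -
  let ?R = "nodes D - I" and ?J = "new_joined D I" and ?l = "new_length D I len"
  let ?D = "new_diagram D I len" and ?D' = "extended_coroot_diagram (coroot ` x ` ?R)"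
  interpret affine_coroots "x ` ?R" H B by (rule aff)
  have xx: "x u = x v \<longleftrightarrow> u = v" if "u \<in> ?R" "v \<in> ?R" for u v using inj_on_eq_iff[OF inj] that .
  have JR: "u \<in> ?R \<and> v \<in> ?R" if "?J u v" for u v using that by (simp add: new_joined_def)
  have nonzero: "x u \<noteq> 0" if "u \<in> ?R" for u using zero_notin_V that by force
  have two: "(\<forall>w. ?J u w \<longrightarrow> w = v) \<and> (\<forall>w. ?J v w \<longrightarrow> w = u) \<and> ?l u = ?l v \<longleftrightarrow> x v = - x u"
    if u: "u \<in> ?R" and v: "v \<in> ?R" and uv: "?J u v" for u v
  proof
    assume L: "(\<forall>w. ?J u w \<longrightarrow> w = v) \<and> (\<forall>w. ?J v w \<longrightarrow> w = u) \<and> ?l u = ?l v"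
    have ne: "x u \<noteq> x v" using uv xx[OF u v] joined[OF u v] by simp
    \<comment> \<open>By connectedness an isolated pair is everything. The relation then has two
      terms, and equal norms force equal coefficients.\<close>
    have eq: "{x u, x v} = x ` ?R"
    proof (rule connected_V)
      fix a b assume a: "a \<in> {x u, x v}" and b: "b \<in> x ` ?R" and ba: "0 < B b a"
      obtain w where w: "w \<in> ?R" "b = x w" using b by auto
      have "b \<noteq> a" using A_pos_neq[OF ba] .
      then have "a \<bullet> b \<noteq> 0" using A_eq_0_iff[of b a] a b ba u v by (auto simp: inner_commute)
      then show "b \<in> {x u, x v}"
        using a w L joined[OF u w(1)] joined[OF v w(1)] \<open>b \<noteq> a\<close> by auto
    qed (use u v in auto)
    then have s: "real (H (x u)) *\<^sub>R x u + real (H (x v)) *\<^sub>R x v = 0"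
      using G_sum ne unfolding eq[symmetric] by simp
    then have "real (H (x u)) *\<^sub>R x u = - (real (H (x v)) *\<^sub>R x v)" by (simp add: eq_neg_iff_add_eq_0)
    then have "norm (real (H (x u)) *\<^sub>R x u) = norm (real (H (x v)) *\<^sub>R x v)" by (metis norm_minus_cancel)
    moreover have "norm (x u) = norm (x v)" using L len u v c by simp
    ultimately have "H (x u) = H (x v)" using nonzero[OF v] by simp
    then have "real (H (x u)) *\<^sub>R (x u + x v) = 0" using s by (simp add: scaleR_add_right)
    then show "x v = - x u" using G_pos[of "x u"] u by (auto simp: add_eq_0_iff)
  next
    assume R: "x v = - x u"
    \<comment> \<open>A third vector has nonpositive inner product with \<open>x u\<close> and with
      its negative, so it is orthogonal to both.\<close>
    have "w = v" if "?J u w" for w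
    proof (rule ccontr)
      assume wv: "w \<noteq> v"
      have w: "w \<in> ?R" "w \<noteq> u" "x u \<bullet> x w \<noteq> 0" using that JR[OF that] joined[OF u, of w] by auto
      have "x u \<bullet> x w \<le> 0" "x v \<bullet> x w \<le> 0"
        using inner_nonpos[of "x u" "x w"] inner_nonpos[of "x v" "x w"] xx u v w wv by auto
      then show False using w R by simp
    qed
    moreover have "w = u" if "?J v w" for w
    proof (rule ccontr)
      assume wu: "w \<noteq> u"
      have w: "w \<in> ?R" "w \<noteq> v" "x v \<bullet> x w \<noteq> 0" using that JR[OF that] joined[OF v, of w] by auto
      have "x u \<bullet> x w \<le> 0" "x v \<bullet> x w \<le> 0"
        using inner_nonpos[of "x u" "x w"] inner_nonpos[of "x v" "x w"] xx u v w wu by auto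
      then show False using w R by simp
    qed
    ultimately show "(\<forall>w. ?J u w \<longrightarrow> w = v) \<and> (\<forall>w. ?J v w \<longrightarrow> w = u) \<and> ?l u = ?l v"
      using len[OF u] len[OF v] R by simp
  qed
  show ?thesis
    unfolding diagram_iso_def
  proof (intro exI[of _ x] conjI ballI)
    show "bij_betw x (nodes ?D) (nodes ?D')"
      using inj by (simp add: new_diagram_def extended_coroot_diagram_def Let_def bij_betw_def image_image)
  next
    fix u v assume "u \<in> nodes ?D" "v \<in> nodes ?D"
    then have u: "u \<in> ?R" and v: "v \<in> ?R" by (simp_all add: new_diagram_def Let_def)
    have le: "?l v \<le> ?l u \<longleftrightarrow> norm (x v) \<le> norm (x u)" if "u \<in> ?R" "v \<in> ?R" for u v
      using len that c by simp
    have ratio: "(?l u)\<^sup>2 / (?l v)\<^sup>2 = (norm (x u))\<^sup>2 / (norm (x v))\<^sup>2" if "u \<in> ?R" "v \<in> ?R" for u v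
      using len that c by (simp add: power_mult_distrib)
    show "arrow ?D u v = arrow ?D' (x u) (x v)"
      using joined[OF u v] xx[OF u v] le[OF v u]
      by (auto simp: new_diagram_def extended_coroot_diagram_def Let_def not_le[symmetric])
    show "bond ?D u v = bond ?D' (x u) (x v)"
    proof (cases "?J u v")
      case False
      then show ?thesis using joined[OF u v] xx[OF u v]
        by (auto simp: new_diagram_def extended_coroot_diagram_def Let_def)
    next
      case True
      then have "\<not> (x u = x v \<or> x u \<bullet> x v = 0)" using joined[OF u v] xx[OF u v] by auto
      then show ?thesis using True two[OF u v True] le[OF u v] ratio[OF u v] ratio[OF v u]
        by (simp add: new_diagram_def extended_coroot_diagram_def Let_def)
    qed
  qed
qed

section \<open>Length functions as multiples of the norm\<close>

locale coroot_diagram = extended_coroots +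
  fixes E :: "'a set" and len :: "'a \<Rightarrow> real"
  assumes V_def: "V = coroot ` E" and len: "length_function (extended_coroot_diagram E) len"
begin

abbreviation "D \<equiv> extended_coroot_diagram E"

lemma nodes_D: "nodes D = V" by (simp add: extended_coroot_diagram_def V_def)

lemma joined_iff: "joined D u v \<longleftrightarrow> u \<in> V \<and> v \<in> V \<and> 0 < A u v"
proof (cases "u \<in> V \<and> v \<in> V \<and> u \<noteq> v")
  case True
  then have "joined D u v \<longleftrightarrow> u \<bullet> v \<noteq> 0" 
    unfolding joined_def nodes_D by (auto simp: extended_coroot_diagram_def)
  then show ?thesis using True A_eq_0_iff[of u v] by auto
next
  case False
  then show ?thesis using A_refl by (auto simp: joined_def nodes_D)
qed

lemma joined_sym: "joined D u v \<Longrightarrow> joined D v u"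
  using A_pos_sym by (auto simp: joined_iff)

lemma symp_joined: "symp (joined D)"
  using joined_sym by (rule sympI)

lemma bond_refl: "bond D v v = No_Bond" "\<not> arrow D v v"
  by (simp_all add: extended_coroot_diagram_def)

lemma len_pos: "v \<in> V \<Longrightarrow> 0 < len v"
  using len by (simp add: length_function_def nodes_D)

lemma len_joined_aux:
  assumes j: "joined D u v" and le: "len v \<le> len u"
  shows "len u * norm v = len v * norm u"
proof -
  have uv: "u \<in> V" "v \<in> V" "u \<noteq> v" "u \<bullet> v \<noteq> 0"
    using j A_eq_0_iff[of u v] A_pos_neq by (auto simp: joined_iff)
  have *: "if bond D u v = Two_Single_Bonds then len u = len v
      else bond D u v = Bond ((len u)\<^sup>2 / (len v)\<^sup>2) \<and> \<not> arrow D v u"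
    using len j le unfolding length_function_def by blast
  have l: "0 < len u" "0 < len v" using len_pos uv by auto
  have n: "0 < norm u" "0 < norm v" using uv zero_notin_V by auto
  show ?thesis
  proof (cases "v = - u")
    case True
    then have "bond D u v = Two_Single_Bonds" using uv by (simp add: extended_coroot_diagram_def)
    then show ?thesis using * True by simp
  next
    case False
    then have "bond D u v \<noteq> Two_Single_Bonds" using uv by (simp add: extended_coroot_diagram_def)
    then have b: "bond D u v = Bond ((len u)\<^sup>2 / (len v)\<^sup>2)" and a: "\<not> arrow D v u" using * by auto
    have "norm v \<le> norm u" using a uv by (auto simp: extended_coroot_diagram_def inner_commute)
    then have "bond D u v = Bond ((norm u)\<^sup>2 / (norm v)\<^sup>2)" using uv False by (simp add: extended_coroot_diagram_def)
    then have "(norm u)\<^sup>2 / (norm v)\<^sup>2 = (len u)\<^sup>2 / (len v)\<^sup>2" using b by simp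
    then have "(len u * norm v)\<^sup>2 = (len v * norm u)\<^sup>2" using l n by (simp add: power_mult_distrib field_simps)
    then show ?thesis using l n by (simp add: power2_eq_iff_nonneg)
  qed
qed

lemma len_joined: "joined D u v \<Longrightarrow> len u * norm v = len v * norm u"
  using len_joined_aux[of u v] len_joined_aux[of v u] joined_sym[of u v] by (cases "len v \<le> len u") auto

text \<open>A length function is constrained only along bonds, where its ratios are those of the
  norms; connectedness makes the factor global. The length comparisons in the node types become
  comparisons of norms.\<close>

lemma len_eq: "v \<in> V \<Longrightarrow> len v = len v0 / norm v0 * norm v"
proof -
  have n0: "norm v0 > 0" using v0_in zero_notin_V by auto
  have "{v \<in> V. len v * norm v0 = len v0 * norm v} = V"
  proof (rule connected_V)
    fix u v assume u: "u \<in> {v \<in> V. len v * norm v0 = len v0 * norm v}" and v: "v \<in> V" "0 < A v u"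
    have "len v * norm u = len u * norm v" using len_joined[of v u] joined_iff u v by auto
    moreover have "len u * norm v0 = len v0 * norm u" using u by auto
    ultimately have "(len v * norm v0) * norm u = (len v0 * norm v) * norm u"
      by (metis mult.assoc mult.commute)
    moreover have "norm u \<noteq> 0" using u zero_notin_V by auto
    ultimately show "v \<in> {v \<in> V. len v * norm v0 = len v0 * norm v}" using v by simp
  qed (use v0_in in auto)
  moreover assume "v \<in> V"
  ultimately have "len v * norm v0 = len v0 * norm v" by blast
  then show ?thesis using n0 by (simp add: field_simps)
qed

lemma scale_pos: "0 < len v0 / norm v0"
  using len_pos[OF v0_in] v0_in zero_notin_V by (intro divide_pos_pos) auto

lemma len_le_iff: "u \<in> V \<Longrightarrow> v \<in> V \<Longrightarrow> len u \<le> len v \<longleftrightarrow> u \<bullet> u \<le> v \<bullet> v"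
  unfolding len_eq[of u] len_eq[of v] norm_le[symmetric] using scale_pos by (simp only: mult_le_cancel_left_pos)

text \<open>Every node is of Type 1 and keeps its length, so the nodes realise the diagram
  themselves. A single node would be of Type \<infinity>, with new length 0.\<close>

lemma diagram_iso_no_nodes_removed:
  assumes "\<And>v. V \<noteq> {v}"
  shows "diagram_iso (new_diagram D {} len) D"
proof -
  have adj: "adjacent_components D {} v = {}" for v
    using adjacent_components_eq[OF symp_joined, of "{}" v] by simp
  have "diagram_iso (new_diagram D {} len) (extended_coroot_diagram (coroot ` (\<lambda>v. v) ` (nodes D - {})))"
  proof (rule diagram_iso_new_diagram)
    show "affine_coroots ((\<lambda>v. v) ` (nodes D - {})) G A"
      using affine_coroots_axioms nodes_D by simp
    show "0 < len v0 / norm v0" by (rule scale_pos)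
    show "new_length D {} len v = len v0 / norm v0 * norm v" if "v \<in> nodes D - {}" for v
      using new_length_type1[of D "{}" v len] adj assms that len_eq[of v] nodes_D by (simp add: type_inf_def)
    show "new_joined D {} u v \<longleftrightarrow> u \<noteq> v \<and> u \<bullet> v \<noteq> 0" if "u \<in> nodes D - {}" "v \<in> nodes D - {}" for u v
      using that adj nodes_D A_eq_0_iff[of u v] A_refl by (auto simp: new_joined_def joined_iff)
  qed simp
  moreover have "coroot ` (\<lambda>v. v) ` (nodes D - {}) = E" by (simp add: nodes_D V_def image_image)
  ultimately show ?thesis by simp
qed

end

section \<open>Projected diagrams\<close>

text \<open>Common frame for \<open>k = 2\<close> and \<open>k = 3\<close>: the coefficients
  \<open>\<beta>\<close> describe the orthogonal projection away from \<open>I\<close>, and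
  \<open>r\<close> is the type. Squared lengths of projections are proportional to
  \<open>\<rho> v / r v\<close>; the last two conditions on \<open>v1\<close> are
  \<open>x0_shortest\<close> and \<open>root_integers\<close> with denominators cleared.\<close>

locale projected_diagram = coroot_diagram +
  fixes k :: nat and I :: "'a set" and \<beta> :: "'a \<Rightarrow> 'a \<Rightarrow> real" and r :: "'a \<Rightarrow> nat" and v1 :: 'a
  assumes I: "I \<subseteq> V" and not_single: "\<And>v. V - I \<noteq> {v}" and k_pos: "0 < k"
    and k_dvd: "\<And>v. v \<in> V - I \<Longrightarrow> k dvd G v"
    and \<beta>_nonneg: "\<And>v w. 0 \<le> \<beta> v w"
    and orth: "\<And>v w. v \<in> V - I \<Longrightarrow> w \<in> I \<Longrightarrow> (v + (\<Sum>u\<in>I. \<beta> v u *\<^sub>R u)) \<bullet> w = 0"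
    and \<beta>_pos_iff: "\<And>v w. v \<in> V - I \<Longrightarrow> w \<in> I \<Longrightarrow>
      0 < \<beta> v w \<longleftrightarrow> (\<exists>w'\<in>I. 0 < A w' v \<and> w \<in> component D I w')"
    and r_pos: "\<And>v. v \<in> V - I \<Longrightarrow> 0 < r v"
    and norm_proj: "\<And>v. v \<in> V - I \<Longrightarrow> v \<bullet> (v + (\<Sum>u\<in>I. \<beta> v u *\<^sub>R u)) = (v \<bullet> v) / real (r v)"
    and new_len: "\<And>v. v \<in> V - I \<Longrightarrow> new_length D I len v = len v / sqrt (real (r v))"
    and integral: "\<And>u v. u \<in> V - I \<Longrightarrow> v \<in> V - I \<Longrightarrow> u \<noteq> v \<Longrightarrow>
      \<exists>m::nat. 2 * real (r v) * (u \<bullet> (v + (\<Sum>w\<in>I. \<beta> v w *\<^sub>R w))) = - real m * (v \<bullet> v)"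
    and v1: "v1 \<in> V - I" "G v1 = k"
    and v1_shortest: "\<And>v. v \<in> V - I \<Longrightarrow> \<rho> v1 * r v \<le> \<rho> v * r v1"
    and v1_integers: "\<And>v. v \<in> V - I \<Longrightarrow> (k * \<rho> v1 * r v) dvd (G v * \<rho> v * r v1)"
begin

definition proj :: "'a \<Rightarrow> 'a" where
  "proj v = v + (\<Sum>u\<in>I. \<beta> v u *\<^sub>R u)"

definition H :: "'a \<Rightarrow> nat" where "H v = G v div k"

abbreviation "R \<equiv> V - I"

lemma finite_I: "finite I" using I finite_V finite_subset by blast

lemma G_H: "v \<in> R \<Longrightarrow> G v = k * H v"
  using k_dvd by (simp add: H_def)

lemma H_pos: "v \<in> R \<Longrightarrow> 0 < H v"
  using G_H[of v] G_pos[of v] by (cases "H v") auto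

lemma proj_orth: "v \<in> R \<Longrightarrow> w \<in> I \<Longrightarrow> proj v \<bullet> w = 0"
  using orth by (simp add: proj_def)

lemma proj_inner: "v \<in> R \<Longrightarrow> proj u \<bullet> proj v = u \<bullet> proj v"
  unfolding proj_def[of u] inner_add_left inner_sum_left
  by (simp add: proj_orth inner_commute[of _ "proj v"])

lemma inner_proj: "u \<bullet> proj v = u \<bullet> v + (\<Sum>w\<in>I. \<beta> v w * (u \<bullet> w))"
  by (simp add: proj_def inner_add_right inner_sum_right)

lemma norm_proj': "v \<in> R \<Longrightarrow> proj v \<bullet> proj v = (v \<bullet> v) / real (r v)"
  using norm_proj proj_inner by (simp add: proj_def)

lemma norm_proj_\<rho>: "v \<in> R \<Longrightarrow> proj v \<bullet> proj v = real (\<rho> v) / real (r v) * (v0 \<bullet> v0)"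
  using norm_proj'[of v] \<rho>[of v] by simp

lemma inner_proj_nonpos: "u \<in> R \<Longrightarrow> v \<in> R \<Longrightarrow> u \<noteq> v \<Longrightarrow> u \<bullet> proj v \<le> 0"
  unfolding inner_proj using I
  by (intro add_nonpos_nonpos sum_nonpos mult_nonneg_nonpos inner_nonpos \<beta>_nonneg) auto

text \<open>Distinct nodes have nonpositive inner products and \<open>\<beta>\<close> is
  nonnegative, so terms cannot cancel.\<close>

lemma inner_proj_eq_0_iff:
  assumes "u \<in> R" "v \<in> R" "u \<noteq> v"
  shows "u \<bullet> proj v = 0 \<longleftrightarrow> A u v = 0 \<and> (\<forall>w\<in>I. \<beta> v w = 0 \<or> A u w = 0)"
proof -
  have s: "\<beta> v w * (u \<bullet> w) \<le> 0" if "w \<in> I" for w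
    using that assms I by (intro mult_nonneg_nonpos \<beta>_nonneg inner_nonpos) auto
  have "u \<bullet> v \<le> 0" using inner_nonpos assms by auto
  then have "u \<bullet> proj v = 0 \<longleftrightarrow> u \<bullet> v = 0 \<and> (\<Sum>w\<in>I. \<beta> v w * (u \<bullet> w)) = 0"
    using sum_nonpos[of I "\<lambda>w. \<beta> v w * (u \<bullet> w)"] s unfolding inner_proj by fastforce
  also have "(\<Sum>w\<in>I. \<beta> v w * (u \<bullet> w)) = 0 \<longleftrightarrow> (\<forall>w\<in>I. \<beta> v w * (u \<bullet> w) = 0)"
    using sum_nonneg_eq_0_iff[OF finite_I, of "\<lambda>w. - (\<beta> v w * (u \<bullet> w))"] s by (simp add: sum_negf)
  also have "\<dots> \<longleftrightarrow> (\<forall>w\<in>I. \<beta> v w = 0 \<or> A u w = 0)"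
  proof (intro ball_cong refl)
    fix w assume "w \<in> I"
    then have "w \<in> V" "u \<noteq> w" using assms I by auto
    then show "\<beta> v w * (u \<bullet> w) = 0 \<longleftrightarrow> \<beta> v w = 0 \<or> A u w = 0"
      using A_eq_0_iff[of u w] assms by auto
  qed
  finally show ?thesis using A_eq_0_iff[of u v] assms by auto
qed

lemma comb_proj:
  "(\<Sum>v\<in>R. c v *\<^sub>R proj v) = (\<Sum>v\<in>R. c v *\<^sub>R v) + (\<Sum>w\<in>I. (\<Sum>v\<in>R. c v * \<beta> v w) *\<^sub>R w)"
proof -
  have "(\<Sum>v\<in>R. c v *\<^sub>R proj v) = (\<Sum>v\<in>R. c v *\<^sub>R v) + (\<Sum>v\<in>R. \<Sum>w\<in>I. (c v * \<beta> v w) *\<^sub>R w)"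
    by (simp add: proj_def scaleR_add_right sum.distrib scaleR_sum_right)
  also have "(\<Sum>v\<in>R. \<Sum>w\<in>I. (c v * \<beta> v w) *\<^sub>R w) = (\<Sum>w\<in>I. (\<Sum>v\<in>R. c v * \<beta> v w) *\<^sub>R w)"
    by (subst sum.swap) (simp add: scaleR_sum_left)
  finally show ?thesis .
qed

lemma sum_split: "(\<Sum>v\<in>V. f v) = (\<Sum>v\<in>R. f v) + (\<Sum>w\<in>I. f w)" for f :: "'a \<Rightarrow> 'a"
  using sum.subset_diff[OF I finite_V, of f] by simp

text \<open>Expanding the projections gives a relation among all nodes with unchanged coefficients
  on \<open>R\<close>; these are proportional to \<open>G\<close>, hence to
  \<open>H\<close>.\<close>

lemma proj_rigid:
  assumes "(\<Sum>v\<in>R. c v *\<^sub>R proj v) = 0"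
  obtains t where "\<And>v. v \<in> R \<Longrightarrow> c v = t * real (H v)"
proof -
  let ?d = "\<lambda>v. if v \<in> I then \<Sum>u\<in>R. c u * \<beta> u v else c v"
  have "(\<Sum>v\<in>V. ?d v *\<^sub>R v) = (\<Sum>v\<in>R. ?d v *\<^sub>R v) + (\<Sum>v\<in>I. ?d v *\<^sub>R v)" by (rule sum_split)
  also have "\<dots> = (\<Sum>v\<in>R. c v *\<^sub>R proj v)" unfolding comb_proj by simp
  finally obtain t where t: "\<And>v. v \<in> V \<Longrightarrow> ?d v = t * real (G v)" using rigid[of ?d] assms by auto
  have "c v = (t * real k) * real (H v)" if "v \<in> R" for v
    using t[of v] G_H[OF that] that by simp
  then show thesis by (rule that)
qed

text \<open>By \<open>G_sum\<close> the combination lies in the span of \<open>I\<close>, while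
  every projection is orthogonal to \<open>I\<close>; so it is orthogonal to itself.\<close>

lemma proj_sum: "(\<Sum>v\<in>R. real (H v) *\<^sub>R proj v) = 0"
proof -
  let ?y = "\<Sum>v\<in>R. real (G v) *\<^sub>R proj v"
  let ?d = "\<lambda>w. (\<Sum>v\<in>R. real (G v) * \<beta> v w) - real (G w)"
  have y: "?y = (\<Sum>w\<in>I. ?d w *\<^sub>R w)"
    using G_sum unfolding sum_split comb_proj by (simp add: scaleR_left_diff_distrib sum_subtractf eq_neg_iff_add_eq_0 algebra_simps)
  have "?y \<bullet> w = 0" if "w \<in> I" for w
    using that by (simp add: inner_sum_left proj_orth)
  then have "?y \<bullet> ?y = 0"
    by (subst (2) y) (simp add: inner_sum_right)
  then have "?y = 0" by simp
  moreover have "?y = real k *\<^sub>R (\<Sum>v\<in>R. real (H v) *\<^sub>R proj v)"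
    unfolding scaleR_sum_right by (intro sum.cong refl) (simp add: G_H)
  ultimately show ?thesis using k_pos by simp
qed

lemma proj_nonzero: "v \<in> R \<Longrightarrow> proj v \<noteq> 0"
proof
  assume v: "v \<in> R" and "proj v = 0"
  then have "v \<bullet> v / real (r v) = 0" using norm_proj'[OF v] by simp
  then show False using inner_pos[of v] r_pos[OF v] v by auto
qed

lemma inj_proj: "inj_on proj R"
proof
  fix u v assume uv: "u \<in> R" "v \<in> R" "proj u = proj v"
  show "u = v"
  proof (rule ccontr)
    assume "u \<noteq> v"
    then have "proj v \<bullet> proj v \<le> 0" using inner_proj_nonpos[OF uv(1,2)] proj_inner[OF uv(2), of u] uv(3) by simp
    then show False using proj_nonzero[OF uv(2)] by (metis inner_gt_zero_iff not_less)
  qed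
qed

text \<open>On \<open>I\<close>, the coefficients \<open>\<beta> v w\<close> are positive exactly on
  the components adjacent to \<open>v\<close>. A removed node thus contributes to
  \<open>u \<bullet> proj v\<close> exactly if \<open>u\<close> is joined to it and it lies in such
  a component.\<close>

lemma new_joined_iff:
  assumes u: "u \<in> R" and v: "v \<in> R"
  shows "new_joined D I u v \<longleftrightarrow> u \<noteq> v \<and> proj u \<bullet> proj v \<noteq> 0"
proof (cases "u = v")
  case False
  have ID: "I \<subseteq> nodes D" using I nodes_D by simp
  note adj = adjacent_components_eq[OF symp_joined ID]
  have "adjacent_components D I u \<inter> adjacent_components D I v \<noteq> {} \<longleftrightarrow> (\<exists>w\<in>I. \<beta> v w \<noteq> 0 \<and> A u w \<noteq> 0)"
  proof
    assume "adjacent_components D I u \<inter> adjacent_components D I v \<noteq> {}"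
    then obtain C where "C \<in> adjacent_components D I u \<inter> adjacent_components D I v"
      unfolding ex_in_conv[symmetric] by (elim exE)
    then have C: "C \<in> component D I ` {w \<in> I. joined D u w}" "C \<in> component D I ` {w \<in> I. joined D v w}"
      unfolding adj by simp_all
    from C(1) obtain w where w1: "w \<in> {w \<in> I. joined D u w}" "C = component D I w" by (elim imageE)
    from C(2) obtain w' where w2: "w' \<in> {w \<in> I. joined D v w}" "C = component D I w'" by (elim imageE)
    have w: "w \<in> I" "joined D u w" "w' \<in> I" "joined D v w'" using w1(1) w2(1) by auto
    have "w \<in> component D I w'" using component_self[of w D I] w1(2) w2(2) by simp
    moreover have "0 < A w' v" using w(4) A_pos_sym joined_iff by auto
    ultimately have "0 < \<beta> v w" using \<beta>_pos_iff[OF v w(1)] w(3) by (metis (no_types))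
    then show "\<exists>w\<in>I. \<beta> v w \<noteq> 0 \<and> A u w \<noteq> 0"
      using w by (intro bexI[of _ w]) (auto simp: joined_iff)
  next
    assume "\<exists>w\<in>I. \<beta> v w \<noteq> 0 \<and> A u w \<noteq> 0"
    then obtain w where w: "w \<in> I" "\<beta> v w \<noteq> 0" "A u w \<noteq> 0" by auto
    then have "0 < \<beta> v w" using \<beta>_nonneg[of v w] by simp
    then obtain w' where w': "w' \<in> I" "0 < A w' v" "w \<in> component D I w'" using \<beta>_pos_iff[OF v w(1)] by auto
    have "component D I w = component D I w'" using component_eq[OF symp_joined w'(3)] .
    moreover have "joined D u w" "joined D v w'"
      using w w' u v I A_pos_sym[of w' v] by (auto simp: joined_iff)
    ultimately have "component D I w \<in> component D I ` {w \<in> I. joined D u w}"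
      "component D I w \<in> component D I ` {w \<in> I. joined D v w}"
      using w(1) w'(1) by (intro image_eqI[of _ _ w] image_eqI[of _ _ w']; simp)+
    then have "component D I w \<in> adjacent_components D I u" "component D I w \<in> adjacent_components D I v"
      unfolding adj .
    then have "component D I w \<in> adjacent_components D I u \<inter> adjacent_components D I v" by (rule IntI)
    then show "adjacent_components D I u \<inter> adjacent_components D I v \<noteq> {}" by (metis empty_iff)
  qed
  then show ?thesis
    using False u v inner_proj_eq_0_iff[OF u v False] unfolding proj_inner[OF v] new_joined_def nodes_D joined_iff
    by auto
qed (simp add: new_joined_def)

lemma special_node_proj:
  obtains B where "special_node (proj ` R) (H \<circ> the_inv_into R proj) B (proj v1)"
proof -
  let ?H = "H \<circ> the_inv_into R proj"
  have H: "?H (proj v) = H v" if "v \<in> R" for v using the_inv_into_f_f[OF inj_proj that] by simp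
  have sum: "(\<Sum>x\<in>proj ` R. f x *\<^sub>R x) = (\<Sum>v\<in>R. f (proj v) *\<^sub>R proj v)" for f
    by (subst sum.reindex[OF inj_proj]) simp
  have "\<forall>u\<in>R. \<forall>v\<in>R. \<exists>m::nat. u \<noteq> v \<longrightarrow> 2 * (proj u \<bullet> proj v) = - real m * (proj v \<bullet> proj v)"
  proof (intro ballI)
    fix u v assume u: "u \<in> R" and v: "v \<in> R"
    show "\<exists>m::nat. u \<noteq> v \<longrightarrow> 2 * (proj u \<bullet> proj v) = - real m * (proj v \<bullet> proj v)"
    proof (cases "u = v")
      case False
      then obtain m :: nat where "2 * real (r v) * (u \<bullet> proj v) = - real m * (v \<bullet> v)"
        using integral[OF u v] by (auto simp: proj_def)
      then have "2 * (u \<bullet> proj v) = - real m * ((v \<bullet> v) / real (r v))"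
        using r_pos[OF v] by (simp add: field_simps)
      then have "2 * (proj u \<bullet> proj v) = - real m * (proj v \<bullet> proj v)"
        unfolding norm_proj'[OF v] unfolding proj_inner[OF v] .
      then show ?thesis by blast
    qed simp
  qed
  then obtain m :: "'a \<Rightarrow> 'a \<Rightarrow> nat" where m: "\<And>u v. u \<in> R \<Longrightarrow> v \<in> R \<Longrightarrow> u \<noteq> v \<Longrightarrow>
      2 * (proj u \<bullet> proj v) = - real (m u v) * (proj v \<bullet> proj v)" by metis
  define B where "B x y = (if x = y then 0 else m (the_inv_into R proj x) (the_inv_into R proj y))" for x y
  show thesis
  proof (rule that[of B], unfold_locales)
    show "finite (proj ` R)" using finite_V by simp
    show "0 \<notin> proj ` R" using proj_nonzero by fastforce
    show "0 < ?H x" if "x \<in> proj ` R" for x using that H H_pos by auto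
    show "(\<Sum>x\<in>proj ` R. real (?H x) *\<^sub>R x) = 0"
    proof -
      have "(\<Sum>v\<in>R. real (?H (proj v)) *\<^sub>R proj v) = (\<Sum>v\<in>R. real (H v) *\<^sub>R proj v)"
        by (intro sum.cong refl) (simp only: H)
      then show ?thesis unfolding sum using proj_sum by simp
    qed
    show "\<exists>t. \<forall>x\<in>proj ` R. c x = t * real (?H x)" if "(\<Sum>x\<in>proj ` R. c x *\<^sub>R x) = 0" for c
    proof -
      obtain t where "\<And>v. v \<in> R \<Longrightarrow> c (proj v) = t * real (H v)"
        using proj_rigid[of "\<lambda>v. c (proj v)"] \<open>(\<Sum>x\<in>proj ` R. c x *\<^sub>R x) = 0\<close>[unfolded sum] by blast
      then show ?thesis using H by auto
    qed
    show "2 * (x \<bullet> y) = - real (B x y) * (y \<bullet> y)" if xy: "x \<in> proj ` R" "y \<in> proj ` R" "x \<noteq> y" for x y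
    proof -
      obtain u v where "u \<in> R" "v \<in> R" "x = proj u" "y = proj v" using xy by auto
      then show ?thesis using m[of u v] xy(3) the_inv_into_f_f[OF inj_proj] by (auto simp: B_def)
    qed
    show "B x x = 0" for x by (simp add: B_def)
    show "proj v1 \<in> proj ` R" using v1 by simp
    show "?H (proj v1) = 1" using H[OF v1(1)] v1 k_pos by (simp add: H_def)
    show "proj v1 \<bullet> proj v1 \<le> x \<bullet> x" if x: "x \<in> proj ` R" for x
    proof -
      obtain v where v: "v \<in> R" "x = proj v" using x by auto
      have "real (\<rho> v1 * r v) \<le> real (\<rho> v * r v1)" using v1_shortest[OF v(1)] by (simp only: of_nat_le_iff)
      then have "real (\<rho> v1) / real (r v1) \<le> real (\<rho> v) / real (r v)"
        using r_pos[OF v1(1)] r_pos[OF v(1)] by (simp add: field_simps)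
      then show ?thesis unfolding v(2) norm_proj_\<rho>[OF v1(1)] norm_proj_\<rho>[OF v(1)]
        by (rule mult_right_mono) simp
    qed
    show "\<exists>m. real (?H x) * (x \<bullet> x) = real m * (proj v1 \<bullet> proj v1)" if x: "x \<in> proj ` R" for x
    proof -
      obtain v where v: "v \<in> R" "x = proj v" using x by auto
      obtain m where "G v * \<rho> v * r v1 = (k * \<rho> v1 * r v) * m" using v1_integers[OF v(1)] by (elim dvdE)
      then have "k * (H v * \<rho> v * r v1) = k * (m * \<rho> v1 * r v)" using G_H[OF v(1)] by (simp add: mult_ac)
      then have "H v * \<rho> v * r v1 = m * \<rho> v1 * r v" using k_pos by simp
      then have "real (H v) * real (\<rho> v) * real (r v1) = real m * real (\<rho> v1) * real (r v)"
        by (metis of_nat_mult)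
      then have "real (H v) * (real (\<rho> v) / real (r v)) = real m * (real (\<rho> v1) / real (r v1))"
        using r_pos[OF v1(1)] r_pos[OF v(1)] by (simp add: field_simps)
      then have "real (H v) * (proj v \<bullet> proj v) = real m * (proj v1 \<bullet> proj v1)"
        unfolding norm_proj_\<rho>[OF v1(1)] norm_proj_\<rho>[OF v(1)] by (metis mult.assoc)
      then show ?thesis using H[OF v(1)] v(2) by auto
    qed
  qed
qed

theorem is_extended_coroot_diagram:
  "\<exists>\<Psi> \<Delta>' E' :: 'a set. extended_simple_roots \<Psi> \<Delta>' E' \<and>
    diagram_iso (new_diagram D I len) (extended_coroot_diagram E')"
proof -
  obtain B where B: "special_node (proj ` R) (H \<circ> the_inv_into R proj) B (proj v1)"
    by (rule special_node_proj)
  interpret P: special_node "proj ` R" "H \<circ> the_inv_into R proj" B "proj v1" by (rule B)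
  have "diagram_iso (new_diagram D I len) (extended_coroot_diagram (coroot ` proj ` (nodes D - I)))"
  proof (rule diagram_iso_new_diagram)
    show "inj_on proj (nodes D - I)" using inj_proj nodes_D by simp
    show "affine_coroots (proj ` (nodes D - I)) (H \<circ> the_inv_into R proj) B"
      using P.affine_coroots_axioms nodes_D by simp
    show "0 < len v0 / norm v0" by (rule scale_pos)
    show "new_length D I len v = len v0 / norm v0 * norm (proj v)" if "v \<in> nodes D - I" for v
    proof -
      have v: "v \<in> R" using that nodes_D by simp
      have "norm (proj v) = norm v / sqrt (real (r v))"
        unfolding norm_eq_sqrt_inner norm_proj'[OF v] by (simp add: real_sqrt_divide)
      then show ?thesis using new_len[OF v] len_eq[of v] v by simp
    qed
    show "new_joined D I u v \<longleftrightarrow> u \<noteq> v \<and> proj u \<bullet> proj v \<noteq> 0"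
      if "u \<in> nodes D - I" "v \<in> nodes D - I" for u v
      using new_joined_iff that nodes_D by simp
  qed
  then show ?thesis using P.extended_simple_roots_roots nodes_D by auto
qed

end

section \<open>Removed nodes modulo 2\<close>

lemma type_A_1:
  assumes "w \<in> nodes D" "bond D w w = No_Bond" "\<not> arrow D w w"
  shows "type_A D 1 {w}"
  unfolding type_A_def diagram_iso_def
  using assms by (intro exI[of _ "\<lambda>_. 0"]) (auto simp: full_subdiagram_def A_diagram_def bij_betw_def)

lemma type_A_2:
  assumes "w \<in> nodes D" "w' \<in> nodes D" "w \<noteq> w'"
    and "bond D w w = No_Bond" "bond D w' w' = No_Bond" "bond D w w' = Bond 1" "bond D w' w = Bond 1"
    and "\<not> arrow D w w" "\<not> arrow D w' w'" "\<not> arrow D w w'" "\<not> arrow D w' w"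
  shows "type_A D 2 {w, w'}"
  unfolding type_A_def diagram_iso_def
proof (intro exI[of _ "\<lambda>u. if u = w then 0 else 1"] conjI)
  show "bij_betw (\<lambda>u. if u = w then 0 else 1) (nodes (full_subdiagram D {w, w'})) (nodes (A_diagram 2))"
    using assms by (auto simp: full_subdiagram_def A_diagram_def bij_betw_def inj_on_def)
qed (use assms in \<open>auto simp: full_subdiagram_def A_diagram_def\<close>)

context extended_coroots
begin

lemma \<rho>_pos: "v \<in> V \<Longrightarrow> 0 < \<rho> v"
  using \<rho>[of v] inner_pos[of v] by (cases "\<rho> v") auto

lemma \<rho>_v0: "\<rho> v0 = 1"
  using \<rho>[OF v0_in] inner_pos[OF v0_in] by simp

lemma A_\<rho>: "u \<in> V \<Longrightarrow> v \<in> V \<Longrightarrow> A u v * \<rho> v = A v u * \<rho> u"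
proof -
  assume u: "u \<in> V" and v: "v \<in> V"
  have "real (A u v) * real (\<rho> v) * (v0 \<bullet> v0) = real (A v u) * real (\<rho> u) * (v0 \<bullet> v0)"
    using A_sym[OF u v] \<rho>[OF u] \<rho>[OF v] by simp
  then have "real (A u v * \<rho> v) = real (A v u * \<rho> u)" using inner_pos[OF v0_in] by simp
  then show ?thesis by (simp only: of_nat_eq_iff)
qed

end

context coroot_diagram
begin

lemma bond_equal_length:
  assumes "u \<in> V" "v \<in> V" "A u v = 1" "A v u = 1"
  shows "bond D u v = Bond 1" "\<not> arrow D u v"
proof -
  have ne: "u \<noteq> v" using assms A_refl by auto
  have "u \<bullet> u = v \<bullet> v" using A_sym[of u v] assms by simp
  then have n: "norm u = norm v" by (simp add: norm_eq)
  have i: "2 * (u \<bullet> v) = - (v \<bullet> v)" using A_inner[of u v] assms ne by simp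
  have pos: "0 < v \<bullet> v" using inner_pos assms by simp
  have "v \<noteq> - u"
  proof
    assume "v = - u"
    then have "u \<bullet> v = - (v \<bullet> v)" by simp
    then show False using i pos by simp
  qed
  moreover have "u \<bullet> v \<noteq> 0" using i pos by auto
  moreover have "norm v \<noteq> 0" using pos by auto
  ultimately show "bond D u v = Bond 1" "\<not> arrow D u v"
    using ne n by (simp_all add: extended_coroot_diagram_def)
qed

text \<open>At least two nodes remain, so \<open>v\<close> together with \<open>I\<close> is a
  proper subset, hence independent. The strict bounds on bonds to \<open>I\<close> come from
  here.\<close>

lemma orthogonal_to_removed_nonzero:
  assumes "I \<subseteq> V" "v \<in> V - I" "V - I \<noteq> {v}"
  shows "v + (\<Sum>u\<in>I. b u *\<^sub>R u) \<noteq> 0"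
proof
  assume 0: "v + (\<Sum>u\<in>I. b u *\<^sub>R u) = 0"
  have fI: "finite I" using assms(1) finite_V finite_subset by blast
  let ?c = "\<lambda>u. if u = v then 1 else b u"
  have "(\<Sum>u\<in>I. ?c u *\<^sub>R u) = (\<Sum>u\<in>I. b u *\<^sub>R u)" using assms(2) by (intro sum.cong) auto
  then have "(\<Sum>u\<in>insert v I. ?c u *\<^sub>R u) = 0" using 0 fI assms(2) by simp
  from indep_proper[OF _ _ this, of v] assms show False by auto
qed

end

locale removed_nodes = coroot_diagram +
  fixes k :: nat and I :: "'a set"
  assumes I_def: "I = {v \<in> V. \<not> k dvd G v}" and not_single: "\<And>v. V - I \<noteq> {v}"
    and nonempty: "V - I \<noteq> {}"
begin

lemma I_V: "I \<subseteq> V" using I_def by auto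

lemma fin_I: "finite I" using I_V finite_V finite_subset by blast

lemma I_proper: "S \<subseteq> I \<Longrightarrow> S \<noteq> V"
  using nonempty I_V by auto

text \<open>The remaining nodes contribute multiples of \<open>k\<close> to the balance at
  \<open>v\<close>, whether or not \<open>v\<close> itself is removed.\<close>

lemma dvd_sum_I: "v \<in> V \<Longrightarrow> int k dvd int (\<Sum>u\<in>I. G u * A u v) - 2 * int (G v)"
proof -
  assume v: "v \<in> V"
  have "k dvd (\<Sum>u\<in>V-I. G u * A u v)" using I_def by (intro dvd_sum) auto
  moreover have "2 * G v = (\<Sum>u\<in>I. G u * A u v) + (\<Sum>u\<in>V-I. G u * A u v)"
    using balance_remove[OF v I_V] .
  then have "int (\<Sum>u\<in>I. G u * A u v) - 2 * int (G v) = - int (\<Sum>u\<in>V-I. G u * A u v)"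
    by linarith
  ultimately show ?thesis by (simp only: dvd_minus_iff int_dvd_int_iff)
qed

lemma adj_eq: "v \<in> V \<Longrightarrow> adjacent_components D I v = component D I ` {w \<in> I. 0 < A w v}"
proof -
  assume v: "v \<in> V"
  have "{w \<in> I. joined D v w} = {w \<in> I. 0 < A w v}"
    using v I_V A_pos_sym by (auto simp: joined_iff)
  then show ?thesis using adjacent_components_eq[OF symp_joined, of I v] I_V nodes_D by simp
qed

lemma joined_I_eq: "v \<in> V \<Longrightarrow> {w \<in> I. joined D v w} = {w \<in> I. 0 < A w v}"
  using I_V A_pos_sym by (auto simp: joined_iff)

lemma not_type_inf: "\<not> type_inf D I v"
  using not_single nodes_D by (simp add: type_inf_def)

lemma inner_I: "u \<in> V - I \<Longrightarrow> w \<in> I \<Longrightarrow> u \<bullet> w = - real (A u w) * (w \<bullet> w) / 2"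
  using inner_eq[of u w] I_V by blast

lemma inner_I': "u \<in> V - I \<Longrightarrow> w \<in> I \<Longrightarrow> u \<bullet> w = - real (A w u) * (u \<bullet> u) / 2"
  using inner_eq[of w u] I_V by (metis DiffD1 DiffD2 inner_commute subsetD)

context
  assumes k2: "k = 2"
begin

lemma odd_I: "u \<in> I \<Longrightarrow> odd (G u)" using I_def k2 by simp

lemma even_sum_A: "S \<subseteq> I \<Longrightarrow> even (\<Sum>u\<in>S. G u * A u v) \<longleftrightarrow> even (\<Sum>u\<in>S. A u v)"
proof -
  assume S: "S \<subseteq> I"
  have "even (\<Sum>u\<in>S. (G u + 1) * A u v)" using S odd_I by (intro dvd_sum) auto
  moreover have "(\<Sum>u\<in>S. (G u + 1) * A u v) = (\<Sum>u\<in>S. G u * A u v) + (\<Sum>u\<in>S. A u v)"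
    by (simp add: sum.distrib algebra_simps)
  ultimately show ?thesis by simp
qed

lemma even_sum_I: "v \<in> V \<Longrightarrow> even (\<Sum>u\<in>I. A u v)"
proof -
  assume "v \<in> V"
  from dvd_sum_I[OF this] have "even (int (\<Sum>u\<in>I. G u * A u v) - 2 * int (G v))"
    by (simp only: k2 of_nat_numeral)
  then have "even (\<Sum>u\<in>I. G u * A u v)" by presburger
  then show ?thesis using even_sum_A[of I v] by simp
qed

text \<open>A node of \<open>I\<close> joined to another one has at least two neighbours in \<open>I\<close>, counted with
  multiplicity, which is impossible in a diagram of finite type.\<close>

lemma I_orthogonal: "u \<in> I \<Longrightarrow> w \<in> I \<Longrightarrow> A u w = 0"
proof (rule ccontr)
  assume uw: "u \<in> I" "w \<in> I" "A u w \<noteq> 0"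
  let ?S = "{w \<in> I. \<exists>u\<in>I. 0 < A u w}"
  have "(1::nat) = 0"
  proof (rule test_vector[of ?S "\<lambda>_. 1" w])
    show "?S \<subseteq> V" using I_V by auto
    show "?S \<noteq> V" by (rule I_proper) auto
    show "w \<in> ?S" using uw by auto
    fix w assume w: "w \<in> ?S"
    have "(\<Sum>u\<in>I. A u w) = (\<Sum>u\<in>?S. A u w)"
    proof (rule sum.mono_neutral_right[OF fin_I])
      show "\<forall>u\<in>I - ?S. A u w = 0"
      proof
        fix u assume u: "u \<in> I - ?S"
        then have "\<not> 0 < A w u" using w by auto
        then show "A u w = 0" using A_pos_sym[of u w] u w I_V by auto
      qed
    qed auto
    moreover obtain u where u: "u \<in> I" "0 < A u w" using w by auto
    have "A u w \<le> (\<Sum>u\<in>I. A u w)" using member_le_sum[of u I "\<lambda>u. A u w"] fin_I u by simp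
    moreover have "even (\<Sum>u\<in>I. A u w)" using even_sum_I w I_V by auto
    ultimately have "2 \<le> (\<Sum>u\<in>?S. A u w)" using u(2) by presburger
    then show "2 * 1 \<le> (\<Sum>u\<in>?S. 1 * A u w)" by simp
  qed
  then show False by simp
qed

lemma component_single: "w \<in> I \<Longrightarrow> component D I w = {w}"
  by (rule component_eqI) (use I_orthogonal component_self in \<open>auto simp: joined_iff\<close>)

lemma adj_single: "v \<in> V \<Longrightarrow> adjacent_components D I v = (\<lambda>w. {w}) ` {w \<in> I. 0 < A w v}"
  unfolding adj_eq by (intro image_cong refl) (simp add: component_single)

text \<open>The removed nodes are pairwise orthogonal, so each \<open>u\<close> is projected away
  separately; the factor \<open>(v \<bullet> u) / (u \<bullet> u)\<close> equals
  \<open>- A v u / 2\<close>.\<close>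

definition proj2 :: "'a \<Rightarrow> 'a" where
  "proj2 v = v + (\<Sum>u\<in>I. (real (A v u) / 2) *\<^sub>R u)"

lemma proj2_orth: "v \<in> V - I \<Longrightarrow> w \<in> I \<Longrightarrow> proj2 v \<bullet> w = 0"
proof -
  assume v: "v \<in> V - I" and w: "w \<in> I"
  have "(\<Sum>u\<in>I. (real (A v u) / 2) *\<^sub>R u) \<bullet> w = (\<Sum>u\<in>I. (real (A v u) / 2) * (u \<bullet> w))"
    by (simp add: inner_sum_left)
  also have "\<dots> = (\<Sum>u\<in>I. if u = w then (real (A v w) / 2) * (w \<bullet> w) else 0)"
  proof (intro sum.cong refl)
    fix u assume u: "u \<in> I"
    show "(real (A v u) / 2) * (u \<bullet> w) = (if u = w then (real (A v w) / 2) * (w \<bullet> w) else 0)"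
      using A_eq_0_iff[of u w] I_orthogonal[OF u w] u w I_V by auto
  qed
  also have "\<dots> = (real (A v w) / 2) * (w \<bullet> w)" using fin_I w by simp
  finally show ?thesis using inner_I[OF v w] by (simp add: proj2_def inner_add_left)
qed

lemma proj2_norm:
  "v \<in> V - I \<Longrightarrow> v \<bullet> proj2 v = (v \<bullet> v) * (1 - real (\<Sum>w\<in>I. A v w * A w v) / 4)"
proof -
  assume v: "v \<in> V - I"
  have "v \<bullet> proj2 v = v \<bullet> v + (\<Sum>w\<in>I. (real (A v w) / 2) * (v \<bullet> w))"
    by (simp add: proj2_def inner_add_right inner_sum_right)
  also have "(\<Sum>w\<in>I. (real (A v w) / 2) * (v \<bullet> w)) = (\<Sum>w\<in>I. - (real (A v w * A w v) / 4) * (v \<bullet> v))"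
    by (intro sum.cong refl) (simp add: inner_I'[OF v])
  also have "\<dots> = - (real (\<Sum>w\<in>I. A v w * A w v) / 4) * (v \<bullet> v)"
    unfolding sum_distrib_right[symmetric] sum_negf sum_divide_distrib[symmetric] by simp
  finally show ?thesis by (simp add: algebra_simps)
qed

text \<open>Each summand is four times the squared cosine between \<open>v\<close> and a member of
  the orthogonal set \<open>I\<close>; strictness says that the projection is nonzero.\<close>

lemma bound2: "v \<in> V - I \<Longrightarrow> (\<Sum>w\<in>I. A v w * A w v) < 4"
proof -
  assume v: "v \<in> V - I"
  have "proj2 v \<bullet> proj2 v = v \<bullet> proj2 v"
    unfolding proj2_def[of v] inner_add_left inner_sum_left
    unfolding proj2_def[symmetric] using proj2_orth[OF v] by (simp add: inner_commute)
  moreover have "proj2 v \<noteq> 0"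
    unfolding proj2_def using orthogonal_to_removed_nonzero[OF I_V v not_single] .
  ultimately have "0 < (v \<bullet> v) * (1 - real (\<Sum>w\<in>I. A v w * A w v) / 4)"
    using proj2_norm[OF v] by (metis inner_gt_zero_iff)
  then have "0 < 1 - real (\<Sum>w\<in>I. A v w * A w v) / 4"
    by (rule zero_less_mult_pos) (use inner_pos[of v] v in simp)
  then show ?thesis by linarith
qed

text \<open>The weighted number of removed neighbours is even by the relation modulo 2 and less than
  4 by \<open>bound2\<close>, so it is 0 or 2. The names compare the removed neighbours with
  \<open>v\<close>: in \<open>long\<close> the neighbour has twice its squared length, in
  \<open>short\<close> one of the two has half of it.\<close>

lemma cases2:
  assumes v: "v \<in> V - I"
  obtains (none) "\<And>w. w \<in> I \<Longrightarrow> A w v = 0"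
  | (long) w where "w \<in> I" "A w v = 2" "A v w = 1" "\<And>u. u \<in> I \<Longrightarrow> u \<noteq> w \<Longrightarrow> A u v = 0"
  | (equal) w w' where "w \<in> I" "w' \<in> I" "w \<noteq> w'" "A w v = 1" "A v w = 1" "A w' v = 1" "A v w' = 1"
      "\<And>u. u \<in> I \<Longrightarrow> u \<noteq> w \<Longrightarrow> u \<noteq> w' \<Longrightarrow> A u v = 0"
  | (short) w w' where "w \<in> I" "w' \<in> I" "w \<noteq> w'" "A w v = 1" "A v w = 1" "A w' v = 1" "A v w' = 2"
      "\<And>u. u \<in> I \<Longrightarrow> u \<noteq> w \<Longrightarrow> u \<noteq> w' \<Longrightarrow> A u v = 0"
proof (cases "\<forall>w\<in>I. A w v = 0")
  case True
  then show thesis using none by blast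
next
  case False
  then obtain w where w: "w \<in> I" "0 < A w v" by auto
  have vV: "v \<in> V" using v by simp
  have pos: "0 < A v u \<longleftrightarrow> 0 < A u v" if "u \<in> I" for u using that I_V A_pos_sym vV by blast
  have le: "A u v \<le> A v u * A u v" "A v u \<le> A v u * A u v" if "u \<in> I" for u
    using pos[OF that] by auto
  have sA: "(\<Sum>u\<in>I. A u v) = A w v + (\<Sum>u\<in>I-{w}. A u v)" using fin_I w by (simp add: sum.remove)
  have sP: "(\<Sum>u\<in>I. A v u * A u v) = A v w * A w v + (\<Sum>u\<in>I-{w}. A v u * A u v)"
    using fin_I w by (simp add: sum.remove)
  have sle: "(\<Sum>u\<in>I-{w}. A u v) \<le> (\<Sum>u\<in>I-{w}. A v u * A u v)" using le by (intro sum_mono) auto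
  have b: "A v w * A w v + (\<Sum>u\<in>I-{w}. A v u * A u v) < 4" using bound2[OF v] sP by simp
  have ev: "even (A w v + (\<Sum>u\<in>I-{w}. A u v))" using even_sum_I[OF vV] sA by simp
  have "A w v + (\<Sum>u\<in>I-{w}. A u v) = 2"
  proof -
    have "A w v + (\<Sum>u\<in>I-{w}. A u v) < 4" using b sle le(1)[OF w(1)] by linarith
    then show ?thesis using ev w(2) by presburger
  qed
  then consider "A w v = 2" "(\<Sum>u\<in>I-{w}. A u v) = 0" | "A w v = 1" "(\<Sum>u\<in>I-{w}. A u v) = 1"
    using w(2) by linarith
  then show thesis
  proof cases
    case 1
    have "A v w = 1" using b 1 pos[OF w(1)] w(2) by auto
    then show thesis using long[of w] w 1 fin_I by auto
  next
    case 2
    have "\<exists>a\<in>I - {w}. A a v = 1 \<and> (\<forall>b\<in>I - {w}. a \<noteq> b \<longrightarrow> A b v = 0)"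
      using 2(2) fin_I sum_eq_1_iff[of "I - {w}" "\<lambda>u. A u v"] by simp
    then obtain w' where w': "w' \<in> I" "w' \<noteq> w" "A w' v = 1" "\<And>u. u \<in> I \<Longrightarrow> u \<noteq> w \<Longrightarrow> u \<noteq> w' \<Longrightarrow> A u v = 0"
      by (metis Diff_iff singletonD singletonI)
    have "A v w' * A w' v \<le> (\<Sum>u\<in>I-{w}. A v u * A u v)"
      using w' fin_I by (intro member_le_sum) auto
    then have "A v w + A v w' < 4" using b 2 w' by simp
    moreover have "0 < A v w" "0 < A v w'" using pos w w' by auto
    ultimately consider "A v w = 1" "A v w' = 1" | "A v w = 1" "A v w' = 2" | "A v w = 2" "A v w' = 1"
      by linarith
    then show thesis
    proof cases
      case 1
      then show thesis using equal[of w w'] w w' 2 by blast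
    next
      case 2
      then show thesis using short[of w w'] w w' \<open>A w v = 1\<close> by blast
    next
      case 3
      then show thesis using short[of w' w] w w' \<open>A w v = 1\<close> by blast
    qed
  qed
qed

text \<open>The type read off from \<open>A\<close> alone; 4 is the case \<open>short\<close> of
  \<open>cases2\<close>.\<close>

definition r2 :: "'a \<Rightarrow> nat" where
  "r2 v = (if \<forall>w\<in>I. A w v = 0 then 1 else if \<exists>w\<in>I. A w v = 1 \<and> A v w = 2 then 4 else 2)"

lemma r2_eq_2: "w \<in> I \<Longrightarrow> A w v \<noteq> 0 \<Longrightarrow> \<not> (\<exists>u\<in>I. A u v = 1 \<and> A v u = 2) \<Longrightarrow> r2 v = 2"
  unfolding r2_def by auto

lemma sum_A_A:
  assumes "w \<in> I" "w' \<in> I" "w \<noteq> w'" "\<And>u. u \<in> I \<Longrightarrow> u \<noteq> w \<Longrightarrow> u \<noteq> w' \<Longrightarrow> A u v = 0"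
  shows "(\<Sum>u\<in>I. A v u * A u v) = A v w * A w v + A v w' * A w' v"
proof -
  have "(\<Sum>u\<in>I. A v u * A u v) = (\<Sum>u\<in>{w, w'}. A v u * A u v)"
    using assms fin_I by (intro sum.mono_neutral_right) auto
  then show ?thesis using assms(3) by simp
qed

lemma proj2_norm_r2:
  assumes v: "v \<in> V - I" shows "v \<bullet> proj2 v = (v \<bullet> v) / real (r2 v)"
  using v
proof (cases rule: cases2)
  case none
  then have "r2 v = 1" by (simp add: r2_def)
  then show ?thesis using proj2_norm[OF v] none by simp
next
  case (long w)
  have "\<not> (\<exists>u\<in>I. A u v = 1 \<and> A v u = 2)" using long by (metis less_numeral_extra(3) one_eq_numeral_iff semiring_norm(83) zero_neq_one)
  then have "r2 v = 2" using r2_eq_2[OF long(1)] long(2) by simp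
  moreover have "(\<Sum>u\<in>I. A v u * A u v) = 2"
  proof -
    have "(\<Sum>u\<in>I. A v u * A u v) = (\<Sum>u\<in>{w}. A v u * A u v)"
      using long fin_I by (intro sum.mono_neutral_right) auto
    then show ?thesis using long by simp
  qed
  ultimately show ?thesis using proj2_norm[OF v] by simp
next
  case (equal w w')
  have "\<not> (\<exists>u\<in>I. A u v = 1 \<and> A v u = 2)"
  proof
    assume "\<exists>u\<in>I. A u v = 1 \<and> A v u = 2"
    then obtain u where "u \<in> I" "A u v = 1" "A v u = 2" by auto
    then show False using equal(4-8) by (cases "u = w"; cases "u = w'") auto
  qed
  then have "r2 v = 2" using r2_eq_2[OF equal(1)] equal(4) by simp
  then show ?thesis using proj2_norm[OF v] sum_A_A[OF equal(1-3,8)] equal by simp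
next
  case (short w w')
  then have "r2 v = 4" unfolding r2_def by (metis zero_neq_one)
  then show ?thesis using proj2_norm[OF v] sum_A_A[OF short(1-3,8)] short by simp
qed

text \<open>\<open>none\<close> is Type 1, \<open>long\<close> the second and \<open>equal\<close>
  the first alternative of Type 2, and \<open>short\<close> the first alternative of Type 4. Other
  types are excluded by counting nodes or components and by comparing lengths.\<close>

lemma new_length2:
  assumes v: "v \<in> V - I" shows "new_length D I len v = len v / sqrt (real (r2 v))"
  using v
proof (cases rule: cases2)
  case none
  then have "r2 v = 1" by (simp add: r2_def)
  moreover have e: "{w \<in> I. 0 < A w v} = {}" using none by auto
  have "{w \<in> I. joined D v w} = {}" "adjacent_components D I v = {}"
    using joined_I_eq[of v] adj_single[of v] v unfolding e by simp_all
  ultimately show ?thesis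
    using new_length_type1[OF not_type_inf, of v len] by simp
next
  case (long w)
  have J: "{u \<in> I. 0 < A u v} = {w}" using long by (auto intro: ccontr)
  then have adj: "adjacent_components D I v = {{w}}" and jo: "{u \<in> I. joined D v u} = {w}"
    using adj_single[of v] joined_I_eq[of v] v by auto
  have "\<not> (\<exists>u\<in>I. A u v = 1 \<and> A v u = 2)" using long by (metis less_numeral_extra(3) one_eq_numeral_iff semiring_norm(83) zero_neq_one)
  then have r: "r2 v = 2" using r2_eq_2[OF long(1)] long(2) by simp
  have wV: "w \<in> V" "v \<in> V" using long I_V v by auto
  have "w \<bullet> w = 2 * (v \<bullet> v)" using A_sym[of v w] wV long by simp
  then have "\<not> w \<bullet> w \<le> v \<bullet> v" using inner_pos[OF wV(2)] by simp
  then have lt: "len v < len w" using len_le_iff[OF wV] by simp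
  show ?thesis
    unfolding r
  proof (rule new_length_not_type1[OF not_type_inf long(1)])
    show "joined D v w" using jo by auto
    show "type2 D I len v \<longleftrightarrow> (2::nat) = 2" unfolding type2_def using jo lt by auto
    show "type3 D I v \<longleftrightarrow> (2::nat) = 3" unfolding type3_def adj by auto
    show "type4 D I len v \<longleftrightarrow> (2::nat) = 4" unfolding type4_def adj by auto
  qed simp
next
  case (equal w w')
  have J: "{u \<in> I. 0 < A u v} = {w, w'}" using equal by (auto intro: ccontr)
  then have adj: "adjacent_components D I v = {{w}, {w'}}" and jo: "{u \<in> I. joined D v u} = {w, w'}"
    using adj_single[of v] joined_I_eq[of v] v by auto
  have wV: "w \<in> V" "w' \<in> V" "v \<in> V" using equal I_V v by auto
  have "\<not> (\<exists>u\<in>I. A u v = 1 \<and> A v u = 2)"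
  proof
    assume "\<exists>u\<in>I. A u v = 1 \<and> A v u = 2"
    then obtain u where "u \<in> I" "A u v = 1" "A v u = 2" by auto
    then show False using equal(4-8) by (cases "u = w"; cases "u = w'") auto
  qed
  then have r: "r2 v = 2" using r2_eq_2[OF equal(1)] equal(4) by simp
  have "w \<bullet> w = v \<bullet> v" "w' \<bullet> w' = v \<bullet> v" using A_sym[of v w] A_sym[of v w'] wV equal by simp_all
  then have le: "len w = len v" "len w' = len v"
    using len_le_iff wV by (metis order_antisym order_refl)+
  have t: "type_A D 1 {w}" "type_A D 1 {w'}" using type_A_1[of _ D] nodes_D bond_refl wV by auto
  have C: "C1 = {w} \<and> C2 = {w'} \<or> C1 = {w'} \<and> C2 = {w}" if "{{w}, {w'}} = {C1, C2}" for C1 C2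
    using that by (metis doubleton_eq_iff)
  have ncard: "\<not> type_A D 2 {w}" "\<not> type_A D 3 {w}" "\<not> type_A D 2 {w'}" "\<not> type_A D 3 {w'}"
    using type_A_card[of D _ "{w}"] type_A_card[of D _ "{w'}"] nodes_D wV by fastforce+
  show ?thesis
    unfolding r
  proof (rule new_length_not_type1[OF not_type_inf equal(1)])
    show "joined D v w" using jo by auto
    have "{w} \<noteq> {w'} \<and> adjacent_components D I v = {{w}, {w'}} \<and> type_A D 1 {w} \<and> type_A D 1 {w'} \<and>
        w \<in> {w} \<and> w' \<in> {w'} \<and> len v \<le> min (len w) (len w')"
      using adj t le equal(3) by simp
    then have "type2 D I len v"
      unfolding type2_def by (intro disjI1 exI[of _ "{w}"] exI[of _ "{w'}"] exI[of _ w] exI[of _ w'])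
    then show "type2 D I len v \<longleftrightarrow> (2::nat) = 2" by simp
    have "\<not> type3 D I v"
    proof
      assume "type3 D I v"
      then obtain C1 C2 where "{{w}, {w'}} = {C1, C2}" "type_A D 2 C1" unfolding type3_def adj by metis
      then show False using C[of C1 C2] ncard by metis
    qed
    then show "type3 D I v \<longleftrightarrow> (2::nat) = 3" by simp
    have no: "\<not> (\<exists>v1\<in>C1. \<exists>v2\<in>C2. min (len v1) (len v2) < len v)" "\<not> type_A D 3 C1"
      if "{{w}, {w'}} = {C1, C2}" for C1 C2
      using C[OF that] le ncard by auto
    have "\<not> type4 D I len v"
    proof
      assume "type4 D I len v"
      then obtain C1 C2 where "{{w}, {w'}} = {C1, C2}"
        "(\<exists>v1\<in>C1. \<exists>v2\<in>C2. min (len v1) (len v2) < len v) \<or> type_A D 3 C1"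
        unfolding type4_def adj by metis
      then show False using no by metis
    qed
    then show "type4 D I len v \<longleftrightarrow> (2::nat) = 4" by simp
  qed simp
next
  case (short w w')
  have J: "{u \<in> I. 0 < A u v} = {w, w'}" using short by (auto intro: ccontr)
  then have adj: "adjacent_components D I v = {{w}, {w'}}" and jo: "{u \<in> I. joined D v u} = {w, w'}"
    using adj_single[of v] joined_I_eq[of v] v by auto
  have wV: "w \<in> V" "w' \<in> V" "v \<in> V" using short I_V v by auto
  have r: "r2 v = 4" using short unfolding r2_def by (metis zero_neq_one)
  have "w \<bullet> w = v \<bullet> v" "2 * (w' \<bullet> w') = v \<bullet> v"
    using A_sym[of v w] A_sym[of v w'] wV short by simp_all
  moreover have "0 < w' \<bullet> w'" using inner_pos wV by blast
  ultimately have "v \<bullet> v \<le> w \<bullet> w" "\<not> v \<bullet> v \<le> w' \<bullet> w'" by linarith+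
  then have le: "len v \<le> len w" "\<not> len v \<le> len w'"
    using len_le_iff wV by blast+
  have t: "type_A D 1 {w}" "type_A D 1 {w'}" using type_A_1[of _ D] nodes_D bond_refl wV by auto
  have C: "C1 = {w} \<and> C2 = {w'} \<or> C1 = {w'} \<and> C2 = {w}" if "{{w}, {w'}} = {C1, C2}" for C1 C2
    using that by (metis doubleton_eq_iff)
  have ncard: "\<not> type_A D 2 {w}" "\<not> type_A D 2 {w'}"
    using type_A_card[of D _ "{w}"] type_A_card[of D _ "{w'}"] nodes_D wV by fastforce+
  show ?thesis
    unfolding r
  proof (rule new_length_not_type1[OF not_type_inf short(1)])
    show "joined D v w" using jo by auto
    have no: "\<not> len v \<le> min (len v1) (len v2)" if "{{w}, {w'}} = {C1, C2}" "v1 \<in> C1" "v2 \<in> C2" for C1 C2 v1 v2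
      using C[OF that(1)] that(2,3) le by auto
    have "\<not> type2 D I len v"
    proof
      assume "type2 D I len v"
      moreover have "{w, w'} \<noteq> {u}" for u using short(3) by auto
      ultimately obtain C1 C2 v1 v2 where "{{w}, {w'}} = {C1, C2}" "v1 \<in> C1" "v2 \<in> C2"
        "len v \<le> min (len v1) (len v2)" unfolding type2_def adj jo by metis
      then show False using no by metis
    qed
    then show "type2 D I len v \<longleftrightarrow> (4::nat) = 2" by simp
    have "\<not> type3 D I v"
    proof
      assume "type3 D I v"
      then obtain C1 C2 where "{{w}, {w'}} = {C1, C2}" "type_A D 2 C1" unfolding type3_def adj by metis
      then show False using C[of C1 C2] ncard by metis
    qed
    then show "type3 D I v \<longleftrightarrow> (4::nat) = 3" by simp
    have "type4 D I len v"
      unfolding type4_def adj using t le short(3) by (intro exI[of _ "{w}"] exI[of _ "{w'}"]) auto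
    then show "type4 D I len v \<longleftrightarrow> (4::nat) = 4" by simp
  qed simp
qed

lemma r2_cases: "v \<in> V - I \<Longrightarrow> r2 v = 1 \<or> r2 v = 2 \<or> r2 v = 4"
  by (simp add: r2_def)

text \<open>The factor 2 in \<open>\<rho> v\<close> serves the length and divisibility conditions on
  the special node.\<close>

lemma r2_4: "v \<in> V - I \<Longrightarrow> r2 v = 4 \<Longrightarrow> \<exists>w\<in>I. \<rho> v = 2 * \<rho> w"
proof -
  assume v: "v \<in> V - I" and "r2 v = 4"
  then obtain w where w: "w \<in> I" "A w v = 1" "A v w = 2" by (auto simp: r2_def split: if_splits)
  then have "\<rho> v = 2 * \<rho> w" using A_\<rho>[of w v] v I_V by auto
  then show ?thesis using w by auto
qed

lemma even_G: "v \<in> V - I \<Longrightarrow> even (G v)" using I_def k2 by simp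

text \<open>The special node is \<open>v0\<close> if it remains, as happens in the non-reduced case, and its neighbour
  otherwise.\<close>

lemma special2:
  obtains v1 where "v1 \<in> V - I" "G v1 = 2" "\<And>v. v \<in> V - I \<Longrightarrow> \<rho> v1 * r2 v \<le> \<rho> v * r2 v1"
    "\<And>v. v \<in> V - I \<Longrightarrow> (2 * \<rho> v1 * r2 v) dvd (G v * \<rho> v * r2 v1)"
  using G_v0
proof
  assume G1: "G v0 = 1"
  then have v0I: "v0 \<in> I" using v0_in I_def k2 by simp
  \<comment> \<open>The balance at \<open>v0\<close> totals 2 and a neighbour, being outside
    \<open>I\<close>, has even \<open>G\<close>. So it has \<open>G u = 2\<close>, and the bond
    joins equal lengths.\<close>
  have "\<not> (\<forall>u\<in>V. G u * A u v0 = 0)"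
  proof
    assume "\<forall>u\<in>V. G u * A u v0 = 0"
    then have "(\<Sum>u\<in>V. G u * A u v0) = 0" by (intro sum.neutral)
    then show False using balance[OF v0_in] G1 by linarith
  qed
  then obtain u where u: "u \<in> V" "0 < A u v0" by auto
  have uR: "u \<in> V - I" using I_orthogonal[OF _ v0I, of u] u by auto
  have "G u * A u v0 \<le> 2" using neighbour_le[OF u(1) v0_in] G1 by simp
  moreover have "2 \<le> G u" using even_G[OF uR] G_pos[OF u(1)] by presburger
  moreover have "G u \<le> G u * A u v0" using u(2) by simp
  ultimately have Gu: "G u = 2" by linarith
  then have Au: "A u v0 = 1" using \<open>G u * A u v0 \<le> 2\<close> u(2) by simp
  then have "A v0 u * \<rho> u = 1" using A_\<rho>[OF u(1) v0_in] \<rho>_v0 by simp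
  then have one: "A v0 u = 1" "\<rho> u = 1" by simp_all
  \<comment> \<open>The removed neighbour \<open>v0\<close> rules out 1, and 4 would make
    \<open>\<rho> u = 1\<close> even.\<close>
  have ru: "r2 u = 2"
  proof -
    have "r2 u \<noteq> 4"
    proof
      assume "r2 u = 4"
      then obtain w where "\<rho> u = 2 * \<rho> w" using r2_4[OF uR] by auto
      then show False using one by presburger
    qed
    moreover have "r2 u \<noteq> 1"
    proof -
      have "\<not> (\<forall>w\<in>I. A w u = 0)" using one v0I by (metis zero_neq_one)
      then show ?thesis unfolding r2_def by simp
    qed
    ultimately show ?thesis using r2_cases[OF uR] by auto
  qed
  have 1: "\<rho> u * r2 v \<le> \<rho> v * r2 u" if v: "v \<in> V - I" for v
  proof -
    have p: "0 < \<rho> v" using \<rho>_pos v by simp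
    show ?thesis
    proof (cases "r2 v = 4")
      case True
      then obtain w where w: "w \<in> I" "\<rho> v = 2 * \<rho> w" using r2_4[OF v] by auto
      have "0 < \<rho> w" using \<rho>_pos w I_V by auto
      then show ?thesis using True one ru w by simp
    next
      case False
      then have "r2 v \<le> 2" using r2_cases[OF v] by auto
      then show ?thesis using one ru p by simp
    qed
  qed
  have 2: "(2 * \<rho> u * r2 v) dvd (G v * \<rho> v * r2 u)" if v: "v \<in> V - I" for v
  proof -
    \<comment> \<open>For Type 4 both factors are even; for Type 2 the evenness of
      \<open>G v\<close> is enough.\<close>
    have "r2 v dvd G v * \<rho> v"
    proof (cases "r2 v = 4")
      case True
      then obtain w where w: "w \<in> I" "\<rho> v = 2 * \<rho> w" using r2_4[OF v] by auto
      have "2 * 2 dvd G v * \<rho> v" by (rule mult_dvd_mono) (use even_G[OF v] w in auto)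
      then show ?thesis using True by simp
    next
      case False
      then show ?thesis using r2_cases[OF v] even_G[OF v] by auto
    qed
    then show ?thesis using one ru by (simp add: mult.commute)
  qed
  show thesis using that[OF uR Gu 1 2] .
next
  assume G2: "G v0 = 2 \<and> (\<forall>v\<in>V - {v0}. even (\<rho> v) \<and> even (A v v0))"
  then have v0R: "v0 \<in> V - I" using v0_in I_def k2 by simp
  have r0: "r2 v0 \<noteq> 4"
  proof
    assume "r2 v0 = 4"
    then obtain w where "\<rho> v0 = 2 * \<rho> w" using r2_4[OF v0R] by auto
    then show False using \<rho>_v0 by presburger
  qed
  have r0': "r2 v0 = 1 \<or> r2 v0 = 2" using r2_cases[OF v0R] r0 by auto
  \<comment> \<open>Every node but \<open>v0\<close> has even \<open>\<rho>\<close>, including the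
    removed neighbour \<open>w\<close> of a Type 4 node. So \<open>\<rho> v\<close> alone is
    divisible by the type, and the factor 2 of \<open>G v\<close> stays free for
    \<open>k\<close>.\<close>
  have *: "r2 v dvd \<rho> v * 1 \<and> 0 < \<rho> v" if v: "v \<in> V - I" "v \<noteq> v0" for v
  proof -
    have e: "even (\<rho> v)" using G2 v by auto
    have "r2 v dvd \<rho> v"
    proof (cases "r2 v = 4")
      case True
      then obtain w where w: "w \<in> I" "\<rho> v = 2 * \<rho> w" using r2_4[OF v(1)] by auto
      have "w \<noteq> v0" using w(1) v0R by auto
      then have "even (\<rho> w)" using G2 w I_V by auto
      then have "2 * 2 dvd 2 * \<rho> w" by (intro mult_dvd_mono) auto
      then show ?thesis using True w by simp
    next
      case False
      then show ?thesis using r2_cases[OF v(1)] e by auto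
    qed
    then show ?thesis using \<rho>_pos v by simp
  qed
  have 1: "\<rho> v0 * r2 v \<le> \<rho> v * r2 v0" if v: "v \<in> V - I" for v
  proof (cases "v = v0")
    case False
    have "r2 v \<le> \<rho> v" using *[OF v False] by (auto dest: dvd_imp_le)
    also have "\<rho> v \<le> \<rho> v * r2 v0" using r0' by auto
    finally show ?thesis using \<rho>_v0 by simp
  qed simp
  have 2: "(2 * \<rho> v0 * r2 v) dvd (G v * \<rho> v * r2 v0)" if v: "v \<in> V - I" for v
  proof (cases "v = v0")
    case True
    then show ?thesis using G2 by simp
  next
    case False
    have "2 * r2 v dvd G v * \<rho> v" using *[OF v False] even_G[OF v] by (intro mult_dvd_mono) auto
    then show ?thesis using \<rho>_v0 by (auto intro: dvd_mult2)
  qed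
  show thesis using that[OF v0R _ 1 2] G2 by blast
qed

text \<open>The lengths of the removed nodes cancel by \<open>A_sym\<close>, which leaves the
  multiple \<open>r2 v * A u v + r2 v * N / 2\<close>. The halving is harmless: the type is even
  unless no removed node is joined to \<open>v\<close>, and then \<open>N = 0\<close>.\<close>

lemma proj2_integral:
  assumes u: "u \<in> V - I" and v: "v \<in> V - I" and uv: "u \<noteq> v"
  shows "\<exists>m::nat. 2 * real (r2 v) * (u \<bullet> proj2 v) = - real m * (v \<bullet> v)"
proof -
  define N where "N = (\<Sum>w\<in>I. A u w * A w v)"
  have "u \<bullet> proj2 v = u \<bullet> v + (\<Sum>w\<in>I. (real (A v w) / 2) * (u \<bullet> w))"
    by (simp add: proj2_def inner_add_right inner_sum_right)
  also have "(\<Sum>w\<in>I. (real (A v w) / 2) * (u \<bullet> w)) = (\<Sum>w\<in>I. real (A u w * A w v) * (- (v \<bullet> v) / 4))"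
  proof (intro sum.cong refl)
    fix w assume w: "w \<in> I"
    have "real (A v w) * (w \<bullet> w) = real (A w v) * (v \<bullet> v)" using A_sym[of v w] v w I_V by auto
    moreover have "(real (A v w) / 2) * (u \<bullet> w) = - real (A u w) / 4 * (real (A v w) * (w \<bullet> w))"
      unfolding inner_I[OF u w] by simp
    ultimately show "(real (A v w) / 2) * (u \<bullet> w) = real (A u w * A w v) * (- (v \<bullet> v) / 4)" by simp
  qed
  also have "\<dots> = real N * (- (v \<bullet> v) / 4)" by (simp only: N_def of_nat_sum sum_distrib_right)
  also have "u \<bullet> v = - real (A u v) * (v \<bullet> v) / 2" using inner_eq u v uv by blast
  finally have eq: "u \<bullet> proj2 v = - real (A u v) * (v \<bullet> v) / 2 + real N * (- (v \<bullet> v) / 4)" .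
  have e: "2 * real (r2 v) * (u \<bullet> proj2 v) = - (real (r2 v * A u v) + real (r2 v * N) / 2) * (v \<bullet> v)"
    unfolding eq by (simp add: algebra_simps)
  have "even (r2 v * N)"
  proof (cases "r2 v = 1")
    case True
    then have "A w v = 0" if "w \<in> I" for w using that by (auto simp: r2_def split: if_splits)
    then show ?thesis by (simp add: N_def)
  qed (use r2_cases[OF v] in auto)
  then obtain M where "r2 v * N = 2 * M" by (elim evenE)
  then have "real (r2 v * N) / 2 = real M" by simp
  then show ?thesis using e by (intro exI[of _ "r2 v * A u v + M"]) simp
qed

theorem is_extended_coroot_diagram2:
  "\<exists>\<Psi> \<Delta>' E' :: 'a set. extended_simple_roots \<Psi> \<Delta>' E' \<and>
    diagram_iso (new_diagram D I len) (extended_coroot_diagram E')"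
proof -
  obtain v1 where v1: "v1 \<in> V - I" "G v1 = 2" "\<And>v. v \<in> V - I \<Longrightarrow> \<rho> v1 * r2 v \<le> \<rho> v * r2 v1"
    "\<And>v. v \<in> V - I \<Longrightarrow> (2 * \<rho> v1 * r2 v) dvd (G v * \<rho> v * r2 v1)"
    using special2 by blast
  interpret projected_diagram V G A v0 \<rho> E len 2 I "\<lambda>v u. real (A v u) / 2" r2 v1
  proof unfold_locales
    show "0 < real (A v w) / 2 \<longleftrightarrow> (\<exists>w'\<in>I. 0 < A w' v \<and> w \<in> component D I w')"
      if "v \<in> V - I" "w \<in> I" for v w
    proof -
      have "(\<exists>w'\<in>I. 0 < A w' v \<and> w \<in> component D I w') \<longleftrightarrow> 0 < A w v"
        using component_single that(2) by auto
      then show ?thesis using A_pos_sym[of v w] that I_V by auto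
    qed
    show "0 < r2 v" if "v \<in> V - I" for v using r2_cases[OF that] by auto
  qed (use I_V not_single even_G v1 proj2_orth proj2_norm_r2 new_length2 proj2_integral
      in \<open>simp_all add: proj2_def\<close>)
  show ?thesis by (rule is_extended_coroot_diagram)
qed

end

end

section \<open>Removed nodes modulo 3\<close>

context removed_nodes
begin

context
  assumes k3: "k = 3"
begin

lemma not_3_dvd: "u \<in> I \<Longrightarrow> \<not> 3 dvd G u" using I_def k3 by simp

abbreviation (input) "deg w \<equiv> \<Sum>u\<in>I. A u w"

lemma dvd3: "v \<in> V \<Longrightarrow> 3 dvd int (\<Sum>u\<in>I. G u * A u v) - 2 * int (G v)"
  using dvd_sum_I[of v] by (simp only: k3 of_nat_numeral)

lemma deg_1:
  assumes "w \<in> V" "deg w = 1"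
  obtains u where "u \<in> I" "A u w = 1" "\<And>x. x \<in> I \<Longrightarrow> x \<noteq> u \<Longrightarrow> A x w = 0"
    "(\<Sum>x\<in>I. f x * A x w) = f u"
proof -
  have "\<exists>u\<in>I. A u w = 1 \<and> (\<forall>x\<in>I. u \<noteq> x \<longrightarrow> A x w = 0)"
    using assms(2) sum_eq_1_iff[OF fin_I, of "\<lambda>u. A u w"] by simp
  then obtain u where u: "u \<in> I" "A u w = 1" "\<And>x. x \<in> I \<Longrightarrow> x \<noteq> u \<Longrightarrow> A x w = 0" by metis
  have "(\<Sum>x\<in>I. f x * A x w) = (\<Sum>x\<in>{u}. f x * A x w)"
    using u fin_I by (intro sum.mono_neutral_right) auto
  then show thesis using that[OF u] u by simp
qed

text \<open>The relation modulo 3 at an isolated removed node would read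
  \<open>3 dvd 2 * G w\<close>.\<close>

lemma deg_pos: "w \<in> I \<Longrightarrow> 0 < deg w"
proof (rule ccontr)
  assume w: "w \<in> I" and "\<not> 0 < deg w"
  then have "\<forall>u\<in>I. A u w = 0" using fin_I by simp
  then have "(\<Sum>u\<in>I. G u * A u w) = 0" by simp
  then have "3 dvd 2 * int (G w)" using dvd3[of w] w I_V by auto
  then show False using not_3_dvd[OF w] by presburger
qed

text \<open>The relation modulo 3 at the leaf \<open>u\<close> involves only \<open>w\<close>, and
  -2 is congruent to 1.\<close>

lemma leaf_neighbour: "u \<in> I \<Longrightarrow> w \<in> I \<Longrightarrow> deg u = 1 \<Longrightarrow> 0 < A u w \<Longrightarrow> 3 dvd G u + G w"
proof -
  assume u: "u \<in> I" and w: "w \<in> I" and d: "deg u = 1" and uw: "0 < A u w"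
  have uV: "u \<in> V" "w \<in> V" using u w I_V by auto
  obtain x where x: "x \<in> I" "A x u = 1" "\<And>y. y \<in> I \<Longrightarrow> y \<noteq> x \<Longrightarrow> A y u = 0"
    "(\<Sum>y\<in>I. G y * A y u) = G x" using deg_1[OF uV(1) d, of G] by blast
  have "x = w" using x(3)[OF w] A_pos_sym[OF uV] uw by auto
  then have "3 dvd int (G w) - 2 * int (G u)" using dvd3[OF uV(1)] x(4) by simp
  then show ?thesis by presburger
qed

text \<open>Two leaves joined to each other: the local form of lying in a component of type
  \<open>A\<^sub>2\<close>.\<close>

definition paired :: "'a \<Rightarrow> bool" where
  "paired w \<longleftrightarrow> deg w = 1 \<and> (\<exists>u\<in>I. 0 < A u w \<and> deg u = 1)"

lemma paired_neighbour:
  assumes w: "w \<in> I" and u: "u \<in> I" and uw: "0 < A u w" and p: "paired u"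
  shows "paired w"
proof -
  have uV: "u \<in> V" "w \<in> V" using u w I_V by auto
  obtain x where x: "x \<in> I" "0 < A x u" "deg x = 1" and d: "deg u = 1" using p by (auto simp: paired_def)
  obtain y where y: "\<And>x. x \<in> I \<Longrightarrow> x \<noteq> y \<Longrightarrow> A x u = 0" using deg_1[OF uV(1) d] by metis
  have "0 < A w u" using A_pos_sym[OF uV] uw by simp
  then have "x = w" using y[OF x(1)] y[OF w] x(2) by (metis less_irrefl)
  then show ?thesis using u uw d x(3) unfolding paired_def by blast
qed

text \<open>The test vector has coefficient 1 at the leaves and 2 at the other nodes of the components
  that are not of type \<open>A\<^sub>2\<close>.\<close>

lemma all_paired: "w \<in> I \<Longrightarrow> paired w"
proof (rule ccontr)
  assume w: "w \<in> I" "\<not> paired w"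
  let ?S = "{w \<in> I. \<not> paired w}" and ?c = "\<lambda>w. if deg w = 1 then 1 else 2 :: nat"
  have "?c w = 0"
  proof (rule test_vector[of ?S ?c w])
    show "?S \<subseteq> V" using I_V by auto
    show "?S \<noteq> V" by (rule I_proper) auto
    show "w \<in> ?S" using w by auto
    fix w assume "w \<in> ?S"
    then have w: "w \<in> I" "\<not> paired w" by auto
    have wV: "w \<in> V" using w I_V by auto
    have restrict: "(\<Sum>u\<in>?S. ?c u * A u w) = (\<Sum>u\<in>I. ?c u * A u w)"
    proof (rule sum.mono_neutral_left[OF fin_I])
      show "\<forall>u\<in>I - ?S. ?c u * A u w = 0" using paired_neighbour[OF w(1)] w(2) by auto
    qed auto
    have "2 * ?c w \<le> (\<Sum>u\<in>I. ?c u * A u w)"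
    proof (cases "deg w = 1")
      case True
      \<comment> \<open>The neighbour of an unpaired leaf is not a leaf and has coefficient 2, just
        what is required.\<close>
      obtain u where u: "u \<in> I" "A u w = 1" "(\<Sum>x\<in>I. ?c x * A x w) = ?c u"
        using deg_1[OF wV True, of ?c] by blast
      have "deg u \<noteq> 1" using u w(2) True unfolding paired_def by (metis zero_less_one)
      then show ?thesis using u(3) True by simp
    next
      case False
      define leaf_set where "leaf_set = {u \<in> I. deg u = 1}"
      define inner_set where "inner_set = {u \<in> I. deg u \<noteq> 1}"
      have split: "(\<Sum>u\<in>I. f u) = (\<Sum>u\<in>leaf_set. f u) + (\<Sum>u\<in>inner_set. f u)" for f :: "'a \<Rightarrow> nat"
      proof -
        have "I = leaf_set \<union> inner_set" "leaf_set \<inter> inner_set = {}" "finite leaf_set" "finite inner_set"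
          using fin_I unfolding leaf_set_def inner_set_def by auto
        then show ?thesis using sum.union_disjoint[of leaf_set inner_set f] by simp
      qed
      have fin: "finite inner_set" "inner_set \<subseteq> I" using fin_I by (auto simp: inner_set_def)
      define L where "L = (\<Sum>u\<in>leaf_set. A u w)"
      define N where "N = (\<Sum>u\<in>inner_set. A u w)"
      have d: "deg w = L + N" unfolding L_def N_def by (rule split)
      have cs: "(\<Sum>u\<in>I. ?c u * A u w) = L + 2 * N"
        unfolding split[of "\<lambda>u. ?c u * A u w"] L_def N_def sum_distrib_left
        by (intro arg_cong2[of _ _ _ _ "(+)"] sum.cong) (auto simp: leaf_set_def inner_set_def)
      \<comment> \<open>Modulo 3 every leaf next to \<open>w\<close> has \<open>G\<close> congruent
        to \<open>- G w\<close>.\<close>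
      have "3 dvd (\<Sum>u\<in>leaf_set. (G u + G w) * A u w)"
      proof (rule dvd_sum)
        fix u assume "u \<in> leaf_set"
        then show "3 dvd (G u + G w) * A u w"
          using leaf_neighbour[of u w] w(1) unfolding leaf_set_def by (cases "A u w = 0") auto
      qed
      moreover have "(\<Sum>u\<in>leaf_set. (G u + G w) * A u w) = (\<Sum>u\<in>leaf_set. G u * A u w) + G w * L"
        by (simp add: L_def sum.distrib sum_distrib_left algebra_simps)
      ultimately have lf: "3 dvd (\<Sum>u\<in>leaf_set. G u * A u w) + G w * L" by simp
      have tot: "3 dvd int ((\<Sum>u\<in>leaf_set. G u * A u w) + (\<Sum>u\<in>inner_set. G u * A u w)) - 2 * int (G w)"
        using dvd3[OF wV] unfolding split[of "\<lambda>u. G u * A u w"] .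
      have Gw: "\<not> 3 dvd G w" using not_3_dvd w by simp
      \<comment> \<open>The pairs \<open>(L, N)\<close> with \<open>L + N \<ge> 2\<close> and
        \<open>L + 2 * N < 4\<close> are (2, 0), (3, 0) and (1, 1). The first two make 3 divide
        \<open>G w\<close>; in the third it divides \<open>G\<close> at the neighbour that is not a
        leaf. Both are impossible in \<open>I\<close>.\<close>
      have arith: "3 dvd a + g * 2 \<Longrightarrow> 3 dvd int a - 2 * int g \<Longrightarrow> 3 dvd g"
        "3 dvd a + g * 3 \<Longrightarrow> 3 dvd int a - 2 * int g \<Longrightarrow> 3 dvd g"
        "3 dvd a + g \<Longrightarrow> 3 dvd int (a + b) - 2 * int g \<Longrightarrow> 3 dvd b" for a b g :: nat
        by presburger+
      have "4 \<le> L + 2 * N"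
      proof (rule ccontr)
        assume "\<not> 4 \<le> L + 2 * N"
        moreover have "2 \<le> L + N" using deg_pos[OF w(1)] False d by linarith
        ultimately have "N = 0 \<and> (L = 2 \<or> L = 3) \<or> N = 1 \<and> L = 1" by linarith
        then show False
        proof
          assume NL: "N = 0 \<and> (L = 2 \<or> L = 3)"
          then have "\<forall>u\<in>inner_set. A u w = 0" using fin unfolding N_def by simp
          then have "(\<Sum>u\<in>inner_set. G u * A u w) = 0" by simp
          then have "3 dvd int (\<Sum>u\<in>leaf_set. G u * A u w) - 2 * int (G w)" using tot by (simp only: add_0_right)
          then show False using NL lf Gw arith(1,2) by blast
        next
          assume NL: "N = 1 \<and> L = 1"
          then have "\<exists>u\<in>inner_set. A u w = 1 \<and> (\<forall>x\<in>inner_set. u \<noteq> x \<longrightarrow> A x w = 0)"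
            using sum_eq_1_iff[of inner_set "\<lambda>u. A u w"] fin unfolding N_def by simp
          then obtain u where u: "u \<in> inner_set" "A u w = 1" "\<forall>x\<in>inner_set. u \<noteq> x \<longrightarrow> A x w = 0"
            by (elim bexE conjE)
          have "(\<Sum>x\<in>inner_set. G x * A x w) = (\<Sum>x\<in>{u}. G x * A x w)"
            using u(1,3) fin by (intro sum.mono_neutral_right) auto
          then have "(\<Sum>x\<in>inner_set. G x * A x w) = G u" using u(2) by simp
          then have "3 dvd int ((\<Sum>u\<in>leaf_set. G u * A u w) + G u) - 2 * int (G w)" using tot by (simp only:)
          moreover have "3 dvd (\<Sum>u\<in>leaf_set. G u * A u w) + G w" using NL lf by (simp only: mult_1_right)
          ultimately have "3 dvd G u" by (rule arith(3)[rotated])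
          then show False using not_3_dvd[of u] u(1) fin by auto
        qed
      qed
      then show ?thesis using cs False by simp
    qed
    then show "2 * ?c w \<le> (\<Sum>u\<in>?S. ?c u * A u w)" unfolding restrict .
  qed
  then show False by (simp split: if_splits)
qed

definition partner :: "'a \<Rightarrow> 'a" where
  "partner w = (SOME u. u \<in> I \<and> 0 < A u w)"

text \<open>Removed nodes are leaves by \<open>all_paired\<close>, so the neighbour chosen by
  \<open>SOME\<close> is the only one.\<close>

lemma partner: "w \<in> I \<Longrightarrow> partner w \<in> I" "w \<in> I \<Longrightarrow> A (partner w) w = 1"
  and A_not_partner: "w \<in> I \<Longrightarrow> u \<in> I \<Longrightarrow> u \<noteq> partner w \<Longrightarrow> A u w = 0"
proof -
  have *: "partner w \<in> I \<and> A (partner w) w = 1 \<and> (\<forall>u\<in>I. u \<noteq> partner w \<longrightarrow> A u w = 0)"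
    if w: "w \<in> I" for w
  proof -
    have d: "deg w = 1" using all_paired[OF w] by (simp add: paired_def)
    have "w \<in> V" using w I_V by auto
    from deg_1[OF this d, of "\<lambda>_. 0"]
    obtain u where u: "u \<in> I" "A u w = 1" "\<And>x. x \<in> I \<Longrightarrow> x \<noteq> u \<Longrightarrow> A x w = 0" by metis
    have "partner w = u"
      unfolding partner_def by (rule some_equality) (use u in \<open>auto intro: ccontr\<close>)
    then show ?thesis using u by auto
  qed
  show "w \<in> I \<Longrightarrow> partner w \<in> I" "w \<in> I \<Longrightarrow> A (partner w) w = 1"
    "w \<in> I \<Longrightarrow> u \<in> I \<Longrightarrow> u \<noteq> partner w \<Longrightarrow> A u w = 0" using * by auto
qed

lemma partner_partner: "w \<in> I \<Longrightarrow> partner (partner w) = w"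
proof -
  assume w: "w \<in> I"
  have "0 < A w (partner w)" using A_pos_sym[of "partner w" w] partner w I_V by auto
  then show ?thesis using A_not_partner[OF partner(1)[OF w] w] by (cases "w = partner (partner w)") auto
qed

lemma A_partner: "w \<in> I \<Longrightarrow> A w (partner w) = 1"
  using partner[of "partner w"] partner_partner[of w] partner(1)[of w] by simp

lemma partner_neq: "w \<in> I \<Longrightarrow> partner w \<noteq> w"
  using partner(2)[of w] A_refl by (metis zero_neq_one)

lemma norm_partner: "w \<in> I \<Longrightarrow> partner w \<bullet> partner w = w \<bullet> w"
  using A_sym[of w "partner w"] partner[of w] A_partner[of w] I_V by auto

lemma component_pair: "w \<in> I \<Longrightarrow> component D I w = {w, partner w}"
proof (rule component_eqI)
  assume w: "w \<in> I"
  fix u v assume u: "u \<in> {w, partner w}" and v: "v \<in> I" and uv: "joined D u v"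
  have "u \<in> I" using u w partner(1) by auto
  moreover have "0 < A v u" using uv A_pos_sym joined_iff by auto
  ultimately have "v = partner u" using A_not_partner[of u v] v by auto
  then show "v \<in> {w, partner w}" using u w partner_partner by auto
next
  assume w: "w \<in> I"
  have "joined D w (partner w)" using w partner(1)[OF w] A_partner[OF w] I_V by (auto simp: joined_iff)
  then have "partner w \<in> component D I w"
    using component_step[OF component_self w partner(1)[OF w]] by blast
  moreover fix u assume "u \<in> {w, partner w}"
  ultimately show "u \<in> component D I w" using component_self by auto
qed simp

text \<open>The coefficients come from the inverse of the Cartan matrix of \<open>A\<^sub>2\<close>.\<close>

definition \<beta>3 :: "'a \<Rightarrow> 'a \<Rightarrow> real" where
  "\<beta>3 v w = real (2 * A v w + A v (partner w)) / 3"

definition proj3 :: "'a \<Rightarrow> 'a" where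
  "proj3 v = v + (\<Sum>u\<in>I. \<beta>3 v u *\<^sub>R u)"

lemma proj3_orth: "v \<in> V - I \<Longrightarrow> w \<in> I \<Longrightarrow> proj3 v \<bullet> w = 0"
proof -
  assume v: "v \<in> V - I" and w: "w \<in> I"
  let ?p = "partner w"
  have "(\<Sum>u\<in>I. \<beta>3 v u *\<^sub>R u) \<bullet> w = (\<Sum>u\<in>I. \<beta>3 v u * (u \<bullet> w))"
    by (simp add: inner_sum_left)
  also have "\<dots> = (\<Sum>u\<in>{w, ?p}. \<beta>3 v u * (u \<bullet> w))"
  proof (rule sum.mono_neutral_right[OF fin_I])
    show "{w, ?p} \<subseteq> I" using w partner(1) by auto
    show "\<forall>u\<in>I - {w, ?p}. \<beta>3 v u * (u \<bullet> w) = 0"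
      using A_not_partner[OF w] A_eq_0_iff[of _ w] w I_V by auto
  qed
  also have "\<dots> = \<beta>3 v w * (w \<bullet> w) + \<beta>3 v ?p * (?p \<bullet> w)" using partner_neq[OF w] by simp
  also have "?p \<bullet> w = - (w \<bullet> w) / 2"
    using inner_eq[of ?p w] partner[OF w] partner_neq[OF w] w I_V by auto
  finally show ?thesis
    using inner_I[OF v w] partner_partner[OF w] by (simp add: proj3_def inner_add_left \<beta>3_def field_simps)
qed

lemma proj3_norm:
  "v \<in> V - I \<Longrightarrow> v \<bullet> proj3 v = (v \<bullet> v) * (1 - real (\<Sum>w\<in>I. (2 * A v w + A v (partner w)) * A w v) / 6)"
proof -
  assume v: "v \<in> V - I"
  have "v \<bullet> proj3 v = v \<bullet> v + (\<Sum>w\<in>I. \<beta>3 v w * (v \<bullet> w))"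
    by (simp add: proj3_def inner_add_right inner_sum_right)
  also have "(\<Sum>w\<in>I. \<beta>3 v w * (v \<bullet> w)) =
      (\<Sum>w\<in>I. real ((2 * A v w + A v (partner w)) * A w v) * (- (v \<bullet> v) / 6))"
    by (intro sum.cong refl) (simp add: inner_I'[OF v] \<beta>3_def)
  also have "\<dots> = real (\<Sum>w\<in>I. (2 * A v w + A v (partner w)) * A w v) * (- (v \<bullet> v) / 6)"
    by (simp only: of_nat_sum sum_distrib_right)
  finally show ?thesis by (simp add: algebra_simps)
qed

lemma bound3: "v \<in> V - I \<Longrightarrow> (\<Sum>w\<in>I. (2 * A v w + A v (partner w)) * A w v) < 6"
proof -
  assume v: "v \<in> V - I"
  have "proj3 v \<bullet> proj3 v = v \<bullet> proj3 v"
    unfolding proj3_def[of v] inner_add_left inner_sum_left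
    unfolding proj3_def[symmetric] using proj3_orth[OF v] by (simp add: inner_commute)
  moreover have "proj3 v \<noteq> 0"
    unfolding proj3_def using orthogonal_to_removed_nonzero[OF I_V v not_single] .
  ultimately have "0 < (v \<bullet> v) * (1 - real (\<Sum>w\<in>I. (2 * A v w + A v (partner w)) * A w v) / 6)"
    using proj3_norm[OF v] by (metis inner_gt_zero_iff)
  then have "0 < 1 - real (\<Sum>w\<in>I. (2 * A v w + A v (partner w)) * A w v) / 6"
    by (rule zero_less_mult_pos) (use inner_pos[of v] v in simp)
  then show ?thesis by linarith
qed

text \<open>A single removed neighbour \<open>w\<close> has a bond of weight 1 or 2, and the
  relation modulo 3 would make 3 divide \<open>G w\<close>. Each neighbour costs at least 2 of the
  fewer than 6 allowed by \<open>bound3\<close>, so there are two, with simple bonds. They belong to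
  different pairs, since both nodes of one pair would cost 3 each.\<close>

lemma cases3:
  assumes v: "v \<in> V - I"
  obtains (none) "\<And>w. w \<in> I \<Longrightarrow> A w v = 0"
  | (two) w w' where "w \<in> I" "w' \<in> I" "w \<noteq> w'" "w' \<noteq> partner w" "A w v = 1" "A v w = 1"
      "A w' v = 1" "A v w' = 1" "\<And>u. u \<in> I \<Longrightarrow> u \<noteq> w \<Longrightarrow> u \<noteq> w' \<Longrightarrow> A u v = 0"
proof (cases "\<forall>w\<in>I. A w v = 0")
  case True
  then show thesis using none by blast
next
  case False
  then obtain w where w: "w \<in> I" "0 < A w v" by auto
  have vV: "v \<in> V" using v by simp
  have pos: "0 < A v u \<longleftrightarrow> 0 < A u v" if "u \<in> I" for u using that I_V A_pos_sym vV by blast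
  let ?f = "\<lambda>w. (2 * A v w + A v (partner w)) * A w v"
  have sub: "(\<Sum>u\<in>S. ?f u) < 6" if "S \<subseteq> I" for S
    using sum_mono2[OF fin_I that, of ?f] bound3[OF v] by simp
  have f2: "2 * (A v u * A u v) \<le> ?f u" for u by (simp add: algebra_simps)
  have np: "A (partner u) v = 0" if u: "u \<in> I" "0 < A u v" for u
  proof (rule ccontr)
    assume n: "A (partner u) v \<noteq> 0"
    let ?p = "partner u"
    have p: "?p \<in> I" "?p \<noteq> u" "partner ?p = u" using partner(1) partner_neq partner_partner u by auto
    have "?f u + ?f ?p < 6" using sub[of "{u, ?p}"] p u by simp
    moreover have "1 \<le> A v u" "1 \<le> A v ?p" "1 \<le> A u v" "1 \<le> A ?p v" using pos u n p by (auto simp: Suc_le_eq)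
    then have "3 * 1 \<le> ?f u" "3 * 1 \<le> ?f ?p" unfolding p(3) by (intro mult_le_mono; linarith)+
    ultimately show False by linarith
  qed
  have "?f w < 6" using sub[of "{w}"] w by simp
  then have aw: "2 * (A v w * A w v) < 6" using f2[of w] by linarith
  have "A w v \<le> A v w * A w v" using pos[OF w(1)] w(2) by simp
  then have "A w v = 1 \<or> A w v = 2" using aw w(2) by linarith
  have "\<exists>w'\<in>I. w' \<noteq> w \<and> 0 < A w' v"
  proof (rule ccontr)
    assume "\<not> ?thesis"
    then have "(\<Sum>u\<in>I. G u * A u v) = (\<Sum>u\<in>{w}. G u * A u v)"
      using w fin_I by (intro sum.mono_neutral_right) auto
    then have "3 dvd int (G w * A w v) - 2 * int (G v)" using dvd3[OF vV] by simp
    moreover have "3 dvd G v" using v I_def k3 by auto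
    ultimately have "3 dvd G w" using \<open>A w v = 1 \<or> A w v = 2\<close> by (elim disjE; simp; presburger)
    then show False using not_3_dvd w by auto
  qed
  then obtain w' where w': "w' \<in> I" "w' \<noteq> w" "0 < A w' v" by auto
  have two: "A v w = 1 \<and> A w v = 1 \<and> A v w' = 1 \<and> A w' v = 1"
  proof -
    have "?f w + ?f w' < 6" using sub[of "{w, w'}"] w w' by simp
    then have "A v w * A w v + A v w' * A w' v < 3" using f2[of w] f2[of w'] by linarith
    moreover have "0 < A v w * A w v" "0 < A v w' * A w' v" using pos w w' by auto
    ultimately have "A v w * A w v = 1" "A v w' * A w' v = 1" by linarith+
    then show ?thesis by simp
  qed
  have "A u v = 0" if u: "u \<in> I" "u \<noteq> w" "u \<noteq> w'" for u
  proof (rule ccontr)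
    assume "A u v \<noteq> 0"
    then have "0 < A v u * A u v" using pos u by auto
    moreover have "?f w + (?f w' + ?f u) < 6" using sub[of "{w, w', u}"] w w' u by auto
    moreover have "A v w * A w v = 1" "A v w' * A w' v = 1" using two by simp_all
    ultimately show False using f2[of u] f2[of w] f2[of w'] by linarith
  qed
  moreover have "w' \<noteq> partner w" using np[OF w] w'(3) by auto
  ultimately show thesis using that(2)[of w w'] w w' two by blast
qed

definition r3 :: "'a \<Rightarrow> nat" where
  "r3 v = (if \<forall>w\<in>I. A w v = 0 then 1 else 3)"

lemma A_partner_two:
  assumes v: "v \<in> V - I" and w: "w \<in> I" "w' \<in> I" "w' \<noteq> partner w"
    and 0: "\<And>u. u \<in> I \<Longrightarrow> u \<noteq> w \<Longrightarrow> u \<noteq> w' \<Longrightarrow> A u v = 0"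
  shows "A v (partner w) = 0" "A v (partner w') = 0"
proof -
  have n: "partner w \<noteq> w" "partner w' \<noteq> w'" "partner w' \<noteq> w"
    using partner_neq partner_partner w by metis+
  have "A (partner w) v = 0" "A (partner w') v = 0"
    using 0[of "partner w"] 0[of "partner w'"] partner(1) w n by auto
  moreover have "partner w \<in> V" "partner w' \<in> V" using partner(1) w I_V by auto
  ultimately show "A v (partner w) = 0" "A v (partner w') = 0"
    using A_pos_sym v by (metis DiffD1 less_nat_zero_code neq0_conv)+
qed

lemma proj3_norm_r3:
  assumes v: "v \<in> V - I" shows "v \<bullet> proj3 v = (v \<bullet> v) / real (r3 v)"
  using v
proof (cases rule: cases3)
  case none
  then have "r3 v = 1" by (simp add: r3_def)
  then show ?thesis using proj3_norm[OF v] none by simp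
next
  case (two w w')
  have p: "A v (partner w) = 0" "A v (partner w') = 0" using A_partner_two[OF v two(1,2,4)] two(9) by blast+
  have "(\<Sum>u\<in>I. (2 * A v u + A v (partner u)) * A u v) = (\<Sum>u\<in>{w, w'}. (2 * A v u + A v (partner u)) * A u v)"
    using two fin_I by (intro sum.mono_neutral_right) auto
  also have "\<dots> = 4" using two p by simp
  finally show ?thesis using proj3_norm[OF v] two unfolding r3_def by auto
qed

lemma adj_pair: "v \<in> V \<Longrightarrow> adjacent_components D I v = (\<lambda>w. {w, partner w}) ` {w \<in> I. 0 < A w v}"
  unfolding adj_eq by (intro image_cong refl) (simp add: component_pair)

lemma type_A_2_pair: "w \<in> I \<Longrightarrow> type_A D 2 {w, partner w}"
proof -
  assume w: "w \<in> I"
  have V: "w \<in> V" "partner w \<in> V" using w partner(1) I_V by auto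
  show ?thesis
    by (rule type_A_2)
      (use V nodes_D partner_neq[OF w] bond_refl bond_equal_length[OF V] bond_equal_length[OF V(2,1)]
        partner(2)[OF w] A_partner[OF w] in auto)
qed

lemma new_length3:
  assumes v: "v \<in> V - I" shows "new_length D I len v = len v / sqrt (real (r3 v))"
  using v
proof (cases rule: cases3)
  case none
  then have "r3 v = 1" by (simp add: r3_def)
  moreover have e: "{w \<in> I. 0 < A w v} = {}" using none by auto
  have "{w \<in> I. joined D v w} = {}" "adjacent_components D I v = {}"
    using joined_I_eq[of v] adj_pair[of v] v unfolding e by simp_all
  ultimately show ?thesis
    using new_length_type1[OF not_type_inf, of v len] by simp
next
  case (two w w')
  let ?C = "{w, partner w}" and ?C' = "{w', partner w'}"
  have J: "{u \<in> I. 0 < A u v} = {w, w'}" using two by (auto intro: ccontr)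
  then have adj: "adjacent_components D I v = {?C, ?C'}" and jo: "{u \<in> I. joined D v u} = {w, w'}"
    using adj_pair[of v] joined_I_eq[of v] v by auto
  have "w' \<notin> ?C" using two(3,4) by simp
  then have ne: "?C \<noteq> ?C'" by (metis insertI1)
  have card: "card ?C = 2" "card ?C' = 2" using partner_neq[OF two(1)] partner_neq[OF two(2)] by auto
  have sub: "?C \<subseteq> nodes D" "?C' \<subseteq> nodes D" using two(1,2) partner(1) I_V nodes_D by auto
  have ncard: "\<not> type_A D 1 ?C" "\<not> type_A D 3 ?C" "\<not> type_A D 1 ?C'" "\<not> type_A D 3 ?C'"
    using type_A_card[OF _ sub(1)] type_A_card[OF _ sub(2)] card by fastforce+
  have C: "C1 = ?C \<or> C1 = ?C'" if "{?C, ?C'} = {C1, C2}" for C1 C2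
    using that by blast
  have r: "r3 v = 3" using two(1,5) unfolding r3_def by (metis zero_neq_one)
  show ?thesis
    unfolding r
  proof (rule new_length_not_type1[OF not_type_inf two(1)])
    show "joined D v w" using jo by auto
    have "\<not> type2 D I len v"
    proof
      assume "type2 D I len v"
      moreover have "{w, w'} \<noteq> {u}" for u using two(3) by auto
      ultimately obtain C1 C2 where "{?C, ?C'} = {C1, C2}" "type_A D 1 C1"
        unfolding type2_def adj jo by metis
      then show False using C[of C1 C2] ncard by metis
    qed
    then show "type2 D I len v \<longleftrightarrow> (3::nat) = 2" by simp
    have "type3 D I v"
      unfolding type3_def adj using ne type_A_2_pair two(1,2) by (intro exI[of _ ?C] exI[of _ ?C']) auto
    then show "type3 D I v \<longleftrightarrow> (3::nat) = 3" by simp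
    have "\<not> type4 D I len v"
    proof
      assume "type4 D I len v"
      then obtain C1 C2 where "{?C, ?C'} = {C1, C2}" "type_A D 1 C1 \<or> type_A D 3 C1"
        unfolding type4_def adj by metis
      then show False using C[of C1 C2] ncard by metis
    qed
    then show "type4 D I len v \<longleftrightarrow> (3::nat) = 4" by simp
  qed simp
qed

text \<open>A removed node joined to \<open>v\<close> has the length of \<open>v\<close>, and so has
  its partner; hence lengths cancel, and \<open>r3 v = 3\<close> absorbs the denominator of
  \<open>\<beta>3\<close>. If nothing removed is joined to \<open>v\<close>, then
  \<open>N = 0\<close>.\<close>

lemma proj3_integral:
  assumes u: "u \<in> V - I" and v: "v \<in> V - I" and uv: "u \<noteq> v"
  shows "\<exists>m::nat. 2 * real (r3 v) * (u \<bullet> proj3 v) = - real m * (v \<bullet> v)"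
proof -
  define N where "N = (\<Sum>w\<in>I. (2 * A v w + A v (partner w)) * A u w)"
  have *: "real (2 * A v w + A v (partner w)) * (w \<bullet> w) = real (2 * A v w + A v (partner w)) * (v \<bullet> v)"
    if w: "w \<in> I" for w
  proof -
    have A: "A v x = 0 \<or> x \<bullet> x = v \<bullet> v" if x: "x \<in> I" for x
      using v
    proof (cases rule: cases3)
      case none
      then show ?thesis using A_pos_sym[of v x] v x I_V by auto
    next
      case (two a b)
      have "A v x = 0 \<longleftrightarrow> A x v = 0" using A_pos_sym[of v x] v x I_V by auto
      then have "A v x = 0 \<or> A v x = 1 \<and> A x v = 1"
        using two(5-8) two(9)[OF x] by metis
      then show ?thesis using A_sym[of v x] v x I_V by auto
    qed
    show ?thesis using A[OF w] A[OF partner(1)[OF w]] norm_partner[OF w] by auto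
  qed
  have "u \<bullet> proj3 v = u \<bullet> v + (\<Sum>w\<in>I. \<beta>3 v w * (u \<bullet> w))"
    by (simp add: proj3_def inner_add_right inner_sum_right)
  also have "(\<Sum>w\<in>I. \<beta>3 v w * (u \<bullet> w)) =
      (\<Sum>w\<in>I. real ((2 * A v w + A v (partner w)) * A u w) * (- (v \<bullet> v) / 6))"
  proof (intro sum.cong refl)
    fix w assume w: "w \<in> I"
    have "\<beta>3 v w * (u \<bullet> w) = - real (A u w) / 6 * (real (2 * A v w + A v (partner w)) * (w \<bullet> w))"
      unfolding \<beta>3_def inner_I[OF u w] by simp
    also have "\<dots> = real ((2 * A v w + A v (partner w)) * A u w) * (- (v \<bullet> v) / 6)"
      unfolding *[OF w] by simp
    finally show "\<beta>3 v w * (u \<bullet> w) = real ((2 * A v w + A v (partner w)) * A u w) * (- (v \<bullet> v) / 6)" .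
  qed
  also have "\<dots> = real N * (- (v \<bullet> v) / 6)" by (simp only: N_def of_nat_sum sum_distrib_right)
  also have "u \<bullet> v = - real (A u v) * (v \<bullet> v) / 2" using inner_eq u v uv by blast
  finally have eq: "u \<bullet> proj3 v = - real (A u v) * (v \<bullet> v) / 2 + real N * (- (v \<bullet> v) / 6)" .
  show ?thesis
  proof (cases "\<forall>w\<in>I. A w v = 0")
    case True
    then have "A v w = 0" if "w \<in> I" for w using A_pos_sym[of v w] that v I_V by auto
    then have "N = 0" using partner(1) by (simp add: N_def)
    moreover have "r3 v = 1" using True by (simp add: r3_def)
    ultimately show ?thesis using eq by (intro exI[of _ "A u v"]) simp
  next
    case False
    then have "r3 v = 3" by (simp add: r3_def)
    then show ?thesis unfolding eq by (intro exI[of _ "3 * A u v + N"]) (simp add: algebra_simps)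
  qed
qed

text \<open>From \<open>v0\<close> the values of \<open>G\<close> run 1, 2, 3: the balance at
  \<open>v0\<close> modulo 3 gives its partner the value 2, and the balance there leaves 3 for a
  remaining neighbour. \<open>G v0 = 2\<close> is excluded by the odd weight of the bond to the
  partner.\<close>

lemma special3:
  obtains v1 where "v1 \<in> V - I" "G v1 = 3" "\<rho> v1 = 1" "r3 v1 = 3"
proof -
  have v0I: "v0 \<in> I" using v0_in I_def k3 G_v0 by auto
  define u where "u = partner v0"
  have u: "u \<in> I" "u \<in> V" "A u v0 = 1" "A v0 u = 1" "u \<noteq> v0"
    using partner[OF v0I] A_partner[OF v0I] partner_neq[OF v0I] I_V by (auto simp: u_def)
  have G0: "G v0 = 1" using G_v0 u by (metis DiffI odd_one singletonD)
  have \<rho>u: "\<rho> u = 1" using A_\<rho>[OF u(2) v0_in] u \<rho>_v0 by simp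
  have dvd: "3 dvd (\<Sum>x\<in>V-{y}. G x * A x w)" if "w \<in> I" "partner w = y" for w y
  proof (rule dvd_sum)
    fix x assume "x \<in> V - {y}"
    then show "3 dvd G x * A x w" using A_not_partner[of w x] that I_def k3 by (cases "x \<in> I") auto
  qed
  have "2 * G v0 = G u * A u v0 + (\<Sum>x\<in>V-{u}. G x * A x v0)"
    using balance_remove[OF v0_in, of "{u}"] u by simp
  then have Gu: "G u = 2"
    using dvd[OF v0I u_def[symmetric]] G0 u G_pos[OF u(2)] by (auto elim!: dvdE) presburger
  have "2 * G u = G v0 * A v0 u + (\<Sum>x\<in>V-{v0}. G x * A x u)"
    using balance_remove[OF u(2), of "{v0}"] v0_in by simp
  then have s: "(\<Sum>x\<in>V-{v0}. G x * A x u) = 3" using Gu G0 u by simp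
  then obtain y where y: "y \<in> V - {v0}" "G y * A y u \<noteq> 0"
    by (metis (no_types, lifting) sum.neutral zero_neq_numeral)
  have pu: "partner u = v0" using partner_partner[OF v0I] by (simp add: u_def)
  have yR: "y \<in> V - I" using A_not_partner[OF u(1), of y] y pu by auto
  then have "3 dvd G y" using I_def k3 by auto
  then have "3 \<le> G y" using G_pos[of y] y by (auto dest: dvd_imp_le)
  moreover have "G y * A y u \<le> 3"
    using member_le_sum[of y "V - {v0}" "\<lambda>x. G x * A x u"] finite_V y s by simp
  moreover have "G y \<le> G y * A y u" using y by simp
  ultimately have Gy: "G y = 3" by linarith
  then have Ay: "A y u = 1" using y(2) \<open>G y * A y u \<le> 3\<close> by simp
  then have "A u y * \<rho> y = 1" using A_\<rho>[of y u] y u \<rho>u by simp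
  then have "\<rho> y = 1" "A u y = 1" by simp_all
  moreover from this have "r3 y = 3" using u(1) unfolding r3_def by (metis zero_neq_one)
  ultimately show thesis using that yR Gy by blast
qed

theorem is_extended_coroot_diagram3:
  "\<exists>\<Psi> \<Delta>' E' :: 'a set. extended_simple_roots \<Psi> \<Delta>' E' \<and>
    diagram_iso (new_diagram D I len) (extended_coroot_diagram E')"
proof -
  obtain v1 where v1: "v1 \<in> V - I" "G v1 = 3" "\<rho> v1 = 1" "r3 v1 = 3" by (rule special3)
  have r: "r3 v = 1 \<or> r3 v = 3" for v by (simp add: r3_def)
  have G3: "3 dvd G v" if "v \<in> V - I" for v using that I_def k3 by auto
  interpret projected_diagram V G A v0 \<rho> E len 3 I \<beta>3 r3 v1
  proof unfold_locales
    show "0 < \<beta>3 v w \<longleftrightarrow> (\<exists>w'\<in>I. 0 < A w' v \<and> w \<in> component D I w')"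
      if v: "v \<in> V - I" and w: "w \<in> I" for v w
    proof -
      have pos: "0 < A v x \<longleftrightarrow> 0 < A x v" if "x \<in> I" for x using that I_V A_pos_sym v by blast
      have "0 < \<beta>3 v w \<longleftrightarrow> 0 < A v w \<or> 0 < A v (partner w)" by (auto simp: \<beta>3_def)
      also have "\<dots> \<longleftrightarrow> 0 < A w v \<or> 0 < A (partner w) v" using pos w partner(1) by auto
      also have "\<dots> \<longleftrightarrow> (\<exists>w'\<in>I. 0 < A w' v \<and> w \<in> {w', partner w'})"
        using w partner(1) partner_partner by (metis insert_iff singletonD)
      also have "\<dots> \<longleftrightarrow> (\<exists>w'\<in>I. 0 < A w' v \<and> w \<in> component D I w')"
        using component_pair by auto
      finally show ?thesis .
    qed
    show "0 \<le> \<beta>3 v w" for v w by (simp add: \<beta>3_def)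
    show "0 < r3 v" for v using r[of v] by auto
    show "\<rho> v1 * r3 v \<le> \<rho> v * r3 v1" if "v \<in> V - I" for v
      using v1 r[of v] \<rho>_pos[of v] that by auto
    show "3 * \<rho> v1 * r3 v dvd G v * \<rho> v * r3 v1" if "v \<in> V - I" for v
    proof -
      have "r3 v dvd G v" using r[of v] G3[OF that] by auto
      then have "3 * r3 v dvd (G v * \<rho> v) * 3" by (subst mult.commute) (intro mult_dvd_mono dvd_mult2 dvd_refl)
      then show ?thesis using v1 by simp
    qed
  qed (use I_V not_single G3 v1 proj3_orth proj3_norm_r3 new_length3 proj3_integral
      in \<open>simp_all add: proj3_def\<close>)
  show ?thesis by (rule is_extended_coroot_diagram)
qed

end

end

section \<open>Chains starting at the lowest root\<close>

lemma type_A_3: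
  assumes "a \<in> nodes D" "b \<in> nodes D" "c \<in> nodes D" "a \<noteq> b" "b \<noteq> c" "a \<noteq> c"
    and "\<And>x. bond D x x = No_Bond" "bond D a b = Bond 1" "bond D b a = Bond 1"
    and "bond D b c = Bond 1" "bond D c b = Bond 1" "bond D a c = No_Bond" "bond D c a = No_Bond"
    and "\<And>x y. x \<in> {a, b, c} \<Longrightarrow> y \<in> {a, b, c} \<Longrightarrow> \<not> arrow D x y"
  shows "type_A D 3 {a, b, c}"
  unfolding type_A_def diagram_iso_def
proof (intro exI[of _ "\<lambda>u. if u = a then 0 else if u = b then 1 else 2"] conjI)
  have "{..<3} = {0, 1, 2 :: nat}" by auto
  then show "bij_betw (\<lambda>u. if u = a then 0 else if u = b then 1 else 2)
      (nodes (full_subdiagram D {a, b, c})) (nodes (A_diagram 3))"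
    using assms(1-6) by (auto simp: full_subdiagram_def A_diagram_def bij_betw_def inj_on_def)
qed (use assms in \<open>auto simp: full_subdiagram_def A_diagram_def\<close>)

text \<open>Affine type \<open>A\<^sub>1\<close>, which is what remains of \<open>E\<^sub>8\<close>
  for \<open>k = 4\<close>.\<close>

lemma special_node_opposite:
  fixes t :: "'a::euclidean_space"
  assumes t: "t \<noteq> 0"
  shows "special_node {t, - t} (\<lambda>_. 1) (\<lambda>u v. if u = v then 0 else 2) t"
proof -
  have ne: "t \<noteq> - t" using t by (metis add_eq_0_iff scaleR_2 scaleR_eq_0_iff zero_neq_numeral)
  show ?thesis
  proof unfold_locales
    show "\<exists>s. \<forall>v\<in>{t, - t}. c v = s * real 1" if "(\<Sum>v\<in>{t, - t}. c v *\<^sub>R v) = 0" for c :: "'a \<Rightarrow> real"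
    proof -
      have "(c t - c (- t)) *\<^sub>R t = 0" using that ne by (simp add: scaleR_left_diff_distrib)
      then have "c t = c (- t)" using t by simp
      then show ?thesis by auto
    qed
    show "\<exists>m. real 1 * (x \<bullet> x) = real m * (t \<bullet> t)" if "x \<in> {t, - t}" for x
      using that by (intro exI[of _ 1]) auto
  qed (use t ne in auto)
qed

section \<open>Growth of \<open>G\<close> along a path from the lowest root\<close>

context extended_coroots
begin

text \<open>Meant as the end of a path from \<open>v0\<close> along which \<open>G\<close> takes the
  values 1, 2, ..., \<open>m\<close>. Only the last edge is kept, since nothing earlier enters the
  balance at \<open>u\<close>.\<close>

definition chain :: "nat \<Rightarrow> 'a \<Rightarrow> 'a \<Rightarrow> bool" where
  "chain m p u \<longleftrightarrow> p \<in> V \<and> u \<in> V \<and> G u = m \<and> G p + 1 = m \<and> A p u = 1 \<and> A u p = 1 \<and> \<rho> u = 1"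

lemma chain_rest:
  assumes "chain m p u" shows "(\<Sum>b\<in>V-{p}. G b * A b u) = m + 1"
  using balance_remove[of u "{p}"] assms by (auto simp: chain_def)

text \<open>After the share \<open>m - 1\<close> of \<open>p\<close>, the balance at
  \<open>u\<close> leaves \<open>m + 1\<close>. This is exhausted by \<open>b\<close>, so the bond
  is simple and there is no further neighbour.\<close>

lemma chain_next:
  assumes c: "chain m p u" and b: "b \<in> V" "0 < A b u" "G b = m + 1"
  shows "chain (m + 1) u b" "\<And>x. x \<in> V \<Longrightarrow> 0 < A x u \<Longrightarrow> x = p \<or> x = b"
proof -
  have bp: "b \<in> V - {p}" using b c by (auto simp: chain_def)
  have fin: "finite (V - {p})" using finite_V by simp
  have s: "G b * A b u + (\<Sum>x\<in>V-{p}-{b}. G x * A x u) = m + 1"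
    using chain_rest[OF c] sum.remove[OF fin bp, of "\<lambda>x. G x * A x u"] by simp
  have "G b * 1 \<le> G b * A b u" using b(2) by (intro mult_le_mono2) simp
  then have "m + 1 \<le> G b * A b u" using b(3) by simp
  then have "G b * A b u = m + 1" and 0: "(\<Sum>x\<in>V-{p}-{b}. G x * A x u) = 0" using s by linarith+
  then have "(m + 1) * A b u = (m + 1) * 1" using b(3) by (metis mult_1_right)
  then have A: "A b u = 1" by (metis add_is_0 mult_cancel_left one_neq_zero)
  have "A u b * \<rho> b = 1" using A_\<rho>[of b u] A c b(1) by (simp add: chain_def)
  then show "chain (m + 1) u b" using c b A by (simp add: chain_def)
  fix x assume x: "x \<in> V" "0 < A x u"
  have "G x * A x u = 0" if "x \<noteq> p" "x \<noteq> b"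
    using 0 finite_V x that by auto
  then show "x = p \<or> x = b" using x G_pos[OF x(1)] by auto
qed

lemma chain_neighbour_le:
  assumes c: "chain m p u" and no: "\<not> (\<exists>b\<in>V. 0 < A b u \<and> G b = m + 1)" and b: "b \<in> V" "0 < A b u"
  shows "G b \<le> m"
proof (cases "b = p")
  case True
  then show ?thesis using c by (simp add: chain_def)
next
  case False
  then have "G b * A b u \<le> m + 1"
    using member_le_sum[of b "V - {p}" "\<lambda>x. G x * A x u"] finite_V b chain_rest[OF c] by simp
  moreover have "G b \<le> G b * A b u" using b by simp
  moreover have "G b \<noteq> m + 1" using no b by auto
  ultimately show ?thesis by linarith
qed

text \<open>No neighbour of \<open>u\<close> exceeds \<open>m = G u\<close>, and concavity carries
  the bound to all nodes.\<close>

lemma chain_stop_le: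
  assumes c: "chain m p u" and no: "\<not> (\<exists>b\<in>V. 0 < A b u \<and> G b = m + 1)" and v: "v \<in> V"
  shows "G v \<le> m"
  using bounded_by_neighbours[of u m v] chain_neighbour_le[OF c no] c v by (cases "v = u") (auto simp: chain_def)

text \<open>The two exits correspond to \<open>E\<^sub>7\<close> and \<open>E\<^sub>8\<close>.\<close>

lemma chain_stop:
  assumes c: "chain m p u" and m: "4 \<le> m" and no: "\<not> (\<exists>b\<in>V. 0 < A b u \<and> G b = m + 1)"
  obtains y z where "m = 4 \<or> m = 6" "y \<in> V" "y \<noteq> p" "2 * G y = m + 2" "0 < A y u" "A u y = 1"
    "z \<in> V" "z \<noteq> u" "G z = 2" "A z y = 1"
proof -
  have uV: "u \<in> V" and Gu: "G u = m" using c by (auto simp: chain_def)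
  have fin: "finite (V - S)" for S using finite_V by simp
  have half: "m * A u b \<le> 2 * G b" "m \<le> 2 * G b" if b: "b \<in> V" "0 < A b u" for b
  proof -
    show 1: "m * A u b \<le> 2 * G b" using neighbour_le[OF uV b(1)] Gu by simp
    have "0 < A u b" using b A_pos_sym uV by blast
    then have "m \<le> m * A u b" by simp
    then show "m \<le> 2 * G b" using 1 by linarith
  qed
  have next_one: "\<exists>b\<in>V-S. 0 < A b u" if "0 < (\<Sum>b\<in>V-S. G b * A b u)" for S
    using that by (metis (no_types, lifting) mult_0_right neq0_conv sum.neutral)
  note rest = chain_rest[OF c]
  \<comment> \<open>Every neighbour of \<open>u\<close> has \<open>G\<close> at least
    \<open>m / 2\<close>, and those other than \<open>p\<close> share only \<open>m + 1\<close>.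
    This leaves few configurations, each with a neighbour for which \<open>2 * G y\<close> is
    \<open>m + 1\<close> or \<open>m + 2\<close>.\<close>
  have "\<exists>y\<in>V-{p}. 0 < A y u \<and> m + 1 \<le> 2 * G y \<and> 2 * G y \<le> m + 2"
  proof -
    obtain b where b: "b \<in> V - {p}" "0 < A b u" using next_one[of "{p}"] rest by auto
    have "V - {p} - {b} = V - {p, b}" by auto
    then have s: "G b * A b u + (\<Sum>x\<in>V-{p,b}. G x * A x u) = m + 1"
      using rest sum.remove[OF fin b(1), of "\<lambda>x. G x * A x u"] by simp
    have hb: "m \<le> 2 * G b" using half b by simp
    show ?thesis
    proof (cases "(\<Sum>x\<in>V-{p,b}. G x * A x u) = 0")
      case True
      have "G b \<le> m" using chain_neighbour_le[OF c no] b by simp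
      then have "A b u \<noteq> 1" using s True by auto
      then have "2 \<le> A b u" using b(2) by linarith
      then have "G b * 2 \<le> G b * A b u" by simp
      then have "2 * G b \<le> m + 1" using s by linarith
      moreover have "2 * G b \<noteq> m"
      proof
        assume "2 * G b = m"
        then have "G b * A b u = 2 * G b + 1" using s True by simp
        then have "G b dvd 2 * G b + 1" by (metis dvd_triv_left)
        then have "G b dvd 1" by (metis dvd_add_right_iff dvd_triv_right)
        then show False using \<open>2 * G b = m\<close> m by simp
      qed
      ultimately show ?thesis using b hb by (intro bexI[of _ b]) auto
    next
      case False
      then obtain b' where b': "b' \<in> V - {p, b}" "0 < A b' u" using next_one[of "{p, b}"] by auto
      have "V - {p, b} - {b'} = V - {p, b, b'}" by auto
      then have s': "G b * A b u + (G b' * A b' u + (\<Sum>x\<in>V-{p,b,b'}. G x * A x u)) = m + 1"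
        using s sum.remove[OF fin b'(1), of "\<lambda>x. G x * A x u"] by simp
      have hb': "m \<le> 2 * G b'" using half b' by simp
      have le: "G b \<le> G b * A b u" "G b' \<le> G b' * A b' u" using b b' by simp_all
      show ?thesis
      proof (cases "m + 1 \<le> 2 * G b")
        case True
        moreover have "2 * G b \<le> m + 2" using le hb' s' by linarith
        ultimately show ?thesis using b by (intro bexI[of _ b]) auto
      next
        case False
        then have mb: "2 * G b = m" using hb by linarith
        show ?thesis
        proof (cases "m + 1 \<le> 2 * G b'")
          case True
          moreover have "2 * G b' \<le> m + 2" using le hb s' by linarith
          ultimately show ?thesis using b' by (intro bexI[of _ b']) auto
        next
          case False
          then have mb': "G b' = G b" using hb' mb by linarith
          have G2: "2 \<le> G b" using mb m by linarith
          have "G b * (A b u + A b' u) \<le> 2 * G b + 1" using s' mb mb' by (simp add: algebra_simps)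
          moreover have "3 \<le> A b u + A b' u \<Longrightarrow> G b * 3 \<le> G b * (A b u + A b' u)" by simp
          ultimately have "A b u + A b' u = 2" using G2 b(2) b'(2) by linarith
          then have one: "A b u = 1" "A b' u = 1" using b(2) b'(2) by linarith+
          then have r1: "(\<Sum>x\<in>V-{p,b,b'}. G x * A x u) = 1" using s' mb mb' by simp
          then obtain d where d: "d \<in> V - {p, b, b'}" "0 < A d u" using next_one[of "{p, b, b'}"] by auto
          have "G d * A d u \<le> 1"
            using member_le_sum[OF d(1), of "\<lambda>x. G x * A x u"] finite_V r1 by simp
          moreover have "G d \<le> G d * A d u" using d by simp
          ultimately have "G d \<le> 1" by linarith
          then show ?thesis using half(2)[of d] d m by simp
        qed
      qed
    qed
  qed
  then obtain y where y: "y \<in> V" "y \<noteq> p" "0 < A y u" "m + 1 \<le> 2 * G y" "2 * G y \<le> m + 2" by auto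
  have "A u y = 1"
  proof -
    have "0 < A u y" using y A_pos_sym uV by blast
    moreover have "m * 2 \<le> m * A u y" if "2 \<le> A u y" using that by simp
    then have "\<not> 2 \<le> A u y" using half(1)[OF y(1,3)] y(5) m by linarith
    ultimately show ?thesis by linarith
  qed
  \<comment> \<open>Beyond \<open>y\<close> only \<open>2 * G y - m\<close>, that is 1 or 2, is
    left, yet the next node needs \<open>2 * G z \<ge> G y \<ge> 3\<close>. So the remainder and
    \<open>G z\<close> are 2 and \<open>G y \<le> 4\<close>, which leaves \<open>m = 4\<close> and
    \<open>m = 6\<close>.\<close>
  have sy: "2 * G y = m + (\<Sum>z\<in>V-{u}. G z * A z y)"
    using balance_remove[OF y(1), of "{u}"] uV Gu \<open>A u y = 1\<close> by simp
  then have "(\<Sum>z\<in>V-{u}. G z * A z y) \<noteq> 0" using y(4) by linarith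
  then obtain z where z: "z \<in> V - {u}" "0 < A z y"
    by (metis (no_types, lifting) mult_0_right neq0_conv sum.neutral)
  have "G z * A z y \<le> (\<Sum>z\<in>V-{u}. G z * A z y)"
    using member_le_sum[OF z(1), of "\<lambda>z. G z * A z y"] finite_V by simp
  then have z2: "G z * A z y \<le> 2 * G y - m" using sy by linarith
  have zV: "z \<in> V" using z by simp
  have "0 < A y z" using A_pos_sym[OF zV y(1)] z(2) by simp
  then have "G y \<le> G y * A y z" by simp
  then have yz: "G y \<le> 2 * G z" using neighbour_le[OF y(1) zV] by linarith
  have zz: "G z \<le> G z * A z y" using z by simp
  have "G z = 2" using yz zz z2 y(4,5) m by linarith
  moreover have "A z y = 1" using z2 y(5) \<open>G z = 2\<close> z(2) by auto
  moreover have "2 * G y = m + 2" using zz z2 \<open>G z = 2\<close> y(5) by linarith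
  moreover have "m = 4 \<or> m = 6" using yz \<open>G z = 2\<close> \<open>2 * G y = m + 2\<close> m by presburger
  ultimately show thesis using that y z \<open>A u y = 1\<close> by auto
qed

text \<open>A chain of length at least 4 stops only at 4 or 6; from 7 on it would never stop, and
  \<open>G\<close> would be unbounded on the finite set \<open>V\<close>.\<close>

lemma chain_7: "\<not> chain 7 p u"
proof
  assume c: "chain 7 p u"
  have "\<exists>p u. chain (n + 7) p u" for n
  proof (induction n)
    case 0
    then show ?case using c by auto
  next
    case (Suc n)
    then obtain p u where pu: "chain (n + 7) p u" by auto
    show ?case
    proof (cases "\<exists>b\<in>V. 0 < A b u \<and> G b = n + 7 + 1")
      case True
      then show ?thesis using chain_next(1)[OF pu] by auto
    next
      case False
      have "(4::nat) \<le> n + 7" by simp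
      from chain_stop[OF pu this False] have "n + 7 = 4 \<or> n + 7 = 6" by metis
      then show ?thesis by simp
    qed
  qed
  then obtain p u where "chain (Max (G ` V) + 1 + 7) p u" by metis
  then have u: "u \<in> V" and "G u = Max (G ` V) + 8" by (auto simp: chain_def)
  moreover have "G u \<le> Max (G ` V)" using finite_V u by (intro Max_ge) auto
  ultimately show False by linarith
qed

text \<open>If \<open>G v0 = 2\<close>, evenness of the bonds bounds the neighbours by 2, and
  concavity bounds all nodes. So \<open>G v0 = 1\<close>, and for the same reason some neighbour has
  \<open>G > 1\<close>; it takes the whole balance 2 at \<open>v0\<close>.\<close>

lemma v0_neighbour:
  assumes v: "v \<in> V" "3 \<le> G v"
  obtains u where "chain 2 v0 u" "\<And>x. x \<in> V \<Longrightarrow> 0 < A x v0 \<Longrightarrow> x = u" "G v0 = 1"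
proof -
  have G1: "G v0 = 1"
  proof (rule ccontr)
    assume "G v0 \<noteq> 1"
    then have G2: "G v0 = 2" "\<And>v. v \<in> V \<Longrightarrow> v \<noteq> v0 \<Longrightarrow> even (A v v0)" using G_v0 by auto
    have "G b \<le> 2" if b: "b \<in> V" "0 < A b v0" for b
    proof -
      have "b \<noteq> v0" using b A_pos_neq by blast
      then have "even (A b v0)" using G2 b by simp
      then have "2 \<le> A b v0" using b(2) by presburger
      then have "G b * 2 \<le> G b * A b v0" by simp
      then show ?thesis using neighbour_le[OF b(1) v0_in] G2(1) by linarith
    qed
    from bounded_by_neighbours[OF v0_in this _ v(1)] show False
      using G2(1) v(2) by (cases "v = v0") auto
  qed
  obtain u where u: "u \<in> V" "0 < A u v0" "1 < G u"
  proof (rule ccontr)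
    assume no: "\<not> thesis"
    then have "G b \<le> 1" if "b \<in> V" "0 < A b v0" for b using that \<open>\<And>u. \<lbrakk>u \<in> V; 0 < A u v0; 1 < G u\<rbrakk> \<Longrightarrow> thesis\<close> not_le by blast
    from bounded_by_neighbours[OF v0_in this _ v(1)] show False
      using G1 v(2) by (cases "v = v0") auto
  qed
  have s: "2 = G u * A u v0 + (\<Sum>x\<in>V-{u}. G x * A x v0)"
    using balance_remove[OF v0_in, of "{u}"] u G1 by simp
  have "G u \<le> G u * A u v0" using u by simp
  then have "G u = 2" "G u * A u v0 = 2" and 0: "(\<Sum>x\<in>V-{u}. G x * A x v0) = 0" using s u(3) by linarith+
  then have Au: "A u v0 = 1" by simp
  have "A v0 u * \<rho> u = 1" using A_\<rho>[OF u(1) v0_in] Au \<rho>_v0 by simp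
  then have c: "chain 2 v0 u" using \<open>G u = 2\<close> Au G1 u v0_in by (simp add: chain_def)
  have only: "x = u" if x: "x \<in> V" "0 < A x v0" for x
  proof (rule ccontr)
    assume "x \<noteq> u"
    then have "G x * A x v0 = 0" using 0 finite_V x by auto
    then show False using x G_pos[OF x(1)] by simp
  qed
  show thesis using that[OF c only G1] .
qed

lemma chain_extend:
  assumes c: "chain m p u" and v: "v \<in> V" "m < G v"
  obtains b where "chain (m + 1) u b" "\<And>x. x \<in> V \<Longrightarrow> 0 < A x u \<Longrightarrow> x = p \<or> x = b"
proof -
  obtain b where "b \<in> V" "0 < A b u" "G b = m + 1"
    using chain_stop_le[OF c _ v(1)] v(2) not_le by blast
  then show thesis using that chain_next[OF c] by blast
qed

end

section \<open>The diagram of type \<open>E\<^sub>8\<close>\<close>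

context removed_nodes
begin

lemma removed_node_multiple:
  obtains v where "v \<in> V - I" "k dvd G v" "k \<le> G v"
proof -
  obtain v where v: "v \<in> V - I" using nonempty by auto
  then have "k dvd G v" using I_def by auto
  then have "k \<le> G v" using G_pos[of v] v by (auto dest: dvd_imp_le)
  then show thesis using that v \<open>k dvd G v\<close> by blast
qed

text \<open>Affine \<open>E\<^sub>8\<close> with its labels: \<open>c1\<close> to \<open>c5\<close>
  form the long arm, \<open>c6\<close> is the branch node, and the other arms are \<open>x\<close>
  and \<open>y\<close>, \<open>z\<close>. Neighbours are listed so that components can be computed;
  \<open>\<rho>\<close> is recorded at the two nodes with label 4.\<close>

definition E8_diagram :: "'a \<Rightarrow> 'a \<Rightarrow> 'a \<Rightarrow> 'a \<Rightarrow> 'a \<Rightarrow> 'a \<Rightarrow> 'a \<Rightarrow> 'a \<Rightarrow> 'a \<Rightarrow> bool" where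
  "E8_diagram c1 c2 c3 c4 c5 c6 x y z \<longleftrightarrow>
    V = {c1, c2, c3, c4, c5, c6, x, y, z} \<and>
    G c1 = 1 \<and> G c2 = 2 \<and> G c3 = 3 \<and> G c4 = 4 \<and> G c5 = 5 \<and> G c6 = 6 \<and> G x = 3 \<and> G y = 4 \<and> G z = 2 \<and>
    \<rho> c4 = 1 \<and> \<rho> y = 1 \<and>
    A c1 c2 = 1 \<and> A c2 c1 = 1 \<and> A c2 c3 = 1 \<and> A c3 c2 = 1 \<and> A c3 c4 = 1 \<and> A c4 c3 = 1 \<and>
    A c4 c5 = 1 \<and> A c5 c4 = 1 \<and> A c5 c6 = 1 \<and> A c6 c5 = 1 \<and> A x c6 = 1 \<and> A c6 x = 1 \<and>
    A y c6 = 1 \<and> A c6 y = 1 \<and> A z y = 1 \<and> A y z = 1 \<and>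
    (\<forall>v\<in>V. 0 < A v c1 \<longrightarrow> v = c2) \<and> (\<forall>v\<in>V. 0 < A v c2 \<longrightarrow> v = c1 \<or> v = c3) \<and>
    (\<forall>v\<in>V. 0 < A v c3 \<longrightarrow> v = c2 \<or> v = c4) \<and> (\<forall>v\<in>V. 0 < A v c4 \<longrightarrow> v = c3 \<or> v = c5) \<and>
    (\<forall>v\<in>V. 0 < A v c5 \<longrightarrow> v = c4 \<or> v = c6) \<and>
    (\<forall>v\<in>V. 0 < A v c6 \<longrightarrow> v = c5 \<or> v = x \<or> v = y) \<and>
    (\<forall>v\<in>V. 0 < A v x \<longrightarrow> v = c6) \<and> (\<forall>v\<in>V. 0 < A v y \<longrightarrow> v = c6 \<or> v = z) \<and>
    (\<forall>v\<in>V. 0 < A v z \<longrightarrow> v = y)"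

text \<open>Some remaining node has \<open>G \<ge> 4\<close>, so the chain reaches 4. Stopping
  there, as for \<open>E\<^sub>7\<close>, keeps all other labels below 4 and leaves a single node.
  It cannot stop at 5 and cannot pass 6.\<close>

lemma E8_structure:
  assumes k4: "4 \<le> k"
  obtains c1 c2 c3 c4 c5 c6 x y z where "E8_diagram c1 c2 c3 c4 c5 c6 x y z"
proof -
  obtain v where v: "v \<in> V - I" "k dvd G v" "k \<le> G v" by (rule removed_node_multiple)
  have vV: "v \<in> V" and v4: "4 \<le> G v" using v k4 by auto
  have v3: "3 \<le> G v" "2 < G v" "3 < G v" using v4 by auto
  obtain c2 where c2: "chain 2 v0 c2" and n1: "\<And>x. x \<in> V \<Longrightarrow> 0 < A x v0 \<Longrightarrow> x = c2" and G1: "G v0 = 1"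
    using v0_neighbour[OF vV v3(1)] by metis
  obtain c3 where c3: "chain (2 + 1) c2 c3" and n2: "\<And>x. x \<in> V \<Longrightarrow> 0 < A x c2 \<Longrightarrow> x = v0 \<or> x = c3"
    using chain_extend[OF c2 vV v3(2)] by metis
  have c3: "chain 3 c2 c3" using c3 by simp
  obtain c4 where c4: "chain (3 + 1) c3 c4" and n3: "\<And>x. x \<in> V \<Longrightarrow> 0 < A x c3 \<Longrightarrow> x = c2 \<or> x = c4"
    using chain_extend[OF c3 vV v3(3)] by metis
  have c4: "chain 4 c3 c4" using c4 by simp
  have "\<exists>b\<in>V. 0 < A b c4 \<and> G b = 4 + 1"
  proof (rule ccontr)
    assume no: "\<not> ?thesis"
    obtain y where y: "y \<in> V" "y \<noteq> c3" "2 * G y = 4 + 2" "0 < A y c4"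
      using chain_stop[OF c4 _ no] by (metis order_refl)
    have c4V: "c4 \<in> V" "G c4 = 4" using c4 by (auto simp: chain_def)
    have "G b \<le> 3" if b: "b \<in> V" "0 < A b c4" for b
    proof (cases "b = c3 \<or> b = y")
      case True
      then show ?thesis using y c4 by (auto simp: chain_def)
    next
      case False
      have "(\<Sum>x\<in>{y, b}. G x * A x c4) \<le> (\<Sum>x\<in>V-{c3}. G x * A x c4)"
        using y b False finite_V by (intro sum_mono2) auto
      moreover have "y \<noteq> b" using False by auto
      ultimately have "G y * A y c4 + G b * A b c4 \<le> 5" using chain_rest[OF c4] by simp
      moreover have "G y \<le> G y * A y c4" "G b \<le> G b * A b c4" using y b by simp_all
      ultimately show ?thesis using y(3) by linarith
    qed
    from bounded_by_neighbours[OF c4V(1) this] have "G w \<le> 3" if "w \<in> V" "w \<noteq> c4" for w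
      using that c4V(2) by simp
    then have only: "w = c4" if "w \<in> V - I" for w
    proof -
      have "k dvd G w" "0 < G w" using that I_def G_pos by auto
      then have "4 \<le> G w" using k4 by (auto dest: dvd_imp_le)
      then show ?thesis using \<open>\<And>w. w \<in> V \<Longrightarrow> w \<noteq> c4 \<Longrightarrow> G w \<le> 3\<close>[of w] that by force
    qed
    then have "V - I = {c4}" using v(1) by blast
    then show False using not_single by blast
  qed
  then obtain c5 where c5: "c5 \<in> V" "0 < A c5 c4" "G c5 = 4 + 1" by auto
  note n4 = chain_next(2)[OF c4 c5]
  have c5: "chain 5 c4 c5" using chain_next(1)[OF c4 c5] by simp
  have "\<exists>b\<in>V. 0 < A b c5 \<and> G b = 5 + 1"
  proof (rule ccontr)
    assume no: "\<not> ?thesis"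
    have "(4::nat) \<le> 5" by simp
    from chain_stop[OF c5 this no] have "(5::nat) = 4 \<or> (5::nat) = 6" by metis
    then show False by simp
  qed
  then obtain c6 where c6: "c6 \<in> V" "0 < A c6 c5" "G c6 = 5 + 1" by auto
  note n5 = chain_next(2)[OF c5 c6]
  have c6: "chain 6 c5 c6" using chain_next(1)[OF c5 c6] by simp
  have no: "\<not> (\<exists>b\<in>V. 0 < A b c6 \<and> G b = 6 + 1)"
    using chain_next(1)[OF c6] chain_7 by auto
  have "(4::nat) \<le> 6" by simp
  from chain_stop[OF c6 this no] obtain y z where y: "y \<in> V" "y \<noteq> c5" "2 * G y = 6 + 2" "0 < A y c6" "A c6 y = 1"
    and z: "z \<in> V" "z \<noteq> c6" "G z = 2" "A z y = 1" by metis
  have Gy: "G y = 4" using y(3) by simp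
  have V: "v0 \<in> V" "c2 \<in> V" "c3 \<in> V" "c4 \<in> V" "c5 \<in> V" "c6 \<in> V"
    and G: "G c2 = 2" "G c3 = 3" "G c4 = 4" "G c5 = 5" "G c6 = 6"
    and \<rho>6: "\<rho> c4 = 1" "\<rho> c6 = 1"
    and A: "A v0 c2 = 1" "A c2 v0 = 1" "A c2 c3 = 1" "A c3 c2 = 1" "A c3 c4 = 1" "A c4 c3 = 1"
      "A c4 c5 = 1" "A c5 c4 = 1" "A c5 c6 = 1" "A c6 c5 = 1"
    using c2 c3 c4 c5 c6 unfolding chain_def by simp_all
  \<comment> \<open>At the branch node the neighbours other than \<open>c5\<close> share 7:
    \<open>y\<close> takes 4, and one node \<open>x\<close> takes the other 3, since a neighbour of
    a node with label 6 has label at least 3.\<close>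
  have s6: "(\<Sum>b\<in>V-{c5}. G b * A b c6) = 7" using chain_rest[OF c6] by simp
  have yp: "y \<in> V - {c5}" using y by simp
  have s6y: "G y * A y c6 + (\<Sum>b\<in>V-{c5}-{y}. G b * A b c6) = 7"
    using s6 sum.remove[OF _ yp, of "\<lambda>b. G b * A b c6"] finite_V by simp
  have Ay: "A y c6 = 1" and r3: "(\<Sum>b\<in>V-{c5}-{y}. G b * A b c6) = 3"
    using s6y Gy y(4) by (auto, presburger+)?
  obtain x where x: "x \<in> V - {c5} - {y}" "0 < A x c6"
  proof -
    have "\<not> (\<forall>b\<in>V-{c5}-{y}. G b * A b c6 = 0)" using r3 by (metis (no_types, lifting) sum.neutral zero_neq_numeral)
    then show thesis using that by auto
  qed
  have xV: "x \<in> V" using x by simp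
  have s6x: "G x * A x c6 + (\<Sum>b\<in>V-{c5}-{y}-{x}. G b * A b c6) = 3"
    using r3 sum.remove[OF _ x(1), of "\<lambda>b. G b * A b c6"] finite_V by simp
  have A6x: "0 < A c6 x" using A_pos_sym[OF xV V(6)] x(2) by simp
  have nx: "6 * A c6 x \<le> 2 * G x" using neighbour_le[OF V(6) xV] G by simp
  have "G x \<le> G x * A x c6" using x(2) by simp
  then have Gx: "G x = 3" "G x * A x c6 = 3" and 0: "(\<Sum>b\<in>V-{c5}-{y}-{x}. G b * A b c6) = 0"
    using s6x nx A6x by linarith+
  then have Ax: "A x c6 = 1" "A c6 x = 1" using nx A6x by auto
  have n6: "v = c5 \<or> v = x \<or> v = y" if "v \<in> V" "0 < A v c6" for v
  proof (rule ccontr)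
    assume "\<not> ?thesis"
    then have "G v * A v c6 = 0" using 0 finite_V that by auto
    then show False using that G_pos[of v] by simp
  qed
  have nx: "v = c6" if v: "v \<in> V" "0 < A v x" for v
  proof (rule ccontr)
    assume "v \<noteq> c6"
    then have "G v * A v x + 6 \<le> 6" using two_neighbours_le[OF v(1) V(6) xV] Gx Ax G by simp
    then show False using v G_pos[of v] by simp
  qed
  have Ayz: "A y z = 1"
    using neighbour_le[OF y(1) z(1)] Gy z(3) A_pos_sym[OF z(1) y(1)] z(4) by (cases "A y z") auto
  have ny: "v = c6 \<or> v = z" if v: "v \<in> V" "0 < A v y" for v
  proof (rule ccontr)
    assume n: "\<not> ?thesis"
    have "(\<Sum>b\<in>{c6, z, v}. G b * A b y) \<le> (\<Sum>b\<in>V. G b * A b y)"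
      using v V z finite_V by (intro sum_mono2) auto
    moreover have "c6 \<notin> {z, v}" "z \<notin> {v}" using n z(2) by auto
    ultimately have "G c6 * A c6 y + (G z * A z y + G v * A v y) \<le> 2 * G y"
      using balance[OF y(1)] by simp
    then have "6 + (2 + G v * A v y) \<le> 8" using z y(5) G Gy by simp
    then show False using v G_pos[of v] by simp
  qed
  have nz: "v = y" if v: "v \<in> V" "0 < A v z" for v
  proof (rule ccontr)
    assume "v \<noteq> y"
    then have "G v * A v z + 4 \<le> 4" using two_neighbours_le[OF v(1) y(1) z(1)] Gy Ayz z(3) by simp
    then show False using v G_pos[of v] by simp
  qed
  have \<rho>y: "\<rho> y = 1" using A_\<rho>[OF y(1) V(6)] Ay y(5) \<rho>6 by simp
  have "{v0, c2, c3, c4, c5, c6, x, y, z} = V"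
  proof (rule connected_V)
    fix u v assume "u \<in> {v0, c2, c3, c4, c5, c6, x, y, z}" and v: "v \<in> V" "0 < A v u"
    then show "v \<in> {v0, c2, c3, c4, c5, c6, x, y, z}"
      using n1[OF v(1)] n2[OF v(1)] n3[OF v(1)] n4[OF v(1)] n5[OF v(1)] n6[OF v(1)] nx[OF v(1)] ny[OF v(1)] nz[OF v(1)]
      by blast
  qed (use V xV y z in auto)
  then have VE: "V = {v0, c2, c3, c4, c5, c6, x, y, z}" by simp
  have balls: "\<forall>v\<in>V. 0 < A v v0 \<longrightarrow> v = c2" "\<forall>v\<in>V. 0 < A v c2 \<longrightarrow> v = v0 \<or> v = c3"
    "\<forall>v\<in>V. 0 < A v c3 \<longrightarrow> v = c2 \<or> v = c4" "\<forall>v\<in>V. 0 < A v c4 \<longrightarrow> v = c3 \<or> v = c5"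
    "\<forall>v\<in>V. 0 < A v c5 \<longrightarrow> v = c4 \<or> v = c6" "\<forall>v\<in>V. 0 < A v c6 \<longrightarrow> v = c5 \<or> v = x \<or> v = y"
    "\<forall>v\<in>V. 0 < A v x \<longrightarrow> v = c6" "\<forall>v\<in>V. 0 < A v y \<longrightarrow> v = c6 \<or> v = z"
    "\<forall>v\<in>V. 0 < A v z \<longrightarrow> v = y"
    using n1 n2 n3 n4 n5 n6 nx ny nz by simp_all
  have "E8_diagram v0 c2 c3 c4 c5 c6 x y z"
    unfolding E8_diagram_def
    by (intro conjI; fact VE G1 G Gx Gy z(3) \<rho>6(1) \<rho>y A Ax Ay y(5) z(4) Ayz balls)
  then show thesis by (rule that)
qed

end

section \<open>The new diagram of \<open>E\<^sub>8\<close> for \<open>k = 4\<close>\<close>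

context removed_nodes
begin

lemma component_path3:
  assumes I: "{a, b, c} \<subseteq> I" and ab: "A a b = 1" and bc: "A b c = 1"
    and closed: "\<And>u v. u \<in> {a, b, c} \<Longrightarrow> v \<in> I \<Longrightarrow> 0 < A v u \<Longrightarrow> v \<in> {a, b, c}"
  shows "component D I a = {a, b, c}"
proof (rule component_eqI)
  fix u v assume u: "u \<in> {a, b, c}" and v: "v \<in> I" and "joined D u v"
  then have "0 < A v u" using A_pos_sym joined_iff by auto
  from closed[OF u v this] show "v \<in> {a, b, c}" .
next
  have V: "a \<in> V" "b \<in> V" "c \<in> V" using I I_V by auto
  have j: "joined D a b" "joined D b c" using V ab bc by (auto simp: joined_iff)
  have "b \<in> component D I a" using component_step[OF component_self _ _ j(1)] I by auto
  moreover from this have "c \<in> component D I a" using component_step[OF _ _ _ j(2)] I by auto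
  ultimately show "u \<in> component D I a" if "u \<in> {a, b, c}" for u using that component_self by auto
qed simp

lemma type_A_3_path:
  assumes V: "a \<in> V" "b \<in> V" "c \<in> V" and A: "A a b = 1" "A b a = 1" "A b c = 1" "A c b = 1" "A a c = 0"
    and ac: "a \<noteq> c"
  shows "type_A D 3 {a, b, c}"
proof -
  have ne: "a \<noteq> b" "b \<noteq> c" using A A_refl by auto
  have i: "a \<bullet> c = 0" using A_eq_0_iff[OF V(1,3) ac] A by simp
  have b: "bond D a c = No_Bond" "bond D c a = No_Bond" "\<not> arrow D a c" "\<not> arrow D c a"
    using i by (simp_all add: extended_coroot_diagram_def inner_commute)
  show ?thesis
    by (rule type_A_3)
      (use V nodes_D ne ac b bond_refl bond_equal_length[OF V(1,2)] bond_equal_length[OF V(2,1)]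
        bond_equal_length[OF V(2,3)] bond_equal_length[OF V(3,2)] A in auto)
qed

theorem is_extended_coroot_diagram4:
  assumes k4: "4 \<le> k"
  shows "\<exists>\<Psi> \<Delta>' E' :: 'a set. extended_simple_roots \<Psi> \<Delta>' E' \<and>
    diagram_iso (new_diagram D I len) (extended_coroot_diagram E')"
proof -
  obtain c1 c2 c3 c4 c5 c6 x y z where E8: "E8_diagram c1 c2 c3 c4 c5 c6 x y z"
    by (rule E8_structure[OF k4])
  have VE: "V = {c1, c2, c3, c4, c5, c6, x, y, z}" and
    G: "G c1 = 1" "G c2 = 2" "G c3 = 3" "G c4 = 4" "G c5 = 5" "G c6 = 6" "G x = 3" "G y = 4" "G z = 2" and
    \<rho>1: "\<rho> c4 = 1" "\<rho> y = 1" and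
    A: "A c1 c2 = 1" "A c2 c1 = 1" "A c2 c3 = 1" "A c3 c2 = 1" "A c3 c4 = 1" "A c4 c3 = 1"
    "A c4 c5 = 1" "A c5 c4 = 1" "A c5 c6 = 1" "A c6 c5 = 1" "A x c6 = 1" "A c6 x = 1"
    "A y c6 = 1" "A c6 y = 1" "A z y = 1" "A y z = 1" and
    balls: "\<forall>v\<in>V. 0 < A v c1 \<longrightarrow> v = c2" "\<forall>v\<in>V. 0 < A v c2 \<longrightarrow> v = c1 \<or> v = c3"
    "\<forall>v\<in>V. 0 < A v c3 \<longrightarrow> v = c2 \<or> v = c4" "\<forall>v\<in>V. 0 < A v c4 \<longrightarrow> v = c3 \<or> v = c5"
    "\<forall>v\<in>V. 0 < A v c5 \<longrightarrow> v = c4 \<or> v = c6" "\<forall>v\<in>V. 0 < A v c6 \<longrightarrow> v = c5 \<or> v = x \<or> v = y"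
    "\<forall>v\<in>V. 0 < A v x \<longrightarrow> v = c6" "\<forall>v\<in>V. 0 < A v y \<longrightarrow> v = c6 \<or> v = z"
    "\<forall>v\<in>V. 0 < A v z \<longrightarrow> v = y"
    by (insert E8[unfolded E8_diagram_def]; elim conjE; assumption)+
  note n1 = balls(1)[rule_format] and n2 = balls(2)[rule_format] and n3 = balls(3)[rule_format]
    and n4 = balls(4)[rule_format] and n5 = balls(5)[rule_format] and n6 = balls(6)[rule_format]
    and nx = balls(7)[rule_format] and ny = balls(8)[rule_format] and nz = balls(9)[rule_format]
  have V: "c1 \<in> V" "c2 \<in> V" "c3 \<in> V" "c4 \<in> V" "c5 \<in> V" "c6 \<in> V" "x \<in> V" "y \<in> V" "z \<in> V"
    unfolding VE by simp_all
  obtain v where v: "v \<in> V - I" "k dvd G v" "k \<le> G v" by (rule removed_node_multiple)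
  have "G v \<le> 6" using v(1) G VE by auto
  then have "k \<in> {4, 5, 6}" using v(3) k4 by auto
  \<comment> \<open>The labels 5 and 6 occur once each, so \<open>k = 5\<close> and
    \<open>k = 6\<close> would leave a single node.\<close>
  then have k: "k = 4"
  proof (elim insertE emptyE)
    assume k: "k = 5"
    have "V - I = {c5}" unfolding I_def k using V G VE by auto
    then show ?thesis using not_single by blast
  next
    assume k: "k = 6"
    have "V - I = {c6}" unfolding I_def k using V G VE by auto
    then show ?thesis using not_single by blast
  qed
  have R: "V - I = {c4, y}" unfolding I_def k using V G VE by auto
  have inI: "c1 \<in> I" "c2 \<in> I" "c3 \<in> I" "c5 \<in> I" "c6 \<in> I" "x \<in> I" "z \<in> I"
    unfolding I_def k using V G by simp_all
  have notI: "c4 \<notin> I" "y \<notin> I" unfolding I_def k using G by simp_all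
  have ne: "c1 \<noteq> c3" "c5 \<noteq> x" "c4 \<noteq> y" "c3 \<noteq> x" "c3 \<noteq> c5" "c3 \<noteq> c6" "c1 \<noteq> c2" "c2 \<noteq> c3" "c5 \<noteq> c6" "c6 \<noteq> x" "c6 \<noteq> z" "z \<noteq> c5" "z \<noteq> x"
  proof -
    show "c4 \<noteq> y"
    proof
      assume "c4 = y"
      then have "0 < A c6 c4" using A(14) by simp
      from n4[OF V(6) this] show False using G by auto
    qed
    show "c3 \<noteq> x"
    proof
      assume "c3 = x"
      then have "0 < A c6 c3" using A(12) by simp
      from n3[OF V(6) this] show False using G by auto
    qed
  qed (use G in auto)
  have comp1: "component D I c3 = {c3, c2, c1}"
  proof (rule component_path3)
    fix u v assume "u \<in> {c3, c2, c1}" "v \<in> I" "0 < A v u"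
    then show "v \<in> {c3, c2, c1}" using n1[of v] n2[of v] n3[of v] I_V notI by blast
  qed (use inI A in auto)
  have comp2: "component D I c5 = {c5, c6, x}"
  proof (rule component_path3)
    fix u v assume "u \<in> {c5, c6, x}" "v \<in> I" "0 < A v u"
    then show "v \<in> {c5, c6, x}" using n5[of v] n6[of v] nx[of v] I_V notI by blast
  qed (use inI A in auto)
  have comp2': "component D I c6 = {c5, c6, x}"
    using component_eq[OF symp_joined, of c6 I c5] comp2 by simp
  have comp3: "component D I z = {z}"
  proof (rule component_eqI)
    fix u v assume u: "u \<in> {z}" and v: "v \<in> I" "joined D u v"
    then have "0 < A v z" using A_pos_sym joined_iff by auto
    then show "v \<in> {z}" using nz[of v] v I_V notI by blast
  qed (use component_self in auto)
  have J4: "{w \<in> I. 0 < A w c4} = {c3, c5}"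
  proof
    show "{w \<in> I. 0 < A w c4} \<subseteq> {c3, c5}" using n4 I_V by blast
  qed (use inI A in auto)
  have Jy: "{w \<in> I. 0 < A w y} = {c6, z}"
  proof
    show "{w \<in> I. 0 < A w y} \<subseteq> {c6, z}" using ny I_V by blast
  qed (use inI A in auto)
  let ?C1 = "{c3, c2, c1}" and ?C2 = "{c5, c6, x}"
  have adj4: "adjacent_components D I c4 = {?C1, ?C2}" unfolding adj_eq[OF V(4)] J4 using comp1 comp2 by simp
  have adjy: "adjacent_components D I y = {?C2, {z}}" unfolding adj_eq[OF V(8)] Jy using comp2' comp3 by simp
  have jo4: "{w \<in> I. joined D c4 w} = {c3, c5}" using joined_I_eq[OF V(4)] J4 by simp
  have joy: "{w \<in> I. joined D y w} = {c6, z}" using joined_I_eq[OF V(8)] Jy by simp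
  have A0: "A c3 c1 = 0" "A c5 x = 0"
    using n1[OF V(3)] nx[OF V(5)] ne by auto
  have t: "type_A D 3 ?C1" "type_A D 3 ?C2" "type_A D 1 {z}"
    using type_A_3_path[OF V(3,2,1)] type_A_3_path[OF V(5,6,7)] type_A_1[of z D] A A0 ne bond_refl V nodes_D by auto
  have card: "card ?C1 = 3" "card ?C2 = 3" "card {z} = 1" using ne by auto
  have sub: "?C1 \<subseteq> nodes D" "?C2 \<subseteq> nodes D" "{z} \<subseteq> nodes D" using V nodes_D by auto
  have C12: "?C1 \<noteq> ?C2"
  proof
    assume "?C1 = ?C2"
    then have "c3 \<in> ?C2" by (metis insertI1)
    then show False using ne by auto
  qed
  have C2z: "?C2 \<noteq> {z}" using card by (metis numeral_eq_one_iff semiring_norm(84))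
  have nC: "\<not> type_A D 1 ?C1" "\<not> type_A D 2 ?C1" "\<not> type_A D 1 ?C2" "\<not> type_A D 2 ?C2"
    using type_A_card[OF _ sub(1)] type_A_card[OF _ sub(2)] card by fastforce+
  have nl4: "new_length D I len c4 = len c4 / sqrt (real 4)"
  proof (rule new_length_not_type1[OF not_type_inf inI(3)])
    show "joined D c4 c3" using jo4 by auto
    have e: "C1 = ?C1 \<or> C1 = ?C2" if "{?C1, ?C2} = {C1, C2}" for C1 C2
      using that by (metis insert_iff singletonD)
    have "\<not> type2 D I len c4"
    proof
      assume "type2 D I len c4"
      moreover have "{c3, c5} \<noteq> {u}" for u using ne by auto
      ultimately obtain C1 C2 where "{?C1, ?C2} = {C1, C2}" "type_A D 1 C1"
        unfolding type2_def adj4 jo4 by metis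
      then show False using e[of C1 C2] nC by metis
    qed
    then show "type2 D I len c4 \<longleftrightarrow> (4::nat) = 2" by simp
    have "\<not> type3 D I c4"
    proof
      assume "type3 D I c4"
      then obtain C1 C2 where "{?C1, ?C2} = {C1, C2}" "type_A D 2 C1" unfolding type3_def adj4 by metis
      then show False using e[of C1 C2] nC by metis
    qed
    then show "type3 D I c4 \<longleftrightarrow> (4::nat) = 3" by simp
    have "type4 D I len c4"
      unfolding type4_def adj4 using t C12 by (intro exI[of _ ?C1] exI[of _ ?C2]) simp
    then show "type4 D I len c4 \<longleftrightarrow> (4::nat) = 4" by simp
  qed simp
  have nly: "new_length D I len y = len y / sqrt (real 4)"
  proof (rule new_length_not_type1[OF not_type_inf inI(5)])
    show "joined D y c6" using joy by auto
    have e: "C1 = ?C2 \<or> C2 = ?C2" if "{?C2, {z}} = {C1, C2}" for C1 C2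
      using that by (metis insert_iff singletonD)
    have "\<not> type2 D I len y"
    proof
      assume "type2 D I len y"
      moreover have "{c6, z} \<noteq> {u}" for u using ne by auto
      ultimately obtain C1 C2 where "{?C2, {z}} = {C1, C2}" "type_A D 1 C1" "type_A D 1 C2"
        unfolding type2_def adjy joy by metis
      then show False using e[of C1 C2] nC by metis
    qed
    then show "type2 D I len y \<longleftrightarrow> (4::nat) = 2" by simp
    have "\<not> type3 D I y"
    proof
      assume "type3 D I y"
      then obtain C1 C2 where "{?C2, {z}} = {C1, C2}" "type_A D 2 C1" "type_A D 2 C2"
        unfolding type3_def adjy by metis
      then show False using e[of C1 C2] nC by metis
    qed
    then show "type3 D I y \<longleftrightarrow> (4::nat) = 3" by simp
    have "type4 D I len y"
      unfolding type4_def adjy using t C2z by (intro exI[of _ ?C2] exI[of _ "{z}"]) simp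
    then show "type4 D I len y \<longleftrightarrow> (4::nat) = 4" by simp
  qed simp
  \<comment> \<open>Both remaining nodes are of Type 4 and have equal lengths, which are halved. Two
    opposite vectors of that length realise the result.\<close>
  define t where "t = (1/2) *\<^sub>R c4"
  define f where "f v = (if v = c4 then t else - t)" for v
  have t0: "t \<noteq> 0" using V(4) zero_notin_V by (auto simp: t_def)
  have tt: "t \<noteq> - t" using t0 by (metis add_eq_0_iff scaleR_2 scaleR_eq_0_iff zero_neq_numeral)
  have fR: "f ` {c4, y} = {t, - t}" using ne(3) by (auto simp: f_def)
  have RD: "nodes D - I = {c4, y}" using R nodes_D by simp
  interpret P: special_node "{t, - t}" "\<lambda>_. 1" "\<lambda>u v. if u = v then 0 else 2" t
    by (rule special_node_opposite[OF t0])
  have "diagram_iso (new_diagram D I len) (extended_coroot_diagram (coroot ` f ` (nodes D - I)))"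
  proof (rule diagram_iso_new_diagram)
    show "inj_on f (nodes D - I)" unfolding RD using ne(3) tt by (auto simp: f_def inj_on_def)
    show "affine_coroots (f ` (nodes D - I)) (\<lambda>_. 1) (\<lambda>u v. if u = v then 0 else 2)"
      unfolding RD fR by (rule P.affine_coroots_axioms)
    show "0 < len v0 / norm v0" by (rule scale_pos)
    have "c4 \<bullet> c4 = y \<bullet> y" using \<rho> \<rho>1 V by metis
    then have n: "norm c4 = norm y" by (simp add: norm_eq)
    show "new_length D I len v = len v0 / norm v0 * norm (f v)" if "v \<in> nodes D - I" for v
      using that nl4 nly len_eq[OF V(4)] len_eq[OF V(8)] n ne(3) unfolding RD
      by (auto simp: f_def t_def)
    have "adjacent_components D I c4 \<inter> adjacent_components D I y \<noteq> {}" unfolding adj4 adjy by blast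
    then have "new_joined D I c4 y" "new_joined D I y c4"
      unfolding new_joined_def RD using ne(3) by (simp_all add: Int_commute)
    then show "new_joined D I u v \<longleftrightarrow> u \<noteq> v \<and> f u \<bullet> f v \<noteq> 0" if "u \<in> nodes D - I" "v \<in> nodes D - I" for u v
      using that ne(3) t0 unfolding RD by (auto simp: f_def new_joined_def)
  qed
  then show ?thesis using P.extended_simple_roots_roots unfolding RD fR by auto
qed

end

section \<open>Elimination of \<open>n0\<close> and the cases for \<open>k\<close>\<close>

theorem proposition1p7p3:
  fixes \<Phi> \<Delta> E :: "'a::euclidean_space set"
    and g n :: "'a \<Rightarrow> nat" and n0 k :: nat and len :: "'a \<Rightarrow> real"
  assumes "extended_simple_roots \<Phi> \<Delta> E"
    and "coroot_integers E g"
    and "n0 > 0"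
    and "\<forall>a\<in>E. n a = n0 * g a"
    and "k \<ge> 1"
    and "\<exists>a\<in>E. k dvd n a"
    and "length_function (extended_coroot_diagram E) len"
  shows "\<exists>\<Psi> \<Delta>' E' :: 'a set. extended_simple_roots \<Psi> \<Delta>' E' \<and>
    diagram_iso (diagram_nk E n k len) (extended_coroot_diagram E')"
proof -
  define V where "V = coroot ` E"
  define G where "G v = g (coroot v)" for v
  define k' where "k' = k div gcd k n0"
  define I where "I = {v \<in> V. \<not> k' dvd G v}"
  have dvd: "k dvd n0 * m \<longleftrightarrow> k' dvd m" for m
  proof -
    let ?d = "gcd k n0"
    have cop: "coprime (k div ?d) (n0 div ?d)" using assms(3) by (intro div_gcd_coprime) simp
    have "k = ?d * k'" "n0 = ?d * (n0 div ?d)" by (simp_all add: k'_def)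
    then have "k dvd n0 * m \<longleftrightarrow> ?d * k' dvd ?d * (n0 div ?d * m)" by (metis mult.assoc)
    also have "\<dots> \<longleftrightarrow> k' dvd n0 div ?d * m" using assms(3) by simp
    also have "\<dots> \<longleftrightarrow> k' dvd m" using cop unfolding k'_def by (rule coprime_dvd_mult_right_iff)
    finally show ?thesis .
  qed
  have "coroot ` {a \<in> E. \<not> k dvd n a} = I"
    using assms(4) dvd unfolding I_def V_def G_def by auto
  then have nk: "diagram_nk E n k len = new_diagram (extended_coroot_diagram E) I len"
    by (simp add: diagram_nk_def)
  have nodes: "nodes (extended_coroot_diagram E) = V" by (simp add: extended_coroot_diagram_def V_def)
  obtain a where "a \<in> E" "k' dvd g a" using assms(4,6) dvd by auto
  then have "coroot a \<in> V - I" unfolding I_def V_def G_def by simp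
  then have ne: "V - I \<noteq> {}" by blast
  have "k' \<noteq> 0" unfolding k'_def using assms(5) by (simp add: dvd_div_eq_0_iff)
  show ?thesis
  \<comment> \<open>A single remaining node gives the diagram of the zero root system. This also
    covers \<open>E = {0}\<close>, so that afterwards \<open>E\<close> comes from an irreducible
    root system.\<close>
  proof (cases "\<exists>v. V - I = {v}")
    case True
    then show ?thesis
      using diagram_iso_single_node[of "extended_coroot_diagram E" I] extended_simple_roots_zero
      unfolding nk nodes by blast
  next
    case False
    have "E \<noteq> {0}"
    proof
      assume "E = {0}"
      moreover have "coroot 0 = (0 :: 'a)" by simp
      ultimately have "V = {0}" unfolding V_def by simp
      then have "V - I = {0}" using ne by auto
      then show False using False by blast
    qed
    then obtain \<theta> where irr: "irreducible_root_system \<Phi>" "simple_roots \<Phi> \<Delta>" "highest_root \<Phi> \<Delta> \<theta>"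
      "E = insert (- \<theta>) \<Delta>"
      using assms(1) unfolding extended_simple_roots_def by auto
    interpret root_data \<Phi> \<Delta> \<theta> by (rule root_data.intro[OF irr(1-3)])
    obtain A \<rho> where "extended_coroots V G A (coroot (- \<theta>)) \<rho>"
      using extended_coroots[OF irr(4) assms(2)] unfolding V_def G_def by blast
    then interpret coroot_diagram V G A "coroot (- \<theta>)" \<rho> E len
      using assms(7) V_def by (simp add: coroot_diagram_def coroot_diagram_axioms_def)
    interpret removed_nodes V G A "coroot (- \<theta>)" \<rho> E len k' I
      using False ne by unfold_locales (auto simp: I_def)
    consider "k' = 1" | "k' = 2" | "k' = 3" | "4 \<le> k'" using \<open>k' \<noteq> 0\<close> by linarith
    then show ?thesis
    proof cases
      case 1
      then have "I = {}" by (simp add: I_def)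
      then show ?thesis
        using diagram_iso_no_nodes_removed False assms(1) unfolding nk by auto
    qed (use is_extended_coroot_diagram2 is_extended_coroot_diagram3 is_extended_coroot_diagram4 in
        \<open>simp_all only: nk\<close>)
  qed
qed

end
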